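(* For every finite Clifford semigroup $S$, the problem $\mathrm{SMP}(S)$ is in $\mathrm{P}$.
   Context: For a fixed finite semigroup $S$, the subpower membership problem $\mathrm{SMP}(S)$ is the following decision problem. Input: $n\in\mathbb{N}$ and tuples $\{a_1,\ldots,a_k\}\subseteq S^n$, $b\in S^n$. Problem: is $b$ in the subsemigroup $\langle a_1,\ldots,a_k\rangle$ of the direct power $S^n$ (componentwise multiplication) generated by $\{a_1,\ldots,a_k\}$, i.e. is $b$ a nonempty finite product of elements of $\{a_1,\dots,a_k\}$? The semigroup $S$ is not part of the input; the input size is essentially $n(k+1)$. A semigroup is completely regular if each of its elements is contained in a subsemigroup that is also a group. A semigroup is a Clifford semigroup if it is completely regular and its idempotents are central. *)

theory Defs
  imports "HOL-Algebra.Group" "HOL-Computational_Algebra.Polynomial"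
begin

section \<open>Clifford semigroups\<close>

definition semigroup_on :: "'a set \<Rightarrow> ('a \<Rightarrow> 'a \<Rightarrow> 'a) \<Rightarrow> bool" where
  "semigroup_on S f \<longleftrightarrow>
     (\<forall>x\<in>S. \<forall>y\<in>S. f x y \<in> S) \<and>
     (\<forall>x\<in>S. \<forall>y\<in>S. \<forall>z\<in>S. f (f x y) z = f x (f y z))"

definition subsemigroup_on :: "'a set \<Rightarrow> 'a set \<Rightarrow> ('a \<Rightarrow> 'a \<Rightarrow> 'a) \<Rightarrow> bool" where
  "subsemigroup_on H S f \<longleftrightarrow> H \<subseteq> S \<and> (\<forall>x\<in>H. \<forall>y\<in>H. f x y \<in> H)"

definition completely_regular_on :: "'a set \<Rightarrow> ('a \<Rightarrow> 'a \<Rightarrow> 'a) \<Rightarrow> bool" where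
  "completely_regular_on S f \<longleftrightarrow> semigroup_on S f \<and>
     (\<forall>x\<in>S. \<exists>H e. x \<in> H \<and> subsemigroup_on H S f \<and>
        group \<lparr>carrier = H, monoid.mult = f, one = e\<rparr>)"

definition clifford_semigroup_on :: "'a set \<Rightarrow> ('a \<Rightarrow> 'a \<Rightarrow> 'a) \<Rightarrow> bool" where
  "clifford_semigroup_on S f \<longleftrightarrow> completely_regular_on S f \<and>
     (\<forall>e\<in>S. f e e = e \<longrightarrow> (\<forall>x\<in>S. f e x = f x e))"


section \<open>Deterministic Turing machines and the class P\<close>

text \<open>
  Machines have a fixed number of two-way infinite tapes. Tape symbols are the blank, the
  letters of the input alphabet, and auxiliary symbols; each machine uses only finitely many.
\<close>

datatype 'a tape_symbol = Blank | Letter 'a | Aux nat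

datatype move = Left | Stay | Right

record 'a tm =
  tm_tapes :: nat
  tm_states :: "nat set"
  tm_symbols :: "'a tape_symbol set"
  tm_start :: nat
  tm_accept :: nat
  tm_reject :: nat
  tm_delta :: "nat \<Rightarrow> 'a tape_symbol list \<Rightarrow> nat \<times> ('a tape_symbol \<times> move) list"

definition turing_machine :: "'a set \<Rightarrow> 'a tm \<Rightarrow> bool" where
  "turing_machine \<Sigma> M \<longleftrightarrow>
     1 \<le> tm_tapes M \<and>
     finite (tm_states M) \<and> finite (tm_symbols M) \<and>
     Blank \<in> tm_symbols M \<and> Letter ` \<Sigma> \<subseteq> tm_symbols M \<and>
     {tm_start M, tm_accept M, tm_reject M} \<subseteq> tm_states M \<and>
     tm_accept M \<noteq> tm_reject M \<and>
     (\<forall>q \<in> tm_states M - {tm_accept M, tm_reject M}.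
        \<forall>xs \<in> lists (tm_symbols M). length xs = tm_tapes M \<longrightarrow>
          (case tm_delta M q xs of (q', acts) \<Rightarrow>
             q' \<in> tm_states M \<and> length acts = tm_tapes M \<and>
             fst ` set acts \<subseteq> tm_symbols M))"

text \<open>A tape is its contents together with the head position.\<close>

type_synonym 'a tape = "(int \<Rightarrow> 'a tape_symbol) \<times> int"

type_synonym 'a config = "nat \<times> 'a tape list"

fun head_symbol :: "'a tape \<Rightarrow> 'a tape_symbol" where
  "head_symbol (c, i) = c i"

fun offset :: "move \<Rightarrow> int" where
  "offset Left = - 1"
| "offset Stay = 0"
| "offset Right = 1"

fun act :: "'a tape_symbol \<times> move \<Rightarrow> 'a tape \<Rightarrow> 'a tape" where
  "act (x, d) (c, i) = (c(i := x), i + offset d)"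

text \<open>The accepting and the rejecting state are halting: their configurations are fixed.\<close>

fun tm_step :: "'a tm \<Rightarrow> 'a config \<Rightarrow> 'a config" where
  "tm_step M (q, ts) =
     (if q = tm_accept M \<or> q = tm_reject M then (q, ts)
      else (case tm_delta M q (map head_symbol ts) of
              (q', acts) \<Rightarrow> (q', map2 act acts ts)))"

definition blank_tape :: "'a tape" where
  "blank_tape = ((\<lambda>_. Blank), 0)"

definition input_tape :: "'a list \<Rightarrow> 'a tape" where
  "input_tape w =
     ((\<lambda>i. if 0 \<le> i \<and> i < int (length w) then Letter (w ! nat i) else Blank), 0)"

definition initial_config :: "'a tm \<Rightarrow> 'a list \<Rightarrow> 'a config" where
  "initial_config M w =
     (tm_start M, input_tape w # replicate (tm_tapes M - 1) blank_tape)"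

definition decides_in_time ::
  "'a set \<Rightarrow> 'a tm \<Rightarrow> 'a list set \<Rightarrow> (nat \<Rightarrow> nat) \<Rightarrow> bool" where
  "decides_in_time \<Sigma> M L T \<longleftrightarrow>
     (\<forall>w \<in> lists \<Sigma>. \<exists>t \<le> T (length w).
        fst ((tm_step M ^^ t) (initial_config M w)) =
          (if w \<in> L then tm_accept M else tm_reject M))"

definition class_P :: "'a set \<Rightarrow> 'a list set set" where
  "class_P \<Sigma> = {L. L \<subseteq> lists \<Sigma> \<and>
     (\<exists>M (p :: nat poly). turing_machine \<Sigma> M \<and> decides_in_time \<Sigma> M L (poly p))}"


section \<open>The subpower membership problem\<close>

text \<open>Elements of the direct power are lists of length \<open>n\<close>, multiplied by \<open>map2 f\<close>.\<close>

definition power_carrier :: "'a set \<Rightarrow> nat \<Rightarrow> 'a list set" where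
  "power_carrier S n = {x \<in> lists S. length x = n}"

inductive_set generated :: "('b \<Rightarrow> 'b \<Rightarrow> 'b) \<Rightarrow> 'b set \<Rightarrow> 'b set"
  for f :: "'b \<Rightarrow> 'b \<Rightarrow> 'b" and A :: "'b set" where
  gen: "a \<in> A \<Longrightarrow> a \<in> generated f A"
| mult: "x \<in> generated f A \<Longrightarrow> y \<in> generated f A \<Longrightarrow> f x y \<in> generated f A"

text \<open>
  An instance is written as the word \<open>a\<^sub>1 | \<dots> | a\<^sub>k | b |\<close> with the elements of \<open>S\<close> as letters and
  the delimiter \<open>|\<close> represented by \<^term>\<open>None\<close>. Its length is \<open>(n + 1) * (k + 1)\<close>; the
  exponent \<open>n\<close> can be read off as the length of \<open>b\<close>.
\<close>

definition smp_alphabet :: "'a set \<Rightarrow> 'a option set" where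
  "smp_alphabet S = insert None (Some ` S)"

definition encode_tuple :: "'a list \<Rightarrow> 'a option list" where
  "encode_tuple x = map Some x @ [None]"

definition encode_instance :: "'a list list \<Rightarrow> 'a list \<Rightarrow> 'a option list" where
  "encode_instance as b = concat (map encode_tuple (as @ [b]))"

definition SMP :: "'a set \<Rightarrow> ('a \<Rightarrow> 'a \<Rightarrow> 'a) \<Rightarrow> 'a option list set" where
  "SMP S f = {encode_instance as b | n as b.
     set as \<subseteq> power_carrier S n \<and> b \<in> power_carrier S n \<and>
     b \<in> generated (map2 f) (set as)}"

lemma encode_tuple_append_eq:
  "encode_tuple x @ u = encode_tuple y @ v \<longleftrightarrow> x = y \<and> u = v"
proof (induction x arbitrary: y)
  case Nil
  then show ?case by (cases y) (auto simp: encode_tuple_def)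
next
  case (Cons a x)
  then show ?case by (cases y) (auto simp: encode_tuple_def)
qed

lemma encode_instance_inject:
  "encode_instance as b = encode_instance as' b' \<longleftrightarrow> as = as' \<and> b = b'"
proof -
  have "concat (map encode_tuple xs) = concat (map encode_tuple ys) \<Longrightarrow> xs = ys"
    for xs ys :: "'a list list"
  proof (induction xs arbitrary: ys)
    case Nil
    then show ?case by (cases ys) (auto simp: encode_tuple_def)
  next
    case (Cons x xs)
    then show ?case
      by (cases ys) (auto simp: encode_tuple_append_eq, simp add: encode_tuple_def)
  qed
  from this[of "as @ [b]" "as' @ [b']"] show ?thesis
    by (auto simp: encode_instance_def simp del: map_append concat_append)
qed

end

theory Submission
  imports Defs "HOL-Algebra.Multiplicative_Group"
begin

text \<open>
  For a Clifford semigroup, \<open>b\<close> is a product of generators iff the generators \<open>a \<ge> b\<close> in the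
  semilattice of idempotents meet in the idempotent \<open>e\<close> of \<open>b\<close>, and \<open>b\<close> lies in the group
  generated by their multiples \<open>a e\<close>. Membership in a subgroup of a direct power of groups is
  decided by a variant of the Furst-Hopcroft-Luks sifting algorithm: a table holds at most one
  element for each first nontrivial coordinate and value there, and it is complete once all products
  of two table elements sift to the identity. The algorithm only ever combines tuples coordinatewise,
  so it can be run by a program that moves tuples between finitely many stacks in synchronized
  sweeps, and such a program is a multitape Turing machine with one tape per stack.
\<close>

section \<open>Stack programs\<close>

text \<open>The subgroup in question can have exponentially many elements, so it is never listed.
  The tuples that are trivial in the first \<open>i\<close> coordinates form a descending chain of
  subgroups, and in a complete table the entries with first nontrivial coordinate \<open>i\<close>
  stand for the nontrivial cosets of one member of the chain in the previous one; the number of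
  entries is at most the tuple length times the number of letters. Closure under products of two
  entries suffices because such a product must sift back through the same entries: this allows
  deeper factors to be moved past shallower ones, as conjugation would. Inverses come from
  finiteness. Hence every test is local to one column. The cost model offers no random access, so
  each operation is a sweep linear in the tuple length, and a bound on the number of sweeps becomes
  a bound on machine time.\<close>

datatype 'b op = Keep | Pop | Push "'b tape_symbol" | Put "'b tape_symbol"

text \<open>\<open>Pop\<close> leaves an empty stack empty and \<open>Put\<close> creates an entry
  on it. This is how a tape behaves that is blank from the head on, so no operation ever
  fails.\<close>

fun apply_op :: "'b op \<Rightarrow> 'b tape_symbol list \<Rightarrow> 'b tape_symbol list" where
  "apply_op Keep xs = xs"
| "apply_op Pop xs = tl xs"
| "apply_op (Push x) xs = x # xs"
| "apply_op (Put x) xs = x # tl xs"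

fun op_symbols :: "'b op \<Rightarrow> 'b tape_symbol set" where
  "op_symbols (Push x) = {x}"
| "op_symbols (Put x) = {x}"
| "op_symbols _ = {}"

definition nth_blank :: "'b tape_symbol list \<Rightarrow> nat \<Rightarrow> 'b tape_symbol" where
  "nth_blank xs k = (if k < length xs then xs ! k else Blank)"

type_synonym 'b store = "nat \<Rightarrow> 'b tape_symbol list"

definition tops :: "'b store \<Rightarrow> nat \<Rightarrow> 'b tape_symbol" where
  "tops \<sigma> r = nth_blank (\<sigma> r) 0"

text \<open>One instruction sees the tops of all stacks and acts on all of them at once, like a
  transition of a multitape machine; this makes columnwise processing of several tuples
  possible.\<close>

type_synonym 'b instr = "(nat \<Rightarrow> 'b tape_symbol) \<Rightarrow> nat \<Rightarrow> 'b op"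

definition update :: "'b instr \<Rightarrow> 'b store \<Rightarrow> 'b store" where
  "update g \<sigma> r = apply_op (g (tops \<sigma>) r) (\<sigma> r)"

datatype 'b cmd =
  Do "'b instr"
| Seq "'b cmd" "'b cmd"
| Cond "(nat \<Rightarrow> 'b tape_symbol) \<Rightarrow> bool" "'b cmd" "'b cmd"
| Loop "(nat \<Rightarrow> 'b tape_symbol) \<Rightarrow> bool" "'b cmd"

text \<open>The counter is the exact number of steps of the compiled control: two for
  \<open>Do\<close>, because a push moves before it writes, and one for each unfolding of
  \<open>Seq\<close>, \<open>Cond\<close> or \<open>Loop\<close>.\<close>

inductive exec :: "'b cmd \<Rightarrow> 'b store \<Rightarrow> nat \<Rightarrow> 'b store \<Rightarrow> bool" where
  exec_Do: "exec (Do g) \<sigma> 2 (update g \<sigma>)"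
| exec_Seq: "exec a \<sigma> s \<sigma>' \<Longrightarrow> exec b \<sigma>' t \<sigma>'' \<Longrightarrow> exec (Seq a b) \<sigma> (Suc (s + t)) \<sigma>''"
| exec_Cond: "exec (if p (tops \<sigma>) then a else b) \<sigma> t \<sigma>' \<Longrightarrow> exec (Cond p a b) \<sigma> (Suc t) \<sigma>'"
| exec_exit: "\<not> p (tops \<sigma>) \<Longrightarrow> exec (Loop p a) \<sigma> 1 \<sigma>"
| exec_iterate: "p (tops \<sigma>) \<Longrightarrow> exec a \<sigma> s \<sigma>' \<Longrightarrow> exec (Loop p a) \<sigma>' t \<sigma>'' \<Longrightarrow>
    exec (Loop p a) \<sigma> (Suc (s + t)) \<sigma>''"

section \<open>Total correctness within a time bound\<close>

definition wp :: "'b cmd \<Rightarrow> nat \<Rightarrow> ('b store \<Rightarrow> bool) \<Rightarrow> 'b store \<Rightarrow> bool" where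
  "wp c n Q \<sigma> \<longleftrightarrow> (\<exists>t \<sigma>'. exec c \<sigma> t \<sigma>' \<and> t \<le> n \<and> Q \<sigma>')"

lemma wp_Do: "Q (update g \<sigma>) \<Longrightarrow> 2 \<le> n \<Longrightarrow> wp (Do g) n Q \<sigma>"
  unfolding wp_def by (blast intro: exec_Do)

lemma wp_Seq:
  assumes "wp a m (wp b n Q) \<sigma>" "Suc (m + n) \<le> k"
  shows "wp (Seq a b) k Q \<sigma>"
proof -
  obtain s \<sigma>' t \<sigma>'' where "exec a \<sigma> s \<sigma>'" "s \<le> m" "exec b \<sigma>' t \<sigma>''" "t \<le> n" "Q \<sigma>''"
    using assms(1) unfolding wp_def by blast
  then show ?thesis
    using exec_Seq[of a \<sigma> s \<sigma>' b t \<sigma>''] assms(2) unfolding wp_def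
    by (intro exI[of _ "Suc (s + t)"] exI[of _ \<sigma>'']) auto
qed

lemma wp_Cond:
  assumes "p (tops \<sigma>) \<Longrightarrow> wp a n Q \<sigma>" "\<not> p (tops \<sigma>) \<Longrightarrow> wp b n Q \<sigma>" "Suc n \<le> k"
  shows "wp (Cond p a b) k Q \<sigma>"
proof -
  have "wp (if p (tops \<sigma>) then a else b) n Q \<sigma>" using assms(1,2) by simp
  then obtain t \<sigma>' where "exec (if p (tops \<sigma>) then a else b) \<sigma> t \<sigma>'" "t \<le> n" "Q \<sigma>'"
    unfolding wp_def by blast
  then show ?thesis
    using exec_Cond[of p \<sigma> a b t \<sigma>'] assms(3) unfolding wp_def
    by (intro exI[of _ "Suc t"] exI[of _ \<sigma>']) auto
qed

lemma wp_mono: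
  assumes "wp c m P \<sigma>" "m \<le> n" "\<And>\<tau>. P \<tau> \<Longrightarrow> Q \<tau>"
  shows "wp c n Q \<sigma>"
  using assms unfolding wp_def by (meson order_trans)

text \<open>The index of the invariant is also the variant: it bounds the number of rounds left,
  each of which costs \<open>m\<close> steps for the body and one for the test.\<close>

lemma wp_Loop:
  assumes body: "\<And>k \<tau>. I k \<tau> \<Longrightarrow> p (tops \<tau>) \<Longrightarrow> wp a m (\<lambda>\<tau>'. \<exists>k'<k. I k' \<tau>') \<tau>"
    and exit: "\<And>k \<tau>. I k \<tau> \<Longrightarrow> \<not> p (tops \<tau>) \<Longrightarrow> Q \<tau>"
    and "I v \<sigma>" "Suc (v * Suc m) \<le> n"
  shows "wp (Loop p a) n Q \<sigma>"
proof -
  have "wp (Loop p a) (Suc (v * Suc m)) Q \<sigma>" using \<open>I v \<sigma>\<close>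
  proof (induction v arbitrary: \<sigma> rule: less_induct)
    case (less v)
    show ?case
    proof (cases "p (tops \<sigma>)")
      case True
      obtain s \<tau> k where s: "exec a \<sigma> s \<tau>" "s \<le> m" "k < v" "I k \<tau>"
        using body[OF less.prems True] unfolding wp_def by blast
      obtain t \<tau>' where t: "exec (Loop p a) \<tau> t \<tau>'" "t \<le> Suc (k * Suc m)" "Q \<tau>'"
        using less.IH[OF s(3,4)] unfolding wp_def by blast
      \<comment> \<open>The round just done is paid for by the drop of the variant from
        \<open>v\<close> to \<open>k\<close>, which is at least one.\<close>
      have "Suc k * Suc m \<le> v * Suc m"
        using s(3) by (intro mult_le_mono1) simp
      then have "Suc (s + t) \<le> Suc (v * Suc m)"
        using s(2) t(2) by simp
      then show ?thesis
        using exec_iterate[OF True s(1) t(1)] t(3) unfolding wp_def by blast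
    next
      case False
      then show ?thesis
        using exec_exit[of p \<sigma> a] exit[OF less.prems False] unfolding wp_def
        by (intro exI[of _ 1] exI[of _ \<sigma>]) auto
    qed
  qed
  then show ?thesis using assms(4) by (rule wp_mono)
qed

text \<open>The form used for stacks of tuples: the invariant speaks of the part \<open>us\<close>
  already processed and the part still to come, and the loop test must hold exactly while the latter
  is nonempty.\<close>

lemma wp_for_each:
  assumes body: "\<And>us x vs \<tau>. xs = us @ x # vs \<Longrightarrow> I us (x # vs) \<tau> \<Longrightarrow> p (tops \<tau>) \<and> wp a m (I (us @ [x]) vs) \<tau>"
    and exit: "\<And>\<tau>. I xs [] \<tau> \<Longrightarrow> \<not> p (tops \<tau>) \<and> Q \<tau>"
    and start: "I [] xs \<sigma>" and n: "Suc (length xs * Suc m) \<le> n"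
  shows "wp (Loop p a) n Q \<sigma>"
proof (rule wp_Loop[where I = "\<lambda>k \<tau>. \<exists>us vs. xs = us @ vs \<and> k = length vs \<and> I us vs \<tau>", OF _ _ _ n])
  fix k \<tau>
  assume "\<exists>us vs. xs = us @ vs \<and> k = length vs \<and> I us vs \<tau>" "p (tops \<tau>)"
  then obtain us x vs where *: "xs = us @ x # vs" "k = Suc (length vs)" "I us (x # vs) \<tau>"
    using exit by (metis append_Nil2 length_Cons neq_Nil_conv)
  show "wp a m (\<lambda>\<tau>'. \<exists>k'<k. \<exists>us vs. xs = us @ vs \<and> k' = length vs \<and> I us vs \<tau>') \<tau>"
    by (rule wp_mono[OF conjunct2[OF body[OF *(1,3)]] order_refl])
      (use *(1,2) in \<open>intro exI[of _ "length vs"] conjI exI[of _ "us @ [x]"] exI[of _ vs], simp_all\<close>)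
next
  fix k \<tau>
  assume "\<exists>us vs. xs = us @ vs \<and> k = length vs \<and> I us vs \<tau>" "\<not> p (tops \<tau>)"
  then show "Q \<tau>" using exit body by (metis append_Nil2 neq_Nil_conv)
qed (use start in auto)

section \<open>Compilation to Turing machines\<close>

fun well_formed :: "'b tape_symbol set \<Rightarrow> nat \<Rightarrow> 'b cmd \<Rightarrow> bool" where
  "well_formed \<Gamma> K (Do g) \<longleftrightarrow> (\<forall>t. range t \<subseteq> \<Gamma> \<longrightarrow>
     (\<forall>r. op_symbols (g t r) \<subseteq> \<Gamma> \<and> (K \<le> r \<longrightarrow> g t r = Keep)))"
| "well_formed \<Gamma> K (Seq a b) \<longleftrightarrow> well_formed \<Gamma> K a \<and> well_formed \<Gamma> K b"
| "well_formed \<Gamma> K (Cond p a b) \<longleftrightarrow> well_formed \<Gamma> K a \<and> well_formed \<Gamma> K b"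
| "well_formed \<Gamma> K (Loop p a) \<longleftrightarrow> well_formed \<Gamma> K a"

text \<open>
  Stack \<open>r\<close> lives on tape \<open>r\<close>, its top under the head and the remaining entries to the right of
  it; whatever lies to the left of the head is garbage. Since a machine writes before it moves,
  pushing takes two steps, and the symbols still to be written are remembered in the first
  component of the control state. The second component is the list of commands still to be run.
\<close>

type_synonym 'b control = "'b tape_symbol option list option \<times> 'b cmd list"

definition idle :: "'b tape_symbol list \<Rightarrow> ('b tape_symbol \<times> move) list" where
  "idle = map (\<lambda>x. (x, Stay))"

fun first_act :: "'b op \<Rightarrow> 'b tape_symbol \<Rightarrow> 'b tape_symbol \<times> move" where
  "first_act Keep x = (x, Stay)"
| "first_act Pop x = (x, Right)"
| "first_act (Push y) x = (x, Left)"
| "first_act (Put y) x = (y, Stay)"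

fun pending :: "'b op \<Rightarrow> 'b tape_symbol option" where
  "pending (Push y) = Some y"
| "pending _ = None"

definition second_act :: "'b tape_symbol option \<Rightarrow> 'b tape_symbol \<Rightarrow> 'b tape_symbol \<times> move" where
  "second_act p x = ((case p of None \<Rightarrow> x | Some y \<Rightarrow> y), Stay)"

fun control_step ::
  "'b control \<Rightarrow> 'b tape_symbol list \<Rightarrow> 'b control \<times> ('b tape_symbol \<times> move) list" where
  "control_step (Some ps, cs) xs = ((None, cs), map2 second_act ps xs)"
| "control_step (None, []) xs = ((None, []), idle xs)"
| "control_step (None, Do g # cs) xs =
     (let ops = map (g (nth_blank xs)) [0..<length xs]
      in ((Some (map pending ops), cs), map2 first_act ops xs))"
| "control_step (None, Seq a b # cs) xs = ((None, a # b # cs), idle xs)"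
| "control_step (None, Cond p a b # cs) xs =
     ((None, (if p (nth_blank xs) then a else b) # cs), idle xs)"
| "control_step (None, Loop p a # cs) xs =
     ((None, if p (nth_blank xs) then a # Loop p a # cs else cs), idle xs)"

text \<open>The continuations that can arise while \<open>c\<close> runs in front of
  \<open>cs\<close>. A loop body is followed by the loop itself, so iterating leads back to a list
  already counted; this is why finitely many control states suffice.\<close>

fun remaining :: "'b cmd \<Rightarrow> 'b cmd list \<Rightarrow> 'b cmd list set" where
  "remaining (Do g) cs = {Do g # cs}"
| "remaining (Seq a b) cs = insert (Seq a b # cs) (remaining a (b # cs) \<union> remaining b cs)"
| "remaining (Cond p a b) cs = insert (Cond p a b # cs) (remaining a cs \<union> remaining b cs)"
| "remaining (Loop p a) cs = insert (Loop p a # cs) (remaining a (Loop p a # cs))"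

lemma finite_remaining: "finite (remaining c cs)"
  by (induction c arbitrary: cs) auto

lemma Cons_in_remaining: "c # cs \<in> remaining c cs"
  by (cases c) auto

lemma remaining_closed:
  assumes "d # ds \<in> remaining c cs"
  shows "snd (fst (control_step (None, d # ds) xs)) \<in> insert cs (remaining c cs)" (is "?s \<in> _")
  using assms
proof (induction c arbitrary: cs)
  case (Seq a b)
  then consider "d # ds = Seq a b # cs" | "?s \<in> insert (b # cs) (remaining a (b # cs))"
    | "?s \<in> insert cs (remaining b cs)" by auto
  then show ?case
    by cases (use Cons_in_remaining[of a "b # cs"] Cons_in_remaining[of b cs] in auto)
next
  case (Cond p a b)
  then consider "d # ds = Cond p a b # cs" | "?s \<in> insert cs (remaining a cs \<union> remaining b cs)" by auto
  then show ?case
    by cases (use Cons_in_remaining[of a cs] Cons_in_remaining[of b cs] in auto)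
next
  case (Loop p a)
  then consider "d # ds = Loop p a # cs" | "?s \<in> insert (Loop p a # cs) (remaining a (Loop p a # cs))"
    by auto
  then show ?case
    by cases (use Cons_in_remaining[of a "Loop p a # cs"] in auto)
qed (simp add: Let_def)

lemma remaining_well_formed:
  assumes "ds \<in> remaining c cs" "list_all (well_formed \<Gamma> K) (c # cs)"
  shows "list_all (well_formed \<Gamma> K) ds"
  using assms
proof (induction c arbitrary: cs)
  case (Seq a b)
  then show ?case using Seq.IH(1)[of "b # cs"] Seq.IH(2)[of cs] by auto
next
  case (Cond p a b)
  then show ?case using Cond.IH[of cs] by auto
next
  case (Loop p a)
  then show ?case using Loop.IH[of "Loop p a # cs"] by auto
qed simp

definition controls :: "'b tape_symbol set \<Rightarrow> nat \<Rightarrow> 'b cmd \<Rightarrow> 'b control set" where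
  "controls \<Gamma> K c =
     insert None (Some ` {ps. set ps \<subseteq> insert None (Some ` \<Gamma>) \<and> length ps = K}) \<times>
     insert [] (remaining c [])"

lemma finite_controls: "finite \<Gamma> \<Longrightarrow> finite (controls \<Gamma> K c)"
  unfolding controls_def by (simp add: finite_remaining finite_lists_length_eq)

lemma control_step_closed:
  assumes s: "s \<in> controls \<Gamma> K c" and c: "well_formed \<Gamma> K c" and \<Gamma>: "Blank \<in> \<Gamma>"
    and xs: "set xs \<subseteq> \<Gamma>" "length xs = K"
  shows "fst (control_step s xs) \<in> controls \<Gamma> K c \<and>
    length (snd (control_step s xs)) = K \<and> fst ` set (snd (control_step s xs)) \<subseteq> \<Gamma>"
proof -
  have idle: "fst ` set (idle xs) \<subseteq> \<Gamma>" "length (idle xs) = K"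
    using xs by (auto simp: idle_def)
  obtain p cs where s_eq: "s = (p, cs)" by fastforce
  have cs: "cs \<in> insert [] (remaining c [])" using s by (auto simp: s_eq controls_def)
  show ?thesis
  proof (cases p)
    case (Some ps)
    then have ps: "set ps \<subseteq> insert None (Some ` \<Gamma>)" "length ps = K"
      using s by (auto simp: s_eq controls_def)
    have "fst (second_act q x) \<in> \<Gamma>" if "(q, x) \<in> set (zip ps xs)" for q x
    proof -
      have "q \<in> insert None (Some ` \<Gamma>)" "x \<in> \<Gamma>"
        using that ps xs by (meson set_zip_leftD set_zip_rightD subset_iff)+
      then show ?thesis by (auto simp: second_act_def)
    qed
    then show ?thesis using cs ps xs by (auto simp: s_eq Some controls_def)
  next
    case None
    show ?thesis
    proof (cases cs)
      case Nil
      then show ?thesis using idle s by (simp add: s_eq None)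
    next
      case (Cons d ds)
      then have rem: "d # ds \<in> remaining c []" using cs by simp
      have next_cmds: "snd (fst (control_step s xs)) \<in> insert [] (remaining c [])"
        using remaining_closed[OF rem, of xs] by (simp add: s_eq None Cons)
      show ?thesis
      proof (cases d)
        case (Do g)
        have "range (nth_blank xs) \<subseteq> \<Gamma>" using xs \<Gamma> by (auto simp: nth_blank_def)
        moreover have "well_formed \<Gamma> K d"
          using remaining_well_formed[OF rem] c by simp
        ultimately have g: "op_symbols (g (nth_blank xs) r) \<subseteq> \<Gamma>" for r
          by (simp add: Do)
        have "pending u \<in> insert None (Some ` \<Gamma>)" if "op_symbols u \<subseteq> \<Gamma>" for u :: "'a op"
          using that by (cases u) auto
        then have p: "set (map (pending \<circ> g (nth_blank xs)) [0..<K]) \<subseteq> insert None (Some ` \<Gamma>)"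
          using g by fastforce
        have *: "fst (first_act u x) \<in> \<Gamma>" if "op_symbols u \<subseteq> \<Gamma>" "x \<in> \<Gamma>" for u and x :: "'a tape_symbol"
          using that by (cases u) auto
        have q: "fst (first_act u x) \<in> \<Gamma>"
          if "(u, x) \<in> set (zip (map (g (nth_blank xs)) [0..<K]) xs)" for u x
        proof -
          have "u \<in> g (nth_blank xs) ` {0..<K}" using set_zip_leftD[OF that] by simp
          then have "op_symbols u \<subseteq> \<Gamma>" using g by auto
          moreover have "x \<in> \<Gamma>" using set_zip_rightD[OF that] xs(1) by auto
          ultimately show ?thesis by (rule *)
        qed
        show ?thesis
          using p q xs next_cmds
          by (auto simp: s_eq None Cons Do Let_def controls_def)
      qed (use idle next_cmds in \<open>auto simp: s_eq None Cons controls_def\<close>)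
    qed
  qed
qed

section \<open>Representation of stacks by tapes\<close>

definition holds :: "'b tape \<Rightarrow> 'b tape_symbol list \<Rightarrow> bool" where
  "holds T xs \<longleftrightarrow> (\<forall>k. fst T (snd T + int k) = nth_blank xs k)"

lemma holds_head_symbol: "holds T xs \<Longrightarrow> head_symbol T = nth_blank xs 0"
  unfolding holds_def by (cases T) (metis head_symbol.simps add.right_neutral fst_conv of_nat_0 snd_conv)

lemma nth_blank_simps [simp]:
  "nth_blank (x # xs) 0 = x" "nth_blank (x # xs) (Suc k) = nth_blank xs k" "nth_blank [] k = Blank"
  by (auto simp: nth_blank_def)

lemma nth_blank_tl: "nth_blank (tl xs) k = nth_blank xs (Suc k)"
  by (cases xs) auto

text \<open>The first step of a push ends on a garbage cell to the left, which the second step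
  overwrites. The other operations are complete after the first step, and the second one writes back
  what it reads.\<close>

lemma holds_apply_op:
  assumes "holds T xs"
  shows "let T' = act (first_act u (head_symbol T)) T
         in holds (act (second_act (pending u) (head_symbol T')) T') (apply_op u xs)"
proof -
  obtain c i where T: "T = (c, i)" by fastforce
  have c: "c (i + int k) = nth_blank xs k" for k using assms by (simp add: holds_def T)
  show ?thesis
  proof (cases u)
    case Keep
    then show ?thesis using c by (simp add: T holds_def second_act_def)
  next
    case Pop
    have "c (i + 1 + int k) = nth_blank (tl xs) k" for k
      using c[of "Suc k"] by (simp add: nth_blank_tl algebra_simps)
    then show ?thesis by (simp add: T Pop holds_def second_act_def)
  next
    case (Push y)
    have "(c(i - 1 := y)) (i - 1 + int k) = nth_blank (y # xs) k" for k
      using c[of "k - 1"] by (cases k) (auto simp: algebra_simps)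
    then show ?thesis by (simp add: T Push holds_def second_act_def)
  next
    case (Put y)
    have "(c(i := y)) (i + int k) = nth_blank (y # tl xs) k" for k
      using c[of k] by (cases k) (auto simp: nth_blank_tl)
    then show ?thesis by (simp add: T Put holds_def second_act_def)
  qed
qed

definition represents :: "'b tape_symbol set \<Rightarrow> nat \<Rightarrow> 'b tape list \<Rightarrow> 'b store \<Rightarrow> bool" where
  "represents \<Gamma> K ts \<sigma> \<longleftrightarrow> length ts = K \<and> (\<forall>r<K. holds (ts ! r) (\<sigma> r)) \<and>
     (\<forall>r\<ge>K. \<sigma> r = []) \<and> (\<forall>r. set (\<sigma> r) \<subseteq> \<Gamma>)"

lemma represents_tops:
  assumes "represents \<Gamma> K ts \<sigma>"
  shows "nth_blank (map head_symbol ts) = tops \<sigma>"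
proof
  fix r
  show "nth_blank (map head_symbol ts) r = tops \<sigma> r"
    using assms unfolding represents_def
    by (cases "r < K") (auto simp: nth_blank_def[of "map _ _"] tops_def holds_head_symbol)
qed

fun config_step :: "'b control \<times> 'b tape list \<Rightarrow> 'b control \<times> 'b tape list" where
  "config_step (s, ts) =
     (case control_step s (map head_symbol ts) of (s', acts) \<Rightarrow> (s', map2 act acts ts))"

lemma act_idle [simp]: "map2 act (idle (map head_symbol ts)) ts = ts"
  by (induction ts) (auto simp: idle_def)

lemma represents_update:
  assumes rep: "represents \<Gamma> K ts \<sigma>" and wf: "well_formed \<Gamma> K (Do g)" and "Blank \<in> \<Gamma>"
  shows "\<exists>ts'. (config_step ^^ 2) ((None, Do g # cs), ts) = ((None, cs), ts') \<and>
    represents \<Gamma> K ts' (update g \<sigma>)"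
proof -
  define ops where "ops = map (g (tops \<sigma>)) [0..<K]"
  define ts1 where "ts1 = map2 act (map2 first_act ops (map head_symbol ts)) ts"
  define ts2 where "ts2 = map2 act (map2 second_act (map pending ops) (map head_symbol ts1)) ts1"
  have len: "length ts = K" "length ops = K" "length ts1 = K" "length ts2 = K"
    using rep by (auto simp: represents_def ops_def ts1_def ts2_def)
  have "(config_step ^^ 2) ((None, Do g # cs), ts) = ((None, cs), ts2)"
    using len by (simp add: numeral_2_eq_2 represents_tops[OF rep] Let_def ops_def ts1_def ts2_def)
  moreover have "holds (ts2 ! r) (update g \<sigma> r)" if "r < K" for r
  proof -
    have "holds (ts ! r) (\<sigma> r)" using rep that by (simp add: represents_def)
    from holds_apply_op[OF this, of "g (tops \<sigma>) r"] show ?thesis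
      using that len by (simp add: ts2_def ts1_def ops_def update_def Let_def)
  qed
  moreover have sym: "set (\<sigma> r) \<subseteq> \<Gamma>" for r using rep by (simp add: represents_def)
  then have "range (tops \<sigma>) \<subseteq> \<Gamma>"
    using assms(3) by (auto simp: tops_def nth_blank_def intro!: nth_mem[THEN subsetD[rotated]])
  then have g: "op_symbols (g (tops \<sigma>) r) \<subseteq> \<Gamma>" "K \<le> r \<Longrightarrow> g (tops \<sigma>) r = Keep" for r
    using wf by simp_all
  then have "update g \<sigma> r = []" if "K \<le> r" for r
    using rep that by (simp add: represents_def update_def)
  moreover have "set (apply_op u xs) \<subseteq> op_symbols u \<union> set xs" for u and xs :: "'a tape_symbol list"
    by (cases u; cases xs) auto
  then have "set (update g \<sigma> r) \<subseteq> \<Gamma>" for r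
    using g(1)[of r] sym[of r] unfolding update_def by blast
  ultimately show ?thesis using len by (auto simp: represents_def)
qed

text \<open>The continuation \<open>cs\<close> is arbitrary so that the induction applies to the
  first part of \<open>Seq\<close> and to loop bodies, which run while further commands are
  waiting.\<close>

lemma exec_control:
  assumes "exec c \<sigma> t \<sigma>'" "represents \<Gamma> K ts \<sigma>" "well_formed \<Gamma> K c" "Blank \<in> \<Gamma>"
  shows "\<exists>ts'. (config_step ^^ t) ((None, c # cs), ts) = ((None, cs), ts') \<and> represents \<Gamma> K ts' \<sigma>'"
  using assms
proof (induction arbitrary: ts cs rule: exec.induct)
  case (exec_Do g \<sigma>)
  then show ?case using represents_update by blast
next
  case (exec_Seq a \<sigma> s \<sigma>' b t \<sigma>'')
  obtain ts1 where 1: "(config_step ^^ s) ((None, a # b # cs), ts) = ((None, b # cs), ts1)"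
    "represents \<Gamma> K ts1 \<sigma>'"
    using exec_Seq.IH(1)[OF exec_Seq.prems(1), of "b # cs"] exec_Seq.prems by auto
  obtain ts2 where 2: "(config_step ^^ t) ((None, b # cs), ts1) = ((None, cs), ts2)"
    "represents \<Gamma> K ts2 \<sigma>''"
    using exec_Seq.IH(2)[OF 1(2), of cs] exec_Seq.prems by auto
  have "(config_step ^^ Suc (s + t)) ((None, Seq a b # cs), ts) = ((None, cs), ts2)"
    unfolding funpow_Suc_right using 1(1) 2(1) by (simp add: funpow_add add.commute[of s])
  then show ?case using 2(2) by blast
next
  case (exec_Cond p \<sigma> a b t \<sigma>')
  then have "well_formed \<Gamma> K (if p (tops \<sigma>) then a else b)" by simp
  from exec_Cond.IH[OF exec_Cond.prems(1) this exec_Cond.prems(3)] show ?case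
    unfolding funpow_Suc_right by (simp add: represents_tops[OF exec_Cond.prems(1)])
next
  case (exec_exit p \<sigma> a)
  then show ?case by (simp add: represents_tops[OF exec_exit.prems(1)])
next
  case (exec_iterate p \<sigma> a s \<sigma>' t \<sigma>'')
  obtain ts1 where 1:
    "(config_step ^^ s) ((None, a # Loop p a # cs), ts) = ((None, Loop p a # cs), ts1)"
    "represents \<Gamma> K ts1 \<sigma>'"
    using exec_iterate.IH(1)[OF exec_iterate.prems(1), of "Loop p a # cs"] exec_iterate.prems by auto
  obtain ts2 where 2: "(config_step ^^ t) ((None, Loop p a # cs), ts1) = ((None, cs), ts2)"
    "represents \<Gamma> K ts2 \<sigma>''"
    using exec_iterate.IH(2)[OF 1(2), of cs] exec_iterate.prems by auto
  have "(config_step ^^ Suc (s + t)) ((None, Loop p a # cs), ts) = ((None, cs), ts2)"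
    unfolding funpow_Suc_right
    using 1(1) 2(1) exec_iterate.hyps(1)
    by (simp add: funpow_add add.commute[of s] represents_tops[OF exec_iterate.prems(1)])
  then show ?case using 2(2) by blast
qed

definition input_store :: "'b list \<Rightarrow> 'b store" where
  "input_store w = (\<lambda>_. [])(0 := map Letter w)"

lemma represents_input:
  assumes "1 \<le> K" "Letter ` set w \<subseteq> \<Gamma>"
  shows "represents \<Gamma> K (input_tape w # replicate (K - 1) blank_tape) (input_store w)"
proof -
  have "holds (input_tape w) (map Letter w)"
    by (auto simp: holds_def input_tape_def nth_blank_def)
  moreover have "holds blank_tape []"
    by (simp add: holds_def blank_tape_def)
  ultimately show ?thesis
    using assms by (auto simp: represents_def input_store_def nth_Cons')
qed

section \<open>The Turing machine of a program\<close>

locale compilation =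
  fixes \<Gamma> :: "'b tape_symbol set" and K :: nat and c :: "'b cmd"
    and accepting :: "(nat \<Rightarrow> 'b tape_symbol) \<Rightarrow> bool" and code :: "'b control \<Rightarrow> nat"
  assumes finite_symbols: "finite \<Gamma>" and Blank_symbol: "Blank \<in> \<Gamma>" and tapes_pos: "1 \<le> K"
    and well_formed: "well_formed \<Gamma> K c"
    and inj_code: "inj_on code (controls \<Gamma> K c)"
begin

text \<open>The offset keeps the states 0 and 1 free for acceptance and rejection.\<close>

definition encode :: "'b control \<Rightarrow> nat" where
  "encode s = code s + 2"

definition machine :: "'b tm" where
  "machine = \<lparr>tm_tapes = K, tm_states = {0, 1} \<union> encode ` controls \<Gamma> K c, tm_symbols = \<Gamma>,
     tm_start = encode (None, [c]), tm_accept = 0, tm_reject = 1,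
     tm_delta = (\<lambda>q xs. let s = inv_into (controls \<Gamma> K c) encode q in
       if s = (None, []) then (if accepting (nth_blank xs) then 0 else 1, idle xs)
       else case control_step s xs of (s', acts) \<Rightarrow> (encode s', acts))\<rparr>"

lemma decode: "s \<in> controls \<Gamma> K c \<Longrightarrow> inv_into (controls \<Gamma> K c) encode (encode s) = s"
  using inj_code by (intro inv_into_f_f) (auto simp: encode_def inj_on_def)

lemma start_in_controls: "(None, [c]) \<in> controls \<Gamma> K c"
  using Cons_in_remaining[of c "[]"] by (simp add: controls_def)

lemma turing_machine: 
  assumes "Letter ` \<Sigma> \<subseteq> \<Gamma>"
  shows "turing_machine \<Sigma> machine"
  unfolding turing_machine_def
proof (intro conjI ballI impI)
  fix q xs
  assume q: "q \<in> tm_states machine - {tm_accept machine, tm_reject machine}"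
    and xs: "xs \<in> lists (tm_symbols machine)" "length xs = tm_tapes machine"
  obtain s where s: "s \<in> controls \<Gamma> K c" "q = encode s"
    using q by (auto simp: machine_def)
  have xs': "set xs \<subseteq> \<Gamma>" "length xs = K" using xs by (auto simp: machine_def)
  show "case tm_delta machine q xs of (q', acts) \<Rightarrow> q' \<in> tm_states machine \<and>
          length acts = tm_tapes machine \<and> fst ` set acts \<subseteq> tm_symbols machine"
  proof (cases "s = (None, [])")
    case True
    then show ?thesis using xs' decode[OF s(1)] s by (auto simp: machine_def Let_def idle_def)
  next
    case False
    obtain s' acts where step: "control_step s xs = (s', acts)" by fastforce
    show ?thesis
      using control_step_closed[OF s(1) well_formed Blank_symbol xs'] decode[OF s(1)] s False
      by (simp add: machine_def Let_def step)
  qed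
next
  show "finite (tm_states machine)"
    using finite_controls[OF finite_symbols] by (simp add: machine_def)
qed (use assms finite_symbols Blank_symbol tapes_pos start_in_controls in
       \<open>auto simp: machine_def\<close>)

lemma machine_step:
  assumes "s \<in> controls \<Gamma> K c" "s \<noteq> (None, [])" "config_step (s, ts) = (s', ts')"
  shows "tm_step machine (encode s, ts) = (encode s', ts')"
  using assms decode[OF assms(1)]
  by (auto simp: machine_def Let_def encode_def split: prod.splits)

text \<open>Between the two steps of a \<open>Do\<close> the tapes need not represent a store, so
  membership in \<open>controls\<close>, on which \<open>decode\<close> relies, is derived from this
  weaker invariant of single steps. It covers all cells, as a push reads a garbage cell before
  overwriting it.\<close>

definition safe :: "'b control \<times> 'b tape list \<Rightarrow> bool" where
  "safe C \<longleftrightarrow> fst C \<in> controls \<Gamma> K c \<and> length (snd C) = K \<and> (\<forall>T \<in> set (snd C). range (fst T) \<subseteq> \<Gamma>)"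

lemma range_act: "fst a \<in> \<Gamma> \<Longrightarrow> range (fst T) \<subseteq> \<Gamma> \<Longrightarrow> range (fst (act a T)) \<subseteq> \<Gamma>"
  by (cases a; cases T) auto

lemma safe_step:
  assumes "safe C"
  shows "safe (config_step C)"
proof -
  obtain s ts where C: "C = (s, ts)" by fastforce
  obtain s' acts where step: "control_step s (map head_symbol ts) = (s', acts)" by fastforce
  have "head_symbol T \<in> \<Gamma>" if "T \<in> set ts" for T
  proof -
    have "range (fst T) \<subseteq> \<Gamma>" using assms that by (simp add: safe_def C)
    moreover have "head_symbol T \<in> range (fst T)" by (cases T) simp
    ultimately show ?thesis by blast
  qed
  then have "set (map head_symbol ts) \<subseteq> \<Gamma>" by auto
  then have s': "s' \<in> controls \<Gamma> K c" "length acts = K" "fst ` set acts \<subseteq> \<Gamma>"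
    using control_step_closed[OF _ well_formed Blank_symbol, of s "map head_symbol ts"] assms
    by (auto simp: safe_def C step)
  have "range (fst (act a T)) \<subseteq> \<Gamma>" if "(a, T) \<in> set (zip acts ts)" for a T
    using set_zip_leftD[OF that] set_zip_rightD[OF that] s'(3) assms
    by (intro range_act) (auto simp: safe_def C)
  then have "\<forall>T \<in> set (map2 act acts ts). range (fst T) \<subseteq> \<Gamma>"
    by (force simp del: image_subset_iff)
  then show ?thesis
    using s' assms by (simp add: safe_def C step)
qed

lemma machine_halt:
  assumes "(None, []) \<in> controls \<Gamma> K c"
  shows "fst (tm_step machine (encode (None, []), ts)) =
    (if accepting (nth_blank (map head_symbol ts)) then 0 else 1)"
proof -
  have "encode s \<noteq> 0" "encode s \<noteq> 1" for s by (simp_all add: encode_def)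
  then show ?thesis using decode[OF assms] by (simp add: machine_def Let_def del: neq0_conv)
qed

text \<open>The control may reach \<open>(None, [])\<close> before step \<open>t\<close> and then
  idles, whereas the machine spends one more step there to enter a halting state; hence
  \<open>t'\<close> may be smaller than \<open>t\<close> and is at most
  \<open>Suc t\<close>.\<close>

lemma machine_run:
  assumes "safe (s, ts)" "(config_step ^^ t) (s, ts) = ((None, []), ts')"
  shows "\<exists>t' \<le> Suc t. fst ((tm_step machine ^^ t') (encode s, ts)) =
    (if accepting (nth_blank (map head_symbol ts')) then 0 else 1)"
  using assms
proof (induction t arbitrary: s ts)
  case 0
  then have "(None, []) \<in> controls \<Gamma> K c" by (simp add: safe_def)
  moreover have "s = (None, [])" "ts = ts'" using 0(2) by simp_all
  ultimately show ?case
    using machine_halt by (intro exI[of _ 1]) (simp del: tm_step.simps)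
next
  case (Suc t)
  show ?case
  proof (cases "s = (None, [])")
    case True
    have "(config_step ^^ n) ((None, []), ts) = ((None, []), ts)" for n
      by (induction n) simp_all
    then have "ts' = ts" using Suc.prems(2) True by (metis prod.inject)
    moreover have "(None, []) \<in> controls \<Gamma> K c"
      using Suc.prems(1) True by (simp add: safe_def)
    ultimately show ?thesis
      using machine_halt True by (intro exI[of _ 1]) (simp del: tm_step.simps)
  next
    case False
    obtain s1 ts1 where 1: "config_step (s, ts) = (s1, ts1)" by fastforce
    have "safe (s1, ts1)" using safe_step[OF Suc.prems(1)] by (simp only: 1)
    moreover have "(config_step ^^ t) (s1, ts1) = ((None, []), ts')"
      using Suc.prems(2) by (simp only: funpow_Suc_right o_apply 1)
    ultimately obtain t' where t': "t' \<le> Suc t" "fst ((tm_step machine ^^ t') (encode s1, ts1)) =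
        (if accepting (nth_blank (map head_symbol ts')) then 0 else 1)"
      using Suc.IH by blast
    have "tm_step machine (encode s, ts) = (encode s1, ts1)"
      using machine_step[OF _ False 1] Suc.prems(1) by (simp add: safe_def)
    then have "fst ((tm_step machine ^^ Suc t') (encode s, ts)) =
        (if accepting (nth_blank (map head_symbol ts')) then 0 else 1)"
      using t'(2) by (simp only: funpow_Suc_right o_apply)
    then show ?thesis using t'(1) by (intro exI[of _ "Suc t'"]) simp
  qed
qed

lemma machine_decides:
  assumes "Letter ` \<Sigma> \<subseteq> \<Gamma>"
    and run: "\<And>w. w \<in> lists \<Sigma> \<Longrightarrow>
      wp c (T (length w)) (\<lambda>\<sigma>. accepting (tops \<sigma>) \<longleftrightarrow> w \<in> L) (input_store w)"
  shows "decides_in_time \<Sigma> machine L (\<lambda>n. Suc (T n))"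
  unfolding decides_in_time_def
proof
  fix w
  assume w: "w \<in> lists \<Sigma>"
  let ?ts = "input_tape w # replicate (K - 1) blank_tape"
  obtain t \<sigma> where \<sigma>: "exec c (input_store w) t \<sigma>" "t \<le> T (length w)" "accepting (tops \<sigma>) \<longleftrightarrow> w \<in> L"
    using run[OF w] unfolding wp_def by blast
  have letters: "Letter x \<in> \<Gamma>" if "x \<in> set w" for x
    using that w assms(1) by auto
  then have rep: "represents \<Gamma> K ?ts (input_store w)"
    using tapes_pos by (intro represents_input) auto
  obtain ts where ts: "(config_step ^^ t) ((None, [c]), ?ts) = ((None, []), ts)"
    "represents \<Gamma> K ts \<sigma>"
    using exec_control[OF \<sigma>(1) rep well_formed Blank_symbol] by blast
  have "safe ((None, [c]), ?ts)"
    using start_in_controls tapes_pos letters Blank_symbol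
    by (auto simp: safe_def input_tape_def blank_tape_def)
  from machine_run[OF this ts(1)] obtain t' where "t' \<le> Suc t"
    "fst ((tm_step machine ^^ t') (encode (None, [c]), ?ts)) = (if accepting (tops \<sigma>) then 0 else 1)"
    unfolding represents_tops[OF ts(2)] by blast
  then show "\<exists>t\<le>Suc (T (length w)). fst ((tm_step machine ^^ t) (initial_config machine w)) =
      (if w \<in> L then tm_accept machine else tm_reject machine)"
    using \<sigma>(2,3) by (intro exI[of _ t']) (auto simp: initial_config_def machine_def)
qed

end

theorem program_in_class_P:
  fixes T :: "nat poly"
  assumes "finite \<Gamma>" "Blank \<in> \<Gamma>" "Letter ` \<Sigma> \<subseteq> \<Gamma>" "1 \<le> K" "well_formed \<Gamma> K c" "L \<subseteq> lists \<Sigma>"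
    and run: "\<And>w. w \<in> lists \<Sigma> \<Longrightarrow>
      wp c (poly T (length w)) (\<lambda>\<sigma>. accepting (tops \<sigma>) \<longleftrightarrow> w \<in> L) (input_store w)"
  shows "L \<in> class_P \<Sigma>"
proof -
  obtain code :: "'a control \<Rightarrow> nat" where "inj_on code (controls \<Gamma> K c)"
    using finite_imp_inj_to_nat_seg[OF finite_controls[OF assms(1)]] by blast
  then interpret compilation \<Gamma> K c accepting code
    using assms by unfold_locales
  have "(\<lambda>n. Suc (poly T n)) = poly (T + 1)" by (simp add: fun_eq_iff)
  then have "decides_in_time \<Sigma> machine L (poly (T + 1))"
    using machine_decides[where T = "poly T", OF assms(3) run] by simp
  then show ?thesis
    using turing_machine[OF assms(3)] assms(6) unfolding class_P_def by blast
qed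

section \<open>Sifting in groups with coordinates\<close>

locale coordinate_group = group G for G :: "('g, 'x) monoid_scheme" (structure) +
  fixes N :: nat and coord :: "'g \<Rightarrow> nat \<Rightarrow> 'v"
  assumes coord_mult: "\<lbrakk>x \<in> carrier G; x' \<in> carrier G; y \<in> carrier G; y' \<in> carrier G; j < N;
      coord x j = coord x' j; coord y j = coord y' j\<rbrakk> \<Longrightarrow> coord (x \<otimes> y) j = coord (x' \<otimes> y') j"
    and coord_eq: "\<lbrakk>x \<in> carrier G; y \<in> carrier G; \<And>j. j < N \<Longrightarrow> coord x j = coord y j\<rbrakk> \<Longrightarrow> x = y"
begin

text \<open>For \<open>i\<close> up to \<open>N\<close>, the elements agreeing with
  \<open>\<one>\<close> below \<open>i\<close> form a subgroup. These subgroups play the part of the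
  pointwise stabilizers in the algorithm for permutation groups.\<close>

definition agree :: "nat \<Rightarrow> 'g \<Rightarrow> 'g \<Rightarrow> bool" where
  "agree i x y \<longleftrightarrow> (\<forall>j<i. coord x j = coord y j)"

definition pivot :: "nat \<Rightarrow> 'g \<Rightarrow> bool" where
  "pivot i x \<longleftrightarrow> i < N \<and> agree i x \<one> \<and> coord x i \<noteq> coord \<one> i"

text \<open>Left division by \<open>y\<close> then makes \<open>x\<close> trivial up to and
  including its pivot. On nontrivial elements this is an equivalence relation, and its classes are
  the slots of the table.\<close>

definition matches :: "'g \<Rightarrow> 'g \<Rightarrow> bool" where
  "matches y x \<longleftrightarrow> (\<exists>i. pivot i x \<and> agree (Suc i) y x)"

lemma agree_mult:
  "\<lbrakk>agree i x x'; agree i y y'; i \<le> N; x \<in> carrier G; x' \<in> carrier G; y \<in> carrier G; y' \<in> carrier G\<rbrakk>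
   \<Longrightarrow> agree i (x \<otimes> y) (x' \<otimes> y')"
  unfolding agree_def by (auto intro: coord_mult)

lemma agree_refl [simp]: "agree i x x" by (simp add: agree_def)
lemma agree_sym: "agree i x y \<Longrightarrow> agree i y x" by (simp add: agree_def)
lemma agree_trans: "agree i x y \<Longrightarrow> agree i y z \<Longrightarrow> agree i x z" by (simp add: agree_def)
lemma agree_le: "agree i x y \<Longrightarrow> k \<le> i \<Longrightarrow> agree k x y" by (simp add: agree_def)
lemma agree_Suc: "agree (Suc i) x y \<longleftrightarrow> agree i x y \<and> coord x i = coord y i"
  by (auto simp: agree_def less_Suc_eq)

lemma agree_eq: "agree N x y \<Longrightarrow> x \<in> carrier G \<Longrightarrow> y \<in> carrier G \<Longrightarrow> x = y"
  by (auto simp: agree_def intro: coord_eq)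

lemma agree_mult_one:
  "\<lbrakk>agree i x \<one>; agree i y \<one>; i \<le> N; x \<in> carrier G; y \<in> carrier G\<rbrakk> \<Longrightarrow> agree i (x \<otimes> y) \<one>"
  using agree_mult[of i x \<one> y \<one>] by simp

lemma pivot_unique: "pivot i x \<Longrightarrow> pivot j x \<Longrightarrow> i = j"
  unfolding pivot_def agree_def by (metis nat_neq_iff)

lemma pivot_agree: "pivot i x \<Longrightarrow> agree k x \<one> \<Longrightarrow> k \<le> i"
  unfolding pivot_def agree_def by (meson not_less)

lemma pivot_cong: "pivot i x \<Longrightarrow> agree (Suc i) y x \<Longrightarrow> pivot i y"
  unfolding pivot_def agree_def by auto

lemma pivot_cases: "agree i x \<one> \<Longrightarrow> i < N \<Longrightarrow> agree (Suc i) x \<one> \<or> pivot i x"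
  by (auto simp: pivot_def agree_Suc)

lemma pivot_not_one: "pivot i x \<Longrightarrow> x \<noteq> \<one>"
  by (auto simp: pivot_def)

lemma pivot_exists:
  assumes "x \<in> carrier G" "x \<noteq> \<one>"
  shows "\<exists>i. pivot i x"
proof -
  define P where "P j \<longleftrightarrow> j < N \<and> coord x j \<noteq> coord \<one> j" for j
  have "\<exists>j. P j"
  proof (rule ccontr)
    assume "\<nexists>j. P j"
    then have "x = \<one>" by (intro coord_eq[OF assms(1)]) (simp_all add: P_def)
    with assms(2) show False ..
  qed
  then obtain i where i: "P i" "\<And>j. j < i \<Longrightarrow> \<not> P j"
    using exists_least_iff[of P] by metis
  have "coord x j = coord \<one> j" if "j < i" for j
    using i(2)[OF that] i(1) that by (simp add: P_def)
  then have "pivot i x" using i(1) by (simp add: pivot_def agree_def P_def)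
  then show ?thesis ..
qed

lemma matches_self: "x \<in> carrier G \<Longrightarrow> x \<noteq> \<one> \<Longrightarrow> matches x x"
  using pivot_exists[of x] by (auto simp: matches_def)

lemma matches_sym: "matches y x \<Longrightarrow> matches x y"
  using pivot_cong[of _ x y] agree_sym[of _ y x] by (auto simp: matches_def)

lemma matches_trans: "matches z y \<Longrightarrow> matches y x \<Longrightarrow> matches z x"
  using pivot_cong pivot_unique agree_trans unfolding matches_def by metis

lemma agree_quotient:
  assumes "agree i y x" "i \<le> N" "x \<in> carrier G" "y \<in> carrier G"
  shows "agree i (inv y \<otimes> x) \<one>"
  using agree_mult[of i "inv y" "inv y" x y] assms by (simp add: agree_sym l_inv)

section \<open>Sifting through a table\<close>

text \<open>For a table in the carrier and empty \<open>Q\<close>, these are the products of table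
  elements with strictly increasing pivots. A nonempty \<open>Q\<close> holds tuples still to be
  processed: an element counts as sifted on the promise that its remainder will be dealt
  with.\<close>

inductive_set sifted :: "'g set \<Rightarrow> 'g set \<Rightarrow> 'g set" for L Q :: "'g set" where
  one: "\<one> \<in> sifted L Q"
| pending: "x \<in> Q \<Longrightarrow> x \<in> sifted L Q"
| step: "y \<in> L \<Longrightarrow> x \<in> carrier G \<Longrightarrow> matches y x \<Longrightarrow> inv y \<otimes> x \<in> sifted L Q \<Longrightarrow> x \<in> sifted L Q"

lemma sifted_carrier: "Q \<subseteq> carrier G \<Longrightarrow> x \<in> sifted L Q \<Longrightarrow> x \<in> carrier G"
  by (erule sifted.cases) auto

text \<open>A pending element may be replaced by any way of sifting it; this is how elements leave
  the queue.\<close>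

lemma sifted_mono:
  assumes "x \<in> sifted L Q" "L \<subseteq> L'" "Q \<subseteq> sifted L' Q'"
  shows "x \<in> sifted L' Q'"
  using assms(1) by induction (use assms(2,3) in \<open>auto intro: sifted.intros\<close>)

text \<open>The computation read forwards, whereas \<open>sifted\<close> is built backwards from the
  final remainder; \<open>reduces_sifted\<close> connects the two.\<close>

inductive reduces :: "'g set \<Rightarrow> 'g \<Rightarrow> 'g \<Rightarrow> bool" for L :: "'g set" where
  refl: "reduces L x x"
| step: "reduces L x x' \<Longrightarrow> y \<in> L \<Longrightarrow> matches y x' \<Longrightarrow> reduces L x (inv y \<otimes> x')"

lemma reduces_trans: "reduces L y z \<Longrightarrow> reduces L x y \<Longrightarrow> reduces L x z"
  by (induction rule: reduces.induct) (auto intro: reduces.step)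

lemma reduces_carrier: "reduces L x x' \<Longrightarrow> L \<subseteq> carrier G \<Longrightarrow> x \<in> carrier G \<Longrightarrow> x' \<in> carrier G"
  by (induction rule: reduces.induct) auto

lemma reduces_sifted:
  assumes "reduces L x x'" "L \<subseteq> carrier G" "x \<in> carrier G" "x' \<in> sifted L Q"
  shows "x \<in> sifted L Q"
  using assms by (induction rule: reduces.induct) (auto intro: sifted.step dest: reduces_carrier)

lemma reduces_mono: "reduces L x x' \<Longrightarrow> L \<subseteq> L' \<Longrightarrow> reduces L' x x'"
  by (induction rule: reduces.induct) (auto intro: reduces.intros)

text \<open>Equal to \<open>N - i\<close> for an element with pivot \<open>i\<close> and to 0 for
  the identity; counting levels avoids choosing the pivot.\<close>

definition height :: "'g \<Rightarrow> nat" where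
  "height x = card {i. i \<le> N \<and> \<not> agree i x \<one>}"

lemma height_le: "height x \<le> Suc N"
  unfolding height_def using card_mono[of "{..N}" "{i. i \<le> N \<and> \<not> agree i x \<one>}"] by auto

lemma height_quotient:
  assumes "matches y x" "x \<in> carrier G" "y \<in> carrier G"
  shows "height (inv y \<otimes> x) < height x"
proof -
  obtain i where i: "pivot i x" "agree (Suc i) y x" using assms(1) unfolding matches_def by blast
  then have "Suc i \<le> N" by (auto simp: pivot_def)
  then have one: "agree (Suc i) (inv y \<otimes> x) \<one>" using agree_quotient i(2) assms by blast
  have "k \<ge> Suc i" if "\<not> agree k (inv y \<otimes> x) \<one>" for k
    using that agree_le[OF one, of k] by linarith
  moreover have "\<not> agree k x \<one>" if "k \<ge> Suc i" for k
    using that i(1) pivot_agree[of i x k] by auto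
  ultimately have "{k. k \<le> N \<and> \<not> agree k (inv y \<otimes> x) \<one>} \<subset> {k. k \<le> N \<and> \<not> agree k x \<one>}"
    using one \<open>Suc i \<le> N\<close> by blast
  then show ?thesis unfolding height_def by (intro psubset_card_mono) auto
qed

end

section \<open>Completeness of a table closed under pairwise products\<close>

locale sifting_table = coordinate_group +
  fixes L :: "'a set"
  assumes L_carrier: "L \<subseteq> carrier G"
    and L_nontrivial: "\<one> \<notin> L"
    and L_unique: "y \<in> L \<Longrightarrow> z \<in> L \<Longrightarrow> matches y z \<Longrightarrow> y = z"
begin

abbreviation U where "U \<equiv> sifted L {}"

lemma U_carrier: "u \<in> U \<Longrightarrow> u \<in> carrier G"
  using sifted_carrier[of "{}"] by simp

lemma U_decompose:
  assumes "u \<in> U" "pivot i u"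
  obtains t u' where "t \<in> L" "pivot i t" "agree (Suc i) t u" "u' \<in> U" "agree (Suc i) u' \<one>" "u = t \<otimes> u'"
  using assms(1)
proof cases
  case one
  then show ?thesis using assms(2) pivot_not_one by blast
next
  case (step t)
  then have "agree (Suc i) t u" using assms(2) pivot_unique unfolding matches_def by blast
  moreover have "pivot i t" using calculation assms(2) pivot_cong by blast
  moreover have t: "t \<in> carrier G" using step(1) L_carrier by blast
  moreover have "agree (Suc i) (inv t \<otimes> u) \<one>"
    using agree_quotient calculation step(2) assms(2) by (simp add: pivot_def)
  moreover have "u = t \<otimes> (inv t \<otimes> u)" using t step(2) by (simp add: m_assoc[symmetric])
  ultimately show ?thesis using that step by blast
qed simp

text \<open>As \<open>w\<close> is trivial up to coordinate \<open>i\<close>, the product has the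
  pivot of \<open>t\<close> and the same value there, so it is sifted first by \<open>t\<close>
  itself.\<close>

lemma U_mult_left:
  assumes "t \<in> L" "pivot i t" "w \<in> U" "agree (Suc i) w \<one>"
  shows "t \<otimes> w \<in> U"
proof (rule sifted.step)
  have c: "t \<in> carrier G" "w \<in> carrier G" using assms(1,3) L_carrier U_carrier by auto
  have "agree (Suc i) (t \<otimes> w) t"
    using agree_mult[of "Suc i" t t w \<one>] assms c by (simp add: pivot_def)
  then show "matches t (t \<otimes> w)"
    using assms(2) pivot_cong agree_sym unfolding matches_def by blast
  show "inv t \<otimes> (t \<otimes> w) \<in> U" using c assms(3) by (simp add: m_assoc[symmetric])
qed (use assms L_carrier U_carrier in auto)

text \<open>All table elements matching a given element match each other and hence coincide, so
  sifting is deterministic: a step leads neither out of \<open>U\<close> nor into it from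
  outside.\<close>

lemma reduces_U_iff:
  assumes "reduces L x x'" "x \<in> carrier G"
  shows "x \<in> U \<longleftrightarrow> x' \<in> U"
  using assms
proof (induction rule: reduces.induct)
  case (step x x' y)
  have x': "x' \<in> carrier G" using reduces_carrier[OF step(1) L_carrier step(5)] .
  have "inv y \<otimes> x' \<in> U" if "x' \<in> U"
    using that
  proof cases
    case one
    then show ?thesis using step(3) unfolding matches_def pivot_def by auto
  next
    case (step z)
    then have "z = y" using L_unique \<open>y \<in> L\<close> \<open>matches y x'\<close> matches_sym matches_trans by blast
    then show ?thesis using step by simp
  qed simp
  then show ?case using step x' sifted.step by metis
qed simp

lemma irreducible_U_iff:
  assumes "\<And>y. y \<in> L \<Longrightarrow> \<not> matches y x"
  shows "x \<in> U \<longleftrightarrow> x = \<one>"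
proof
  assume "x \<in> U"
  then show "x = \<one>" using assms by cases auto
qed (simp add: sifted.one)

text \<open>
  The elements of \<open>U\<close> agreeing with \<open>\<one>\<close> below \<open>i\<close> form a subgroup; by downward induction on \<open>i\<close>,
  an element \<open>t\<close> of the table with pivot \<open>i\<close> normalizes the subgroup for \<open>i + 1\<close>.
\<close>

lemma U_closed_from:
  assumes LL: "\<And>y z. y \<in> L \<Longrightarrow> z \<in> L \<Longrightarrow> y \<otimes> z \<in> U" and "i \<le> N"
  shows "\<forall>u\<in>U. \<forall>v\<in>U. agree i u \<one> \<longrightarrow> agree i v \<one> \<longrightarrow> u \<otimes> v \<in> U"
  using \<open>i \<le> N\<close>
proof (induction i rule: inc_induct)
  case base
  show ?case
  proof (intro ballI impI)
    fix u v
    assume "u \<in> U" "v \<in> U" "agree N u \<one>" "agree N v \<one>"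
    moreover from this have "u = \<one>" "v = \<one>" using agree_eq U_carrier by auto
    ultimately show "u \<otimes> v \<in> U" by simp
  qed
next
  case (step i)
  have IH: "u \<otimes> v \<in> U" if "u \<in> U" "v \<in> U" "agree (Suc i) u \<one>" "agree (Suc i) v \<one>" for u v
    using step.IH that by blast
  have i: "i < N" using step.hyps by simp
  \<comment> \<open>A factor of level \<open>i + 1\<close> on the right is absorbed: only the tail
    \<open>u'\<close> of \<open>u = t \<otimes> u'\<close> meets it, and the induction hypothesis
    applies to these two.\<close>
  have right: "u \<otimes> s \<in> U" if u: "u \<in> U" "agree i u \<one>" and s: "s \<in> U" "agree (Suc i) s \<one>" for u s
  proof (cases "agree (Suc i) u \<one>")
    case False
    then have "pivot i u" using pivot_cases[OF u(2) i] by simp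
    then obtain t u' where t: "t \<in> L" "pivot i t" "u' \<in> U" "agree (Suc i) u' \<one>" "u = t \<otimes> u'"
      using U_decompose[OF u(1)] by blast
    have c: "t \<in> carrier G" "u' \<in> carrier G" "s \<in> carrier G"
      using t L_carrier U_carrier s by auto
    have "t \<otimes> (u' \<otimes> s) \<in> U"
      using U_mult_left[OF t(1,2) IH[OF t(3) s(1) t(4) s(2)]] agree_mult_one t(4) s(2) c i by simp
    then show ?thesis using t(5) c by (simp add: m_assoc)
  qed (use IH that in blast)
  \<comment> \<open>This replaces normality: \<open>u\<close> moves to the right of \<open>t\<close>
    and becomes some \<open>w\<close> of the same level. The factors of \<open>u\<close> are moved
    one at a time, following its sifting.\<close>
  have commute: "\<exists>w\<in>U. agree (Suc i) w \<one> \<and> u \<otimes> t = t \<otimes> w"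
    if "u \<in> U" "agree (Suc i) u \<one>" "t \<in> L" "pivot i t" for u t
    using that(1,2)
  proof induction
    case one
    show ?case
      using \<open>t \<in> L\<close> L_carrier by (intro bexI[of _ \<one>]) (auto intro: sifted.one)
  next
    case (step y u)
    obtain k where k: "pivot k u" "agree (Suc k) y u" using step(3) unfolding matches_def by blast
    have ik: "Suc i \<le> k" using pivot_agree[OF k(1) step.prems] .
    have c: "y \<in> carrier G" "t \<in> carrier G" "u \<in> carrier G" using step(1,2) \<open>t \<in> L\<close> L_carrier by auto
    have y1: "agree (Suc i) y \<one>"
      using agree_trans[OF agree_le[OF k(2)] step.prems] ik by simp
    have "agree (Suc k) (inv y \<otimes> u) \<one>"
      using agree_quotient[OF k(2)] c k(1) by (simp add: pivot_def)
    then have "agree (Suc i) (inv y \<otimes> u) \<one>" using agree_le ik by simp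
    from step.IH[OF this] obtain w where
      w: "w \<in> U" "agree (Suc i) w \<one>" "inv y \<otimes> u \<otimes> t = t \<otimes> w" by blast
    have "agree (Suc i) (y \<otimes> t) (\<one> \<otimes> t)"
      using agree_mult[OF y1 agree_refl[of _ t]] c i by simp
    then have yt: "agree (Suc i) (y \<otimes> t) t" using c by simp
    then have "pivot i (y \<otimes> t)" using pivot_cong \<open>pivot i t\<close> by blast
    then obtain z v where z: "z \<in> L" "pivot i z" "agree (Suc i) z (y \<otimes> t)" "v \<in> U"
      "agree (Suc i) v \<one>" "y \<otimes> t = z \<otimes> v"
      using U_decompose[OF LL[OF step(1) \<open>t \<in> L\<close>]] by blast
    \<comment> \<open>The coordinates of \<open>y\<close> up to \<open>i\<close> are trivial, so
      \<open>y \<otimes> t\<close> falls into the slot of \<open>t\<close>, and uniqueness in the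
      table gives \<open>y \<otimes> t = t \<otimes> v\<close>.\<close>
    have "matches z t" using agree_trans[OF z(3) yt] \<open>pivot i t\<close> unfolding matches_def by blast
    then have "z = t" using L_unique z(1) \<open>t \<in> L\<close> by blast
    have c': "w \<in> carrier G" "v \<in> carrier G" using w z U_carrier by auto
    have "u \<otimes> t = y \<otimes> (inv y \<otimes> u \<otimes> t)" using c by (simp add: m_assoc[symmetric])
    also have "\<dots> = y \<otimes> t \<otimes> w" using w(3) c c' by (simp add: m_assoc)
    also have "\<dots> = t \<otimes> (v \<otimes> w)" using z(6) \<open>z = t\<close> c c' by (simp add: m_assoc)
    finally show ?case
      using IH[OF z(4) w(1) z(5) w(2)] agree_mult_one[OF z(5) w(2)] c' i by auto
  qed simp
  show ?case
  proof (intro ballI impI)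
    fix u v
    assume u: "u \<in> U" "agree i u \<one>" and v: "v \<in> U" "agree i v \<one>"
    show "u \<otimes> v \<in> U"
    proof (cases "agree (Suc i) v \<one>")
      case True
      then show ?thesis using right u v by blast
    next
      case False
      then have "pivot i v" using pivot_cases[OF v(2) i] by simp
      then obtain t v' where t: "t \<in> L" "pivot i t" "v' \<in> U" "agree (Suc i) v' \<one>" "v = t \<otimes> v'"
        using U_decompose[OF v(1)] by blast
      have tU: "t \<in> U" and tc: "t \<in> carrier G"
        using U_mult_left[OF t(1,2) sifted.one] t(1) L_carrier by auto
      \<comment> \<open>If \<open>u\<close> has level \<open>i + 1\<close>, then
        \<open>p = t\<close> by commutation. If its pivot is \<open>i\<close>, then \<open>p\<close>
        is the product \<open>y \<otimes> t\<close> of two table elements, which lies in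
        \<open>U\<close> by assumption; this is the only place where that assumption enters for two
        elements of the same pivot.\<close>
      have "\<exists>p\<in>U. \<exists>w\<in>U. agree i p \<one> \<and> agree (Suc i) w \<one> \<and> u \<otimes> t = p \<otimes> w"
      proof (cases "agree (Suc i) u \<one>")
        case True
        then show ?thesis using commute[OF u(1) True t(1,2)] tU t(2) by (auto simp: pivot_def)
      next
        case False
        then have "pivot i u" using pivot_cases[OF u(2) i] by simp
        then obtain y u' where y: "y \<in> L" "pivot i y" "u' \<in> U" "agree (Suc i) u' \<one>" "u = y \<otimes> u'"
          using U_decompose[OF u(1)] by blast
        obtain w where w: "w \<in> U" "agree (Suc i) w \<one>" "u' \<otimes> t = t \<otimes> w"
          using commute[OF y(3,4) t(1,2)] by blast
        have c: "w \<in> carrier G" "u' \<in> carrier G" "y \<in> carrier G"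
          using L_carrier U_carrier w y by auto
        have "agree i (y \<otimes> t) \<one>"
          using agree_mult_one y(2) t(2) c tc i by (simp add: pivot_def)
        moreover have "u \<otimes> t = y \<otimes> t \<otimes> w" using y(5) w(3) c tc by (simp add: m_assoc)
        ultimately show ?thesis using LL[OF y(1) t(1)] w by blast
      qed
      then obtain p w where pw: "p \<in> U" "w \<in> U" "agree i p \<one>" "agree (Suc i) w \<one>" "u \<otimes> t = p \<otimes> w"
        by blast
      have c: "v' \<in> carrier G" "w \<in> carrier G" "u \<in> carrier G" "p \<in> carrier G"
        using t U_carrier pw u by auto
      have "p \<otimes> (w \<otimes> v') \<in> U"
        using right[OF pw(1,3) IH[OF pw(2) t(3) pw(4) t(4)]] agree_mult_one[OF pw(4) t(4)] c i by simp
      then show ?thesis using t(5) pw(5) c tc by (simp add: m_assoc[symmetric])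
    qed
  qed
qed

lemma generated_subset_U:
  assumes "\<And>y z. y \<in> L \<Longrightarrow> z \<in> L \<Longrightarrow> y \<otimes> z \<in> U" "A \<subseteq> U"
  shows "generated (\<otimes>) A \<subseteq> U"
proof
  fix x
  assume "x \<in> generated (\<otimes>) A"
  then show "x \<in> U"
  proof induction
    case (mult x y)
    \<comment> \<open>Below coordinate 0 all elements agree with \<open>\<one>\<close>.\<close>
    then show ?case using U_closed_from[OF assms(1), of 0] by (simp add: agree_def)
  qed (use assms(2) in auto)
qed

text \<open>An entry is determined by its pivot and the value there, since all earlier coordinates
  are those of the identity.\<close>

lemma card_table_le:
  assumes "finite T" "\<And>y j. y \<in> L \<Longrightarrow> j < N \<Longrightarrow> coord y j \<in> T"
  shows "finite L" "card L \<le> N * card T"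
proof -
  define p where "p y = (SOME i. pivot i y)" for y
  have p: "pivot (p y) y" if "y \<in> L" for y
    using pivot_exists[of y] that L_carrier L_nontrivial unfolding p_def by (metis someI_ex subsetD)
  let ?f = "\<lambda>y. (p y, coord y (p y))"
  have "?f ` L \<subseteq> {..<N} \<times> T" using p assms(2) by (auto simp: pivot_def)
  moreover have inj: "inj_on ?f L"
  proof (rule inj_onI)
    fix y z
    assume yz: "y \<in> L" "z \<in> L" "?f y = ?f z"
    have "p y = p z" "coord y (p z) = coord z (p z)" using yz(3) by auto
    then have "agree (Suc (p z)) y z"
      using p[OF yz(1)] p[OF yz(2)] by (simp add: pivot_def agree_Suc) (simp add: agree_def)
    then show "y = z" using L_unique[OF yz(1,2)] p[OF yz(2)] unfolding matches_def by blast
  qed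
  ultimately show "finite L" "card L \<le> N * card T"
    using assms(1) card_inj_on_le[OF inj, of "{..<N} \<times> T"] finite_imageD[OF _ inj]
    by (auto dest: finite_subset)
qed

end

section \<open>Clifford semigroups\<close>

text \<open>Unit and inverse are functions subject to equations, so the structure passes to direct
  powers coordinate by coordinate; the subgroups in the definition of complete regularity would have
  to be chosen anew for each tuple.\<close>

locale clifford =
  fixes C :: "'c set" and mul :: "'c \<Rightarrow> 'c \<Rightarrow> 'c" and unit_of :: "'c \<Rightarrow> 'c" and inverse_of :: "'c \<Rightarrow> 'c"
  assumes closed: "x \<in> C \<Longrightarrow> y \<in> C \<Longrightarrow> mul x y \<in> C"
    and assoc: "x \<in> C \<Longrightarrow> y \<in> C \<Longrightarrow> z \<in> C \<Longrightarrow> mul (mul x y) z = mul x (mul y z)"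
    and unit_closed: "x \<in> C \<Longrightarrow> unit_of x \<in> C"
    and inverse_closed: "x \<in> C \<Longrightarrow> inverse_of x \<in> C"
    and unit_central: "x \<in> C \<Longrightarrow> y \<in> C \<Longrightarrow> mul (unit_of x) y = mul y (unit_of x)"
    and mult_unit: "x \<in> C \<Longrightarrow> mul x (unit_of x) = x"
    and mult_inverse: "x \<in> C \<Longrightarrow> mul x (inverse_of x) = unit_of x"
    and inverse_mult: "x \<in> C \<Longrightarrow> mul (inverse_of x) x = unit_of x"
    and unit_mult: "x \<in> C \<Longrightarrow> y \<in> C \<Longrightarrow> unit_of (mul x y) = mul (unit_of x) (unit_of y)"
    and unit_unit: "x \<in> C \<Longrightarrow> unit_of (unit_of x) = unit_of x"
    and unit_inverse: "x \<in> C \<Longrightarrow> unit_of (inverse_of x) = unit_of x"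
begin

lemma unit_idem: "x \<in> C \<Longrightarrow> mul (unit_of x) (unit_of x) = unit_of x"
  using mult_unit[of "unit_of x"] unit_closed unit_unit by simp

text \<open>The maximal subgroup around \<open>b\<close>. As units multiply, the semigroup is a
  semilattice of these groups.\<close>

definition component :: "'c \<Rightarrow> 'c monoid" where
  "component b = \<lparr>carrier = {x \<in> C. unit_of x = unit_of b}, monoid.mult = mul, one = unit_of b\<rparr>"

lemma component_group:
  assumes "b \<in> C"
  shows "group (component b)"
proof (rule groupI)
  fix x
  assume x: "x \<in> carrier (component b)"
  show "\<one>\<^bsub>component b\<^esub> \<otimes>\<^bsub>component b\<^esub> x = x"
    using x mult_unit[of x] unit_central[of x x] by (simp add: component_def)
  show "\<exists>y\<in>carrier (component b). y \<otimes>\<^bsub>component b\<^esub> x = \<one>\<^bsub>component b\<^esub>"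
    using x inverse_mult[of x] inverse_closed[of x] unit_inverse[of x]
    by (intro bexI[of _ "inverse_of x"]) (auto simp: component_def)
qed (use assms closed assoc unit_closed unit_mult unit_unit unit_idem in \<open>auto simp: component_def\<close>)

lemma component_inv:
  assumes "b \<in> C" "x \<in> carrier (component b)"
  shows "inv\<^bsub>component b\<^esub> x = inverse_of x"
proof -
  interpret group "component b" using component_group[OF assms(1)] .
  show ?thesis
    using assms inverse_mult[of x] inverse_closed[of x] unit_inverse[of x]
    by (intro inv_equality) (auto simp: component_def)
qed

lemma generated_closed: "A \<subseteq> C \<Longrightarrow> x \<in> generated mul A \<Longrightarrow> x \<in> C"
  by (erule generated.induct[where P = "\<lambda>x. x \<in> C"]) (auto simp: closed)

text \<open>In a finite group the identity and all inverses are positive powers, so generating as a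
  semigroup already yields a group.\<close>

lemma generated_unit_inverse:
  assumes "finite C" "A \<subseteq> C" "x \<in> generated mul A"
  shows "unit_of x \<in> generated mul A" "inverse_of x \<in> generated mul A"
proof -
  have x: "x \<in> C" using generated_closed assms by blast
  interpret G: group "component x" using component_group[OF x] .
  have carr: "x \<in> carrier (component x)" using x by (simp add: component_def)
  have pow: "x [^]\<^bsub>component x\<^esub> Suc n \<in> generated mul A" for n
  proof (induction n)
    case 0
    then show ?case using assms(3) G.nat_pow_Suc[of x 0] G.l_one[OF carr] by simp
  next
    case (Suc n)
    then show ?case
      using G.nat_pow_Suc[of x "Suc n"] generated.mult[OF Suc assms(3)]
      by (simp add: component_def)
  qed
  let ?n = "Coset.order (component x)"
  have "finite (carrier (component x))" using assms(1) by (simp add: component_def)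
  then have n: "0 < ?n" using G.order_gt_0_iff_finite by simp
  have one: "x [^]\<^bsub>component x\<^esub> ?n = unit_of x"
    using G.pow_order_eq_1[OF carr] by (simp add: component_def)
  then show "unit_of x \<in> generated mul A"
    using pow[of "?n - 1"] n by simp
  \<comment> \<open>The exponent \<open>2 * ?n - 1\<close> is positive also for the trivial group,
    where \<open>?n - 1\<close> would give the empty product.\<close>
  have "x [^]\<^bsub>component x\<^esub> Suc (2 * ?n - 2) \<otimes>\<^bsub>component x\<^esub> x = x [^]\<^bsub>component x\<^esub> (?n * 2)"
    using n by (cases ?n) (simp_all add: mult.commute)
  also have "\<dots> = \<one>\<^bsub>component x\<^esub>"
    using G.pow_order_eq_1[OF carr] by (simp add: G.nat_pow_pow[OF carr, symmetric])
  finally have "inv\<^bsub>component x\<^esub> x = x [^]\<^bsub>component x\<^esub> Suc (2 * ?n - 2)"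
    using G.inv_equality carr G.nat_pow_closed by blast
  then show "inverse_of x \<in> generated mul A"
    using pow component_inv[OF x carr] by simp
qed

section \<open>The semilattice of units\<close>

definition above :: "'c \<Rightarrow> 'c \<Rightarrow> bool" where
  "above a b \<longleftrightarrow> mul (unit_of a) (unit_of b) = unit_of b"

lemma above_multD:
  assumes "above (mul x y) b" "x \<in> C" "y \<in> C" "b \<in> C"
  shows "above x b" "above y b"
proof -
  have u: "unit_of x \<in> C" "unit_of y \<in> C" "unit_of b \<in> C" using unit_closed assms by auto
  have xyb: "mul (unit_of x) (mul (unit_of y) (unit_of b)) = unit_of b"
    using assms u by (simp add: above_def unit_mult assoc)
  have "mul (unit_of x) (mul (unit_of x) (mul (unit_of y) (unit_of b))) =
      mul (unit_of x) (mul (unit_of y) (unit_of b))"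
    using u assms closed unit_idem by (simp add: assoc[symmetric])
  then show "above x b" by (simp add: above_def xyb)
  have "mul (unit_of y) (unit_of b) = mul (unit_of x) (mul (mul (unit_of y) (unit_of y)) (unit_of b))"
    by (metis assms(3) assoc closed u unit_central xyb)
  then show "above y b" using u assms by (simp add: above_def xyb unit_idem)
qed

lemma above_trans:
  assumes "above a b" "above b c" "a \<in> C" "b \<in> C" "c \<in> C"
  shows "above a c"
  using assms assoc[of "unit_of a" "unit_of b" "unit_of c"] unit_closed by (simp add: above_def)

lemma above_mult:
  assumes "above a c" "above b c" "a \<in> C" "b \<in> C" "c \<in> C"
  shows "above (mul a b) c"
  using assms assoc[of "unit_of a" "unit_of b" "unit_of c"] unit_closed
  by (simp add: above_def unit_mult)

lemma above_refl: "a \<in> C \<Longrightarrow> above a a"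
  by (simp add: above_def unit_idem)

lemma above_mult_left:
  assumes "a \<in> C" "b \<in> C"
  shows "above a (mul a b)" "above b (mul a b)"
  using above_multD[OF above_refl assms] closed assms by auto

lemma above_antisym:
  assumes "above a b" "above b a" "a \<in> C" "b \<in> C"
  shows "unit_of a = unit_of b"
  using assms unit_central[of a "unit_of b"] unit_closed by (simp add: above_def)

text \<open>On elements above \<open>b\<close> this is the structure homomorphism into the component
  of \<open>b\<close>.\<close>

definition lower :: "'c \<Rightarrow> 'c \<Rightarrow> 'c" where
  "lower b a = mul a (unit_of b)"

lemma lower_component:
  assumes "a \<in> C" "b \<in> C" "above a b"
  shows "lower b a \<in> carrier (component b)"
  using assms closed unit_closed unit_mult unit_unit by (simp add: lower_def component_def above_def)

lemma lower_mult:
  assumes "x \<in> C" "y \<in> C" "b \<in> C"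
  shows "lower b (mul x y) = mul (lower b x) (lower b y)"
proof -
  have u: "unit_of b \<in> C" using unit_closed assms by auto
  have "mul (lower b x) (lower b y) = mul x (mul (mul (unit_of b) y) (unit_of b))"
    using assms u closed by (simp add: lower_def assoc)
  also have "\<dots> = mul x (mul y (mul (unit_of b) (unit_of b)))"
    using assms u closed by (simp add: unit_central[of b y] assoc)
  finally show ?thesis using assms u by (simp add: lower_def unit_idem assoc)
qed

text \<open>Every factor of a product equal to \<open>b\<close> is above \<open>b\<close>, and
  multiplying the factors by the central unit of \<open>b\<close> does not change \<open>b\<close>.
  Conversely, a product of lowered generators is a product of generators times the unit of
  \<open>b\<close>; this is the unit of \<open>m\<close>, hence a power of a product of generators.
  The element \<open>m\<close> serves as the meet of the relevant generators.\<close>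

lemma generated_iff_lower:
  assumes "finite C" "A \<subseteq> C" "b \<in> C"
    and m: "m \<in> generated mul {a \<in> A. above a b}" and m_below: "\<And>a. a \<in> A \<Longrightarrow> above a b \<Longrightarrow> above a m"
  shows "b \<in> generated mul A \<longleftrightarrow>
    unit_of m = unit_of b \<and> b \<in> generated mul (lower b ` {a \<in> A. above a b})"
proof -
  let ?A = "{a \<in> A. above a b}"
  have A: "?A \<subseteq> C" using assms(2) by auto
  have m_C: "m \<in> C" using generated_closed[OF A m] .
  show ?thesis
  proof
    assume b: "b \<in> generated mul A"
    have in_lower: "above x b \<longrightarrow> lower b x \<in> generated mul (lower b ` ?A)"
      and x_m: "above x b \<longrightarrow> above x m" if "x \<in> generated mul A" for x
      using that
    proof (induction x)
      case (mult x y)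
      have c: "x \<in> C" "y \<in> C" using mult generated_closed assms(2) by auto
      {
        case 1
        show ?case
          using mult above_multD[OF _ c assms(3)] lower_mult[OF c assms(3)]
            generated.mult[of "lower b x" mul _ "lower b y"] by simp
      next
        case 2
        show ?case using mult above_multD[OF _ c assms(3)] above_mult c m_C by blast
      }
    qed (use m_below in \<open>auto intro: generated.gen\<close>)
    have "lower b b = b" using assms(3) by (simp add: lower_def mult_unit)
    moreover have "above m b"
      using m
    proof induction
      case (mult x y)
      then show ?case using above_mult generated_closed[OF A] assms(3) by blast
    qed simp
    ultimately show "unit_of m = unit_of b \<and> b \<in> generated mul (lower b ` ?A)"
      using in_lower[OF b] x_m[OF b] above_refl[OF assms(3)] above_antisym[of m b] assms(3) m_C
      by simp
  next
    assume b: "unit_of m = unit_of b \<and> b \<in> generated mul (lower b ` ?A)"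
    have "\<exists>y \<in> generated mul A. x = lower b y" if "x \<in> generated mul (lower b ` ?A)" for x
      using that
    proof induction
      case (mult x y)
      then obtain x' y' where "x' \<in> generated mul A" "y' \<in> generated mul A" "x = lower b x'" "y = lower b y'"
        by blast
      moreover have "x' \<in> C" "y' \<in> C" using calculation generated_closed assms(2) by auto
      ultimately show ?case using lower_mult assms(3) generated.mult[of x' mul A y'] by metis
    qed (auto intro: generated.gen)
    then obtain y where y: "y \<in> generated mul A" "b = mul y (unit_of m)"
      using b by (auto simp: lower_def)
    have "x \<in> generated mul A" if "x \<in> generated mul ?A" for x
      using that by induction (auto intro: generated.intros)
    then have "unit_of m \<in> generated mul A"
      using generated_unit_inverse(1)[OF assms(1) A m] by blast
    then show "b \<in> generated mul A" using y generated.mult by metis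
  qed
qed

end

section \<open>Direct powers of Clifford semigroups\<close>

text \<open>The subgroup around an element is not unique, but its identity is, because idempotents
  are central. So the laws for the unit follow by exhibiting any suitable pair of unit and
  inverse.\<close>

lemma clifford_semigroup_on_clifford:
  assumes "clifford_semigroup_on S f"
  obtains e i where "clifford S f e i"
proof -
  have closed: "f x y \<in> S" if "x \<in> S" "y \<in> S" for x y
    using assms that
    by (auto simp: clifford_semigroup_on_def completely_regular_on_def semigroup_on_def)
  have assoc: "f (f x y) z = f x (f y z)" if "x \<in> S" "y \<in> S" "z \<in> S" for x y z
    using assms that
    by (auto simp: clifford_semigroup_on_def completely_regular_on_def semigroup_on_def)
  have central: "f e x = f x e" if "e \<in> S" "f e e = e" "x \<in> S" for e x
    using assms that by (auto simp: clifford_semigroup_on_def)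
  define unit_inverse where "unit_inverse x u \<longleftrightarrow> fst u \<in> S \<and> snd u \<in> S \<and> f (fst u) (fst u) = fst u \<and>
    f x (fst u) = x \<and> f (fst u) (snd u) = snd u \<and> f x (snd u) = fst u \<and> f (snd u) x = fst u" for x u
  have ex: "\<exists>u. unit_inverse x u" if x: "x \<in> S" for x
  proof -
    obtain H e where H: "x \<in> H" "H \<subseteq> S" "group \<lparr>carrier = H, monoid.mult = f, one = e\<rparr>"
      using assms x unfolding clifford_semigroup_on_def completely_regular_on_def subsemigroup_on_def
      by blast
    interpret group "\<lparr>carrier = H, monoid.mult = f, one = e\<rparr>" by (rule H(3))
    obtain y where "y \<in> H" "f y x = e" using l_inv_ex[of x] H(1) by auto
    moreover have "f x y = e" using inv_comm[of y x] calculation H(1) by simp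
    ultimately have "unit_inverse x (e, y)"
      using H(1,2) one_closed l_one[of y] l_one[of e] r_one[of x] by (auto simp: unit_inverse_def)
    then show ?thesis ..
  qed
  have unique: "e = e'" if "unit_inverse x (e, y)" "unit_inverse x (e', y')" "x \<in> S" for x e y e' y'
  proof -
    have u: "e \<in> S" "e' \<in> S" "y \<in> S" "y' \<in> S" "f e e = e" "f e' e' = e'" "f x e = x" "f x e' = x"
      "f x y = e" "f x y' = e'"
      using that by (auto simp: unit_inverse_def)
    \<comment> \<open>Centrality moves \<open>e'\<close> to the right of \<open>x\<close>, where it
      is absorbed, so \<open>f e' e = e\<close>; symmetrically \<open>f e e' = e'\<close>.\<close>
    have "f e' e = f (f e' x) y" using u assoc that(3) by simp
    also have "\<dots> = e" using central[of e' x] u that(3) by simp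
    finally have 1: "f e' e = e" .
    have "f e e' = f (f e x) y'" using u assoc that(3) by simp
    also have "\<dots> = e'" using central[of e x] u that(3) by simp
    finally show ?thesis using 1 central[of e e'] u by simp
  qed
  define e where "e x = fst (SOME u. unit_inverse x u)" for x
  define i where "i x = snd (SOME u. unit_inverse x u)" for x
  have ui: "unit_inverse x (e x, i x)" if "x \<in> S" for x
    using someI_ex[OF ex[OF that]] by (simp add: e_def i_def)
  have uiD: "e x \<in> S" "i x \<in> S" "f (e x) (e x) = e x" "f x (e x) = x" "f (e x) (i x) = i x"
    "f x (i x) = e x" "f (i x) x = e x" if "x \<in> S" for x
    using ui[OF that] by (auto simp: unit_inverse_def)
  \<comment> \<open>The pair for \<open>f x y\<close> consists of the product of the units and the
    product of the inverses in opposite order.\<close>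
  have mult: "e (f x y) = f (e x) (e y)" if x: "x \<in> S" and y: "y \<in> S" for x y
  proof (rule unique[OF ui])
    note S = x y uiD(1,2)[OF x] uiD(1,2)[OF y]
    have e_y: "f (e y) z = f z (e y)" and e_x: "f (e x) z = f z (e x)" if "z \<in> S" for z
      using central uiD x y that by auto
    have idem: "f (f (e x) (e y)) (f (e x) (e y)) = f (e x) (e y)"
      by (metis S assoc closed e_y uiD(3) x y)
    have xy: "f (f x y) (f (e x) (e y)) = f x y"
      by (metis S assoc closed e_x uiD(4) x y)
    have inv: "f (f (e x) (e y)) (f (i y) (i x)) = f (i y) (i x)"
      by (metis S assoc closed e_x uiD(5) x y)
    have right: "f (f x y) (f (i y) (i x)) = f (e x) (e y)"
      by (metis S assoc closed e_y uiD(6) x y)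
    have left: "f (f (i y) (i x)) (f x y) = f (e x) (e y)"
      by (metis S assoc closed e_x uiD(7) x y)
    show "unit_inverse (f x y) (f (e x) (e y), f (i y) (i x))"
      using S idem xy inv right left closed by (simp add: unit_inverse_def)
  qed (use closed x y in auto)
  have unit: "e (e x) = e x" if "x \<in> S" for x
    using uiD[OF that] unique[OF ui, of "e x" "e x" "e x"] by (simp add: unit_inverse_def)
  have inverse: "e (i x) = e x" if x: "x \<in> S" for x
  proof (rule unique[OF ui])
    show "unit_inverse (i x) (e x, x)"
      using uiD[OF x] central[of "e x" "i x"] central[of "e x" x] x by (simp add: unit_inverse_def)
  qed (use uiD x in auto)
  have "clifford S f e i"
    using closed assoc uiD central mult unit inverse by unfold_locales auto
  then show ?thesis by (rule that)
qed

section \<open>Adjoining a zero and forming powers\<close>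

fun option_mult :: "'a set \<Rightarrow> ('a \<Rightarrow> 'a \<Rightarrow> 'a) \<Rightarrow> 'a option \<Rightarrow> 'a option \<Rightarrow> 'a option" where
  "option_mult S f (Some x) (Some y) = (if x \<in> S \<and> y \<in> S then Some (f x y) else None)"
| "option_mult S f _ _ = None"

definition option_map_on :: "'a set \<Rightarrow> ('a \<Rightarrow> 'a) \<Rightarrow> 'a option \<Rightarrow> 'a option" where
  "option_map_on S g x = (case x of Some y \<Rightarrow> if y \<in> S then Some (g y) else None | None \<Rightarrow> None)"

lemma option_map_on_simps [simp]:
  "option_map_on S g None = None" "x \<in> S \<Longrightarrow> option_map_on S g (Some x) = Some (g x)"
  by (auto simp: option_map_on_def)

text \<open>\<open>None\<close> is a zero and forms a component of its own, being its own unit and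
  inverse; a coordinate with this value never becomes a pivot.\<close>

lemma clifford_option:
  assumes "clifford S f e i"
  shows "clifford (smp_alphabet S) (option_mult S f) (option_map_on S e) (option_map_on S i)"
proof -
  interpret clifford S f e i by fact
  show ?thesis
  proof
    fix x y
    assume xy: "x \<in> smp_alphabet S" "y \<in> smp_alphabet S"
    show "option_mult S f x y \<in> smp_alphabet S"
      using xy by (auto simp: smp_alphabet_def closed)
    show "option_mult S f (option_map_on S e x) y = option_mult S f y (option_map_on S e x)"
      using xy by (auto simp: smp_alphabet_def unit_closed intro: unit_central)
    show "option_map_on S e (option_mult S f x y) =
        option_mult S f (option_map_on S e x) (option_map_on S e y)"
      using xy by (auto simp: smp_alphabet_def closed unit_closed unit_mult)
    fix z
    assume "z \<in> smp_alphabet S"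
    then show "option_mult S f (option_mult S f x y) z = option_mult S f x (option_mult S f y z)"
      using xy by (auto simp: smp_alphabet_def closed assoc)
  qed (auto simp: smp_alphabet_def unit_closed inverse_closed mult_unit mult_inverse inverse_mult
      unit_unit unit_inverse)
qed

lemma power_carrier_nth: "x \<in> power_carrier S n \<Longrightarrow> j < n \<Longrightarrow> x ! j \<in> S"
  by (auto simp: power_carrier_def)

lemma power_carrier_length: "x \<in> power_carrier S n \<Longrightarrow> length x = n"
  by (simp add: power_carrier_def)

lemma power_carrierI: "length x = n \<Longrightarrow> (\<And>j. j < n \<Longrightarrow> x ! j \<in> S) \<Longrightarrow> x \<in> power_carrier S n"
  by (auto simp: power_carrier_def in_set_conv_nth)

lemma clifford_power:
  assumes "clifford S f e i"
  shows "clifford (power_carrier S n) (map2 f) (map e) (map i)"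
proof -
  interpret clifford S f e i by fact
  have nth: "x ! j \<in> S" if "x \<in> power_carrier S n" "j < n" for x j
    using that by (rule power_carrier_nth)
  have len: "length x = n" if "x \<in> power_carrier S n" for x
    using that by (rule power_carrier_length)
  show ?thesis
  proof
    fix x y
    assume xy: "x \<in> power_carrier S n" "y \<in> power_carrier S n"
    show "map2 f x y \<in> power_carrier S n"
      by (rule power_carrierI) (simp_all add: xy len nth closed)
    show "map2 f (map e x) y = map2 f y (map e x)"
      by (rule nth_equalityI) (simp_all add: xy len nth unit_central)
    show "map e (map2 f x y) = map2 f (map e x) (map e y)"
      by (rule nth_equalityI) (simp_all add: xy len nth unit_mult)
    fix z
    assume "z \<in> power_carrier S n"
    then show "map2 f (map2 f x y) z = map2 f x (map2 f y z)"
      by (intro nth_equalityI) (simp_all add: xy len nth assoc)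
  next
    fix x
    assume x: "x \<in> power_carrier S n"
    show "map e x \<in> power_carrier S n" "map i x \<in> power_carrier S n"
      by (rule power_carrierI; simp add: x len nth unit_closed inverse_closed)+
    show "map2 f x (map e x) = x"
      by (rule nth_equalityI) (simp_all add: x len nth mult_unit)
    show "map2 f x (map i x) = map e x"
      by (rule nth_equalityI) (simp_all add: x len nth mult_inverse)
    show "map2 f (map i x) x = map e x"
      by (rule nth_equalityI) (simp_all add: x len nth inverse_mult)
    show "map e (map e x) = map e x"
      by (rule nth_equalityI) (simp_all add: x len nth unit_unit)
    show "map e (map i x) = map e x"
      by (rule nth_equalityI) (simp_all add: x len nth unit_inverse)
  qed
qed

lemma finite_power_carrier: "finite S \<Longrightarrow> finite (power_carrier S n)"
  using finite_lists_length_eq[of S n] by (simp add: power_carrier_def in_lists_conv_set subset_eq)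

text \<open>
  The input is read from its right end, so that the target comes first and a delimiter stands at
  the beginning of a block. The delimiter is treated as one more coordinate of the tuple, which
  takes values in the trivial component of the zero \<^term>\<open>None\<close> adjoined to \<open>S\<close>.
\<close>

definition block :: "'a list \<Rightarrow> 'a option list" where
  "block x = rev (encode_tuple x)"

lemma block_eq: "block x = None # rev (map Some x)"
  by (simp add: block_def encode_tuple_def)

lemma block_inject: "block x = block y \<longleftrightarrow> x = y"
  by (simp add: block_eq inj_map_eq_map)

lemma block_power_carrier: "block x \<in> power_carrier (smp_alphabet S) (Suc n) \<longleftrightarrow> x \<in> power_carrier S n"
  by (auto simp: block_eq power_carrier_def smp_alphabet_def)

lemma block_mult:
  assumes "x \<in> power_carrier S n" "y \<in> power_carrier S n"
  shows "map2 (option_mult S f) (block x) (block y) = block (map2 f x y)"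
proof (rule nth_equalityI)
  have len: "length x = n" "length y = n" using assms by (auto simp: power_carrier_length)
  show "length (map2 (option_mult S f) (block x) (block y)) = length (block (map2 f x y))"
    by (simp add: block_eq len)
  fix j
  assume j: "j < length (map2 (option_mult S f) (block x) (block y))"
  show "map2 (option_mult S f) (block x) (block y) ! j = block (map2 f x y) ! j"
  proof (cases j)
    case (Suc k)
    then have "k < n" using j by (simp add: block_eq len)
    then show ?thesis
      using power_carrier_nth[OF assms(1), of "n - Suc k"] power_carrier_nth[OF assms(2), of "n - Suc k"]
      by (simp add: Suc block_eq len rev_nth)
  qed (simp add: block_eq)
qed

text \<open>\<open>block\<close> is an injective homomorphism: the order of coordinates is reversed
  in all tuples alike, and the added one only multiplies zeros.\<close>

lemma block_generated:
  assumes "clifford S f e i" "A \<subseteq> power_carrier S n"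
  shows "block b \<in> generated (map2 (option_mult S f)) (block ` A) \<longleftrightarrow> b \<in> generated (map2 f) A"
proof -
  interpret clifford "power_carrier S n" "map2 f" "map e" "map i"
    using assms(1) by (rule clifford_power)
  have "\<exists>y \<in> generated (map2 f) A. x = block y"
    if "x \<in> generated (map2 (option_mult S f)) (block ` A)" for x
    using that
  proof induction
    case (mult x y)
    then obtain x' y' where xy: "x' \<in> generated (map2 f) A" "y' \<in> generated (map2 f) A"
      "x = block x'" "y = block y'" by blast
    then have "x' \<in> power_carrier S n" "y' \<in> power_carrier S n"
      using generated_closed assms(2) by auto
    then show ?case using xy generated.mult[OF xy(1,2)] block_mult by metis
  qed (auto intro: generated.gen)
  moreover have "block y \<in> generated (map2 (option_mult S f)) (block ` A)"
    if "y \<in> generated (map2 f) A" for y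
    using that
  proof induction
    case (mult x y)
    then have "x \<in> power_carrier S n" "y \<in> power_carrier S n"
      using generated_closed assms(2) by auto
    then show ?case using generated.mult[OF mult.IH] block_mult by metis
  qed (auto intro: generated.gen)
  ultimately show ?thesis by (metis block_inject)
qed

section \<open>Sweeps over synchronized stacks\<close>

lemma nth_blank_drop: "nth_blank (drop k xs) j = nth_blank xs (k + j)"
  by (auto simp: nth_blank_def)

lemma tl_drop: "tl (drop k xs) = drop (Suc k) xs"
  by (simp add: drop_Suc tl_drop)

definition column :: "nat set \<Rightarrow> 'b store \<Rightarrow> nat \<Rightarrow> nat \<Rightarrow> 'b tape_symbol" where
  "column D \<sigma> j = (\<lambda>r. if r \<in> D then nth_blank (\<sigma> r) j else Blank)"

definition forward :: "nat set \<Rightarrow> ('b tape_symbol \<Rightarrow> (nat \<Rightarrow> 'b tape_symbol) \<Rightarrow> 'b tape_symbol) \<Rightarrow> 'b instr" where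
  "forward D h t r =
     (if r = 20 then Put (h (t 20) (\<lambda>s. if s \<in> D then t s else Blank))
      else if r \<in> D then Pop
      else if 10 \<le> r \<and> r - 10 \<in> D then Push (t (r - 10)) else Keep)"

type_synonym 'b emitter = "'b tape_symbol \<Rightarrow> nat \<Rightarrow> ((nat \<Rightarrow> 'b tape_symbol) \<Rightarrow> 'b tape_symbol) option"

text \<open>The emitted values may depend on the fold over all columns, kept in register 20, which
  is known only after the forward pass; this is why a sweep goes over the tuples twice. A stack in
  \<open>D\<close> without an emitter loses its top block.\<close>

definition backward :: "nat set \<Rightarrow> 'b emitter \<Rightarrow> 'b instr" where
  "backward D out t r =
     (if 10 \<le> r \<and> r - 10 \<in> D then Pop
      else if r < 10 then
        (case out (t 20) r of None \<Rightarrow> Keep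
         | Some v \<Rightarrow> Push (v (\<lambda>s. if s \<in> D then t (s + 10) else Blank)))
      else Keep)"

definition put :: "nat \<Rightarrow> 'b tape_symbol \<Rightarrow> 'b cmd" where
  "put s x = Do (\<lambda>t r. if r = s then Put x else Keep)"

text \<open>
  Stack 1 always carries one block of \<open>N\<close> non-blank symbols, which serves as the loop counter.
  A sweep pops the top \<open>N\<close> symbols of every stack in \<open>D\<close> (including 1) onto its shadow, the stack
  with index shifted by 10, while \<open>h\<close> folds the columns into the register 20; then it pops the
  shadows and pushes onto the stacks the values that \<open>out\<close> computes from the columns.
\<close>

definition sweep :: "nat set \<Rightarrow> ('b tape_symbol \<Rightarrow> (nat \<Rightarrow> 'b tape_symbol) \<Rightarrow> 'b tape_symbol) \<Rightarrow> 'b emitter \<Rightarrow> 'b cmd" where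
  "sweep D h out = Seq (put 20 (Aux 0)) (Seq (Loop (\<lambda>t. t 1 \<noteq> Blank) (Do (forward D h)))
     (Loop (\<lambda>t. t 11 \<noteq> Blank) (Do (backward D out))))"

definition sweep_flag :: "nat set \<Rightarrow> ('b tape_symbol \<Rightarrow> (nat \<Rightarrow> 'b tape_symbol) \<Rightarrow> 'b tape_symbol) \<Rightarrow> nat \<Rightarrow> 'b store \<Rightarrow> 'b tape_symbol" where
  "sweep_flag D h n \<sigma> = foldl h (Aux 0) (map (column D \<sigma>) [0..<n])"

definition sweep_stack :: "nat set \<Rightarrow> 'b emitter \<Rightarrow> nat \<Rightarrow> 'b tape_symbol \<Rightarrow> 'b store \<Rightarrow> 'b store" where
  "sweep_stack D out n f \<sigma> r =
     (case out f r of None \<Rightarrow> [] | Some v \<Rightarrow> map (\<lambda>j. v (column D \<sigma> j)) [0..<n]) @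
     (if r \<in> D then drop n (\<sigma> r) else \<sigma> r)"

definition sweep_result :: "nat set \<Rightarrow> ('b tape_symbol \<Rightarrow> (nat \<Rightarrow> 'b tape_symbol) \<Rightarrow> 'b tape_symbol) \<Rightarrow> 'b emitter \<Rightarrow> nat \<Rightarrow> 'b store \<Rightarrow> 'b store" where
  "sweep_result D h out n \<sigma> r =
     (if r = 20 then [sweep_flag D h n \<sigma>]
      else if r < 10 then sweep_stack D out n (sweep_flag D h n \<sigma>) \<sigma> r
      else \<sigma> r)"

lemma wp_put:
  "\<lbrakk>length (\<sigma> s) \<le> 1; Q (\<sigma>(s := [x])); 2 \<le> n\<rbrakk> \<Longrightarrow> wp (put s x) n Q \<sigma>"
  unfolding put_def
  by (rule wp_Do) (auto elim!: back_subst[of Q] simp: update_def fun_eq_iff le_Suc_eq length_Suc_conv)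

text \<open>Two loops over \<open>N\<close> columns at three steps per round, two for the
  instruction and one for the test, give \<open>6 * N\<close>; the rest is overhead.\<close>

lemma wp_sweep:
  assumes D: "D \<subseteq> {..<10}" "1 \<in> D" and len: "length (\<sigma> 1) = N" and nonblank: "Blank \<notin> set (\<sigma> 1)"
    and shadows: "\<And>r. 10 \<le> r \<Longrightarrow> r < 20 \<Longrightarrow> \<sigma> r = []" and flag: "length (\<sigma> 20) \<le> 1"
    and Q: "Q (sweep_result D h out N \<sigma>)" and n: "6 * N + 6 \<le> n"
  shows "wp (sweep D h out) n Q \<sigma>"
proof -
  define shadow where "shadow k r = rev (map (nth_blank (\<sigma> (r - 10))) [0..<k])" for k r
  define fwd where "fwd k r = (if r = 20 then [sweep_flag D h k \<sigma>]
    else if r \<in> D then drop k (\<sigma> r)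
    else if 10 \<le> r \<and> r - 10 \<in> D then shadow k r else \<sigma> r)" for k r
  \<comment> \<open>The store with \<open>k\<close> columns still on the shadows. These hold the
    columns in reverse, so pushing proceeds from the last coordinate to the first and restores the
    order; the two descriptions meet at \<open>fwd N = bwd N\<close>.\<close>
  define bwd where "bwd k r = (if r = 20 then [sweep_flag D h N \<sigma>]
    else if 10 \<le> r \<and> r - 10 \<in> D then shadow k r
    else if r < 10 then
        (case out (sweep_flag D h N \<sigma>) r of None \<Rightarrow> []
         | Some v \<Rightarrow> map (\<lambda>j. v (column D \<sigma> j)) [k..<N]) @
        (if r \<in> D then drop N (\<sigma> r) else \<sigma> r)
    else \<sigma> r)" for k r
  have D': "r < 10" if "r \<in> D" for r using D(1) that by auto
  have start: "\<sigma>(20 := [Aux 0]) = fwd 0"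
    using shadows D' by (fastforce simp: fwd_def shadow_def sweep_flag_def fun_eq_iff)
  have fwd_step: "update (forward D h) (fwd k) = fwd (Suc k)" for k
  proof
    fix r
    have col: "(\<lambda>s. if s \<in> D then tops (fwd k) s else Blank) = column D \<sigma> k"
      using D' by (fastforce simp: tops_def fwd_def column_def nth_blank_drop fun_eq_iff)
    have "tops (fwd k) 20 = sweep_flag D h k \<sigma>" by (simp add: tops_def fwd_def)
    moreover have "tops (fwd k) s = nth_blank (\<sigma> s) k" if "s \<in> D" for s
      using that D'[of s] by (simp add: tops_def fwd_def nth_blank_drop)
    ultimately show "update (forward D h) (fwd k) r = fwd (Suc k) r"
      using D'[of 20] D'[of r] D'[of "r - 10"]
      by (auto simp: update_def forward_def col) (auto simp: fwd_def shadow_def sweep_flag_def tl_drop)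
  qed
  have bwd_step: "update (backward D out) (bwd (Suc k)) = bwd k" if "k < N" for k
  proof
    fix r
    have "tops (bwd (Suc k)) (s + 10) = nth_blank (\<sigma> s) k" if "s \<in> D" for s
      using that D'[of s] by (simp add: tops_def bwd_def shadow_def)
    then have col: "(\<lambda>s. if s \<in> D then tops (bwd (Suc k)) (s + 10) else Blank) = column D \<sigma> k"
      by (auto simp: column_def fun_eq_iff)
    have "tops (bwd (Suc k)) 20 = sweep_flag D h N \<sigma>" by (simp add: tops_def bwd_def)
    then show "update (backward D out) (bwd (Suc k)) r = bwd k r"
      using D'[of "r - 10"] that
      by (auto simp: update_def backward_def col split: option.splits)
        (auto simp: bwd_def shadow_def upt_conv_Cons)
  qed
  have counter: "nth_blank (\<sigma> 1) k \<noteq> Blank \<longleftrightarrow> k < N" for k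
    using len nonblank by (auto simp: nth_blank_def in_set_conv_nth)
  have fwd_cond: "tops (fwd k) 1 \<noteq> Blank \<longleftrightarrow> k < N" for k
    using D(2) counter by (simp add: tops_def fwd_def nth_blank_drop)
  have bwd_cond: "tops (bwd k) 11 \<noteq> Blank \<longleftrightarrow> 0 < k" if "k \<le> N" for k
    using D(2) counter[of "k - 1"] that
    by (cases k) (auto simp: tops_def bwd_def shadow_def)
  have fwd_bwd: "fwd N = bwd N"
    using D' by (fastforce simp: fwd_def bwd_def fun_eq_iff split: option.split)
  have finish: "bwd 0 = sweep_result D h out N \<sigma>"
  proof
    fix r
    show "bwd 0 r = sweep_result D h out N \<sigma> r"
      using shadows[of r] D'[of "r - 10"] by (auto simp: bwd_def sweep_result_def sweep_stack_def shadow_def)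
  qed
  have "wp (Loop (\<lambda>t. t 11 \<noteq> Blank) (Do (backward D out))) (3 * N + 1) Q (bwd N)"
  proof (rule wp_Loop[where I = "\<lambda>k \<tau>. \<tau> = bwd k \<and> k \<le> N" and v = N])
    fix k \<tau>
    assume "\<tau> = bwd k \<and> k \<le> N" "tops \<tau> 11 \<noteq> Blank"
    then show "wp (Do (backward D out)) 2 (\<lambda>\<tau>'. \<exists>k'<k. \<tau>' = bwd k' \<and> k' \<le> N) \<tau>"
      using bwd_cond[of k] bwd_step[of "k - 1"] by (intro wp_Do) (auto intro!: exI[of _ "k - 1"])
  next
    fix k \<tau>
    assume "\<tau> = bwd k \<and> k \<le> N" "\<not> tops \<tau> 11 \<noteq> Blank"
    then show "Q \<tau>" using bwd_cond[of k] Q finish by auto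
  qed auto
  then have bwd_loop: "wp (Loop (\<lambda>t. t 11 \<noteq> Blank) (Do (backward D out))) (3 * N + 1) Q (fwd N)"
    unfolding fwd_bwd .
  have 1: "wp (Loop (\<lambda>t. t 1 \<noteq> Blank) (Do (forward D h))) (3 * N + 1)
    (wp (Loop (\<lambda>t. t 11 \<noteq> Blank) (Do (backward D out))) (3 * N + 1) Q) (fwd 0)"
  proof (rule wp_Loop[where I = "\<lambda>k \<tau>. \<tau> = fwd (N - k) \<and> k \<le> N" and v = N])
    fix k \<tau>
    assume k: "\<tau> = fwd (N - k) \<and> k \<le> N" "tops \<tau> 1 \<noteq> Blank"
    then have "0 < k" using fwd_cond[of "N - k"] by auto
    then have "N - (k - 1) = Suc (N - k)" using k by auto
    then show "wp (Do (forward D h)) 2 (\<lambda>\<tau>'. \<exists>k'<k. \<tau>' = fwd (N - k') \<and> k' \<le> N) \<tau>"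
      using k fwd_step[of "N - k"] \<open>0 < k\<close> by (intro wp_Do) (auto intro!: exI[of _ "k - 1"])
  next
    fix k \<tau>
    assume "\<tau> = fwd (N - k) \<and> k \<le> N" "\<not> tops \<tau> 1 \<noteq> Blank"
    then have "N - k = N" "\<tau> = fwd (N - k)" using fwd_cond[of "N - k"] by auto
    then have "\<tau> = fwd N" by simp
    then show "wp (Loop (\<lambda>t. t 11 \<noteq> Blank) (Do (backward D out))) (3 * N + 1) Q \<tau>"
      using bwd_loop by simp
  qed auto
  have "wp (Seq (Loop (\<lambda>t. t 1 \<noteq> Blank) (Do (forward D h)))
      (Loop (\<lambda>t. t 11 \<noteq> Blank) (Do (backward D out)))) (6 * N + 3) Q (\<sigma>(20 := [Aux 0]))"
    unfolding start by (rule wp_Seq[OF 1]) simp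
  then have "wp (put 20 (Aux 0)) 2 (wp (Seq (Loop (\<lambda>t. t 1 \<noteq> Blank) (Do (forward D h)))
      (Loop (\<lambda>t. t 11 \<noteq> Blank) (Do (backward D out)))) (6 * N + 3) Q) \<sigma>"
    by (intro wp_put flag) auto
  then show ?thesis
    unfolding sweep_def by (rule wp_Seq) (use n in simp)
qed

section \<open>The program\<close>

definition skip :: "'b cmd" where
  "skip = Do (\<lambda>_ _. Keep)"

lemma wp_skip: "Q \<sigma> \<Longrightarrow> 2 \<le> n \<Longrightarrow> wp skip n Q \<sigma>"
  unfolding skip_def by (rule wp_Do) (auto elim!: back_subst[of Q] simp: update_def fun_eq_iff)

text \<open>Keeps the earliest verdict other than \<open>Aux 0\<close>. Folded over the columns, it
  finds the first coordinate where something happens, which is how pivots are recognized.\<close>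

definition first_nonzero ::
  "((nat \<Rightarrow> 'b tape_symbol) \<Rightarrow> 'b tape_symbol) \<Rightarrow> 'b tape_symbol \<Rightarrow> (nat \<Rightarrow> 'b tape_symbol) \<Rightarrow> 'b tape_symbol" where
  "first_nonzero d f c = (if f = Aux 0 then d c else f)"

lemma foldl_first_nonzero_0:
  "foldl (first_nonzero d) (Aux 0) (map g [0..<n]) = Aux 0 \<longleftrightarrow> (\<forall>j<n. d (g j) = Aux 0)"
  by (induction n) (auto simp: first_nonzero_def less_Suc_eq)

lemma foldl_first_nonzero:
  assumes "x \<noteq> Aux 0"
  shows "foldl (first_nonzero d) (Aux 0) (map g [0..<n]) = x \<longleftrightarrow>
    (\<exists>i<n. (\<forall>j<i. d (g j) = Aux 0) \<and> d (g i) = x)"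
proof (induction n)
  case (Suc n)
  define u where "u = foldl (first_nonzero d) (Aux 0) (map g [0..<n])"
  have "foldl (first_nonzero d) (Aux 0) (map g [0..<Suc n]) = (if u = Aux 0 then d (g n) else u)"
    by (simp add: u_def) (simp add: first_nonzero_def)
  moreover have "u = Aux 0 \<longleftrightarrow> (\<forall>j<n. d (g j) = Aux 0)"
    using foldl_first_nonzero_0[of d g n] by (simp add: u_def)
  moreover have "u = x \<longleftrightarrow> (\<exists>i<n. (\<forall>j<i. d (g j) = Aux 0) \<and> d (g i) = x)"
    using Suc by (simp add: u_def)
  ultimately show ?case
    using assms by (metis less_Suc_eq)
qed (use assms in auto)

definition word :: "'b list list \<Rightarrow> 'b tape_symbol list" where
  "word xs = map Letter (concat xs)"

lemma word_simps [simp]: "word [] = []" "word (x # xs) = map Letter x @ word xs"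
  by (simp_all add: word_def)

lemma nth_blank_append: "j < length x \<Longrightarrow> nth_blank (map Letter x @ u) j = Letter (x ! j)"
  by (simp add: nth_blank_def nth_append)

lemma nth_blank_map: "j < length x \<Longrightarrow> nth_blank (map Letter x) j = Letter (x ! j)"
  by (simp add: nth_blank_def)

text \<open>
  The stacks hold: 0 the input, 1 the target, 2 the input not yet processed, 3 the product of the
  relevant generators, 4 the tuples still to be sifted, 5 the tuple being sifted, 6 the table and
  7 the part of the table already scanned. Register 20 is the outcome of the last sweep; register
  21 is \<open>Aux 1\<close> as long as the last pass over the table has changed the tuple being sifted.
\<close>

definition conf :: "'b list \<Rightarrow> 'b tape_symbol list \<Rightarrow> 'b tape_symbol list \<Rightarrow> 'b list list \<Rightarrow> 'b list list \<Rightarrow>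
    'b list list \<Rightarrow> 'b list list \<Rightarrow> 'b tape_symbol list \<Rightarrow> 'b tape_symbol list \<Rightarrow> 'b store" where
  "conf \<beta> R M Q X L P F A = (\<lambda>_. [])(1 := map Letter \<beta>, 2 := R, 3 := M, 4 := word Q, 5 := word X,
     6 := word L, 7 := word P, 20 := F, 21 := A)"

lemma conf_simps [simp]:
  "conf \<beta> R M Q X L P F A (Suc 0) = map Letter \<beta>" "conf \<beta> R M Q X L P F A 2 = R"
  "conf \<beta> R M Q X L P F A 3 = M" "conf \<beta> R M Q X L P F A 4 = word Q"
  "conf \<beta> R M Q X L P F A 5 = word X" "conf \<beta> R M Q X L P F A 6 = word L"
  "conf \<beta> R M Q X L P F A 7 = word P" "conf \<beta> R M Q X L P F A 20 = F"
  "conf \<beta> R M Q X L P F A 21 = A"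
  by (simp_all add: conf_def)

lemma conf_other: "r \<notin> {1, 2, 3, 4, 5, 6, 7, 20, 21} \<Longrightarrow> conf \<beta> R M Q X L P F A r = []"
  by (simp add: conf_def)

lemma conf_put_21: "(conf \<beta> R M Q X L P F A)(21 := [x]) = conf \<beta> R M Q X L P F [x]"
  by (auto simp: conf_def fun_eq_iff)

text \<open>Reduces a sweep to one equation for each of the seven data stacks, which simplification
  settles for concrete \<open>D\<close>, \<open>h\<close> and \<open>out\<close>.\<close>

lemma wp_sweep_conf:
  assumes post: "Post (conf \<beta> R' M' Q' X' L' P' [f] A)"
    and "D \<subseteq> {1..7}" "1 \<in> D" "length \<beta> = N" "length F \<le> 1" "6 * N + 6 \<le> n"
    and dom: "\<And>f r. r \<notin> {1..7} \<Longrightarrow> out f r = None"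
    and flag: "foldl h (Aux 0) (map (column D (conf \<beta> R M Q X L P F A)) [0..<N]) = f"
    and result: "\<forall>r\<in>{1, 2, 3, 4, 5, 6, 7}.
      sweep_stack D out N f (conf \<beta> R M Q X L P F A) r = conf \<beta> R' M' Q' X' L' P' [f] A r"
  shows "wp (sweep D h out) n Post (conf \<beta> R M Q X L P F A)"
proof (rule wp_sweep[where N = N])
  have fl: "sweep_flag D h N (conf \<beta> R M Q X L P F A) = f"
    by (simp add: sweep_flag_def flag)
  have "sweep_result D h out N (conf \<beta> R M Q X L P F A) = conf \<beta> R' M' Q' X' L' P' [f] A"
  proof
    fix r :: nat
    consider "r = 20" | "r \<in> {1..7}" | "r \<noteq> 20" "r \<notin> {1..7}" by blast
    then show "sweep_result D h out N (conf \<beta> R M Q X L P F A) r = conf \<beta> R' M' Q' X' L' P' [f] A r"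
    proof cases
      case 1
      then show ?thesis by (simp add: sweep_result_def fl)
    next
      case 2
      then have "r \<in> {1, 2, 3, 4, 5, 6, 7}" by auto
      from bspec[OF result this] show ?thesis using 2 by (simp add: sweep_result_def fl)
    next
      case 3
      have "conf \<beta> R M Q X L P F A r = conf \<beta> R' M' Q' X' L' P' [f] A r"
        using 3 by (cases "r = 21") (auto simp: conf_other)
      moreover have "r \<notin> D" "out f r = None" using 3(2) dom assms(2) by blast+
      ultimately show ?thesis using 3(1) by (simp add: sweep_result_def sweep_stack_def fl)
    qed
  qed
  then show "Post (sweep_result D h out N (conf \<beta> R M Q X L P F A))" using post by simp
qed (use assms in \<open>auto simp: conf_other\<close>)

locale solver = clifford T mul unit_of inverse_of
  for T :: "'b set" and mul unit_of inverse_of +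
  fixes delim :: 'b
  assumes finite_T: "finite T" and delim: "delim \<in> T"
begin

text \<open>The default \<open>delim\<close> makes the function total with values in
  \<open>T\<close> on the alphabet, so that the symbols written stay in the alphabet even for
  columns that never occur.\<close>

definition letter :: "'b tape_symbol \<Rightarrow> 'b" where
  "letter s = (case s of Letter x \<Rightarrow> x | _ \<Rightarrow> delim)"

lemma letter_Letter [simp]: "letter (Letter x) = x"
  by (simp add: letter_def)

definition copy_flag :: "'b tape_symbol \<Rightarrow> (nat \<Rightarrow> 'b tape_symbol) \<Rightarrow> 'b tape_symbol" where
  "copy_flag f c = f"

text \<open>\<open>Aux 0\<close> means equal and trivial, so nothing is decided;
  \<open>Aux 1\<close> equal and nontrivial, so both tuples have their pivot here and match;
  \<open>Aux 2\<close> different, so they do not match. With \<open>first_nonzero\<close> the first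
  decisive column gives the answer.\<close>

definition compare :: "(nat \<Rightarrow> 'b tape_symbol) \<Rightarrow> 'b tape_symbol" where
  "compare c = (if letter (c 6) \<noteq> letter (c 5) then Aux 2
     else if unit_of (letter (c 5)) = letter (c 5) then Aux 0 else Aux 1)"

definition check_unit :: "(nat \<Rightarrow> 'b tape_symbol) \<Rightarrow> 'b tape_symbol" where
  "check_unit c = (if unit_of (letter (c 5)) = letter (c 5) then Aux 0 else Aux 1)"

definition pop_cmd :: "'b cmd" where
  "pop_cmd = sweep {1, 4, 5} copy_flag (\<lambda>_. [1 \<mapsto> \<lambda>c. c 1, 5 \<mapsto> \<lambda>c. c 4])"

definition scan_cmd :: "'b cmd" where
  "scan_cmd = sweep {1, 5, 6} (first_nonzero compare) (\<lambda>f. [1 \<mapsto> \<lambda>c. c 1, 7 \<mapsto> \<lambda>c. c 6,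
     5 \<mapsto> \<lambda>c. if f = Aux 1 then Letter (mul (inverse_of (letter (c 6))) (letter (c 5))) else c 5])"

definition restore_cmd :: "'b cmd" where
  "restore_cmd = sweep {1, 7} copy_flag (\<lambda>_. [1 \<mapsto> \<lambda>c. c 1, 6 \<mapsto> \<lambda>c. c 7])"

definition check_unit_cmd :: "'b cmd" where
  "check_unit_cmd = sweep {1, 5} (first_nonzero check_unit) (\<lambda>_. [1 \<mapsto> \<lambda>c. c 1, 5 \<mapsto> \<lambda>c. c 5])"

definition insert_cmd :: "'b cmd" where
  "insert_cmd = sweep {1, 5} copy_flag (\<lambda>_. [1 \<mapsto> \<lambda>c. c 1, 5 \<mapsto> \<lambda>c. c 5, 6 \<mapsto> \<lambda>c. c 5])"

definition left_product_cmd :: "'b cmd" where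
  "left_product_cmd = sweep {1, 5, 6} copy_flag (\<lambda>_. [1 \<mapsto> \<lambda>c. c 1, 5 \<mapsto> \<lambda>c. c 5, 7 \<mapsto> \<lambda>c. c 6,
     4 \<mapsto> \<lambda>c. Letter (mul (letter (c 5)) (letter (c 6)))])"

definition right_product_cmd :: "'b cmd" where
  "right_product_cmd = sweep {1, 5, 7} copy_flag (\<lambda>_. [1 \<mapsto> \<lambda>c. c 1, 5 \<mapsto> \<lambda>c. c 5, 6 \<mapsto> \<lambda>c. c 7,
     4 \<mapsto> \<lambda>c. Letter (mul (letter (c 7)) (letter (c 5)))])"

definition recall_cmd :: "'b cmd" where
  "recall_cmd = sweep {1, 5} copy_flag (\<lambda>_. [1 \<mapsto> \<lambda>c. c 1, 5 \<mapsto> \<lambda>c. c 1])"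

definition scan_step :: "'b cmd" where
  "scan_step = Seq scan_cmd (Cond (\<lambda>t. t 20 = Aux 1) (put 21 (Aux 1)) skip)"

definition scan_loop :: "'b cmd" where
  "scan_loop = Loop (\<lambda>t. t 6 \<noteq> Blank) scan_step"

definition restore_loop :: "'b cmd" where
  "restore_loop = Loop (\<lambda>t. t 7 \<noteq> Blank) restore_cmd"

text \<open>A pass that has changed the tuple is followed by another, since the new remainder may
  match an entry already left behind. A pass without change ends the loop.\<close>

definition reduce_cmd :: "'b cmd" where
  "reduce_cmd = Seq (put 21 (Aux 1)) (Loop (\<lambda>t. t 21 = Aux 1)
     (Seq (put 21 (Aux 0)) (Seq scan_loop restore_loop)))"

definition left_product_loop :: "'b cmd" where
  "left_product_loop = Loop (\<lambda>t. t 6 \<noteq> Blank) left_product_cmd"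

definition right_product_loop :: "'b cmd" where
  "right_product_loop = Loop (\<lambda>t. t 7 \<noteq> Blank) right_product_cmd"

definition extend_cmd :: "'b cmd" where
  "extend_cmd = Seq insert_cmd (Seq left_product_loop right_product_loop)"

definition extend_unless_unit :: "'b cmd" where
  "extend_unless_unit = Cond (\<lambda>t. t 20 = Aux 0) skip extend_cmd"

definition close_cmd :: "'b cmd" where
  "close_cmd = Loop (\<lambda>t. t 4 \<noteq> Blank) (Seq pop_cmd (Seq reduce_cmd (Seq check_unit_cmd extend_unless_unit)))"

definition test_cmd :: "'b cmd" where
  "test_cmd = Seq recall_cmd (Seq reduce_cmd check_unit_cmd)"

section \<open>Time bounds\<close>

definition table_bound :: "nat \<Rightarrow> nat" where
  "table_bound l = l * card T"

definition pass_time :: "nat \<Rightarrow> nat" where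
  "pass_time l = 2 * table_bound l * (6 * l + 11) + 6"

text \<open>The factor \<open>l + 2\<close> comes from \<open>height_le\<close>: the height is at
  most \<open>N + 1\<close>, and one last pass has to find that nothing matches.\<close>

definition reduce_time :: "nat \<Rightarrow> nat" where
  "reduce_time l = (l + 2) * Suc (pass_time l) + 4"

definition extend_time :: "nat \<Rightarrow> nat" where
  "extend_time l = 6 * l + 10 + 2 * Suc (table_bound l) * (6 * l + 7)"

definition close_body_time :: "nat \<Rightarrow> nat" where
  "close_body_time l = 12 * l + 20 + reduce_time l + extend_time l"

text \<open>The first factor bounds the variant \<open>V\<close> of \<open>wp_close\<close>: an
  insertion takes one of \<open>table_bound l\<close> slots and queues at most
  \<open>2 * table_bound l\<close> products, and \<open>l\<close> accounts for the initial
  queue.\<close>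

definition close_time :: "nat \<Rightarrow> nat" where
  "close_time l = Suc ((table_bound l * (2 * table_bound l + 1) + l) * Suc (close_body_time l))"

definition test_time :: "nat \<Rightarrow> nat" where
  "test_time l = 12 * l + 14 + reduce_time l"

end

section \<open>Correctness of the commands on tuples\<close>

locale solver_instance = solver T mul unit_of inverse_of delim
  for T :: "'b set" and mul unit_of inverse_of delim +
  fixes \<beta> :: "'b list" and N l :: nat
  assumes \<beta>: "\<beta> \<in> power_carrier T N" and N_pos: "0 < N" and N_le: "N \<le> l"
begin

sublocale P: clifford "power_carrier T N" "map2 mul" "map unit_of" "map inverse_of"
  by (rule clifford_power) unfold_locales

abbreviation \<G> where "\<G> \<equiv> P.component \<beta>"
abbreviation \<C> where "\<C> \<equiv> carrier \<G>"
abbreviation times (infixl "\<cdot>" 70) where "x \<cdot> y \<equiv> x \<otimes>\<^bsub>\<G>\<^esub> y"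
abbreviation one ("\<^bold>1") where "\<^bold>1 \<equiv> \<one>\<^bsub>\<G>\<^esub>"

lemma carrierD:
  assumes "x \<in> \<C>"
  shows "x \<in> power_carrier T N" "length x = N" "j < N \<Longrightarrow> x ! j \<in> T"
    "j < N \<Longrightarrow> unit_of (x ! j) = unit_of (\<beta> ! j)"
proof -
  show x: "x \<in> power_carrier T N" using assms by (simp add: P.component_def)
  then show len: "length x = N" by (rule power_carrier_length)
  show "x ! j \<in> T" if "j < N" using power_carrier_nth[OF x that] .
  have "map unit_of x = map unit_of \<beta>" using assms by (simp add: P.component_def)
  then show "unit_of (x ! j) = unit_of (\<beta> ! j)" if "j < N"
    using that len power_carrier_length[OF \<beta>] by (metis nth_map)
qed

lemma component_simps: "x \<cdot> y = map2 mul x y" "\<^bold>1 = map unit_of \<beta>"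
  by (simp_all add: P.component_def)

sublocale G: coordinate_group \<G> N "(!)"
proof -
  interpret group \<G> using P.component_group[OF \<beta>] .
  show "coordinate_group \<G> N (!)"
    by unfold_locales
      (auto simp: component_simps carrierD(2) intro: nth_equalityI)
qed

text \<open>The identity of the component is the tuple of units, and each group contains a single
  idempotent; hence triviality of a coordinate is tested without looking at the target.\<close>

lemma nth_one_iff:
  assumes "x \<in> \<C>" "j < N"
  shows "x ! j = \<^bold>1 ! j \<longleftrightarrow> unit_of (x ! j) = x ! j"
  using carrierD(3,4)[OF assms(1,2)] assms(2) power_carrier_length[OF \<beta>]
    unit_unit[of "\<beta> ! j"] power_carrier_nth[OF \<beta> assms(2)]
  by (auto simp: component_simps)

lemma one_iff:
  assumes "x \<in> \<C>"
  shows "x = \<^bold>1 \<longleftrightarrow> (\<forall>j<N. unit_of (x ! j) = x ! j)"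
  using nth_one_iff[OF assms] G.coord_eq[OF assms G.one_closed] by blast

lemma matches_iff:
  assumes "x \<in> \<C>"
  shows "G.matches y x \<longleftrightarrow> (\<exists>i<N. (\<forall>j<i. y ! j = x ! j \<and> unit_of (x ! j) = x ! j) \<and>
    y ! i = x ! i \<and> unit_of (x ! i) \<noteq> x ! i)"
proof -
  have "G.pivot i x \<and> G.agree (Suc i) y x \<longleftrightarrow> i < N \<and> (\<forall>j<i. y ! j = x ! j \<and> unit_of (x ! j) = x ! j) \<and>
    y ! i = x ! i \<and> unit_of (x ! i) \<noteq> x ! i" for i
    using nth_one_iff[OF assms]
    by (auto simp: G.pivot_def G.agree_Suc) (auto simp: G.agree_def)
  then show ?thesis unfolding G.matches_def by blast
qed

lemma inv_eq: "x \<in> \<C> \<Longrightarrow> inv\<^bsub>\<G>\<^esub> x = map inverse_of x"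
  by (rule P.component_inv[OF \<beta>])

abbreviation state where "state \<equiv> conf \<beta> [] []"

lemma length_\<beta>: "length \<beta> = N"
  using power_carrier_length[OF \<beta>] .

text \<open>An empty tuple would be invisible on a stack. In the application blocks include the
  delimiter, which makes \<open>N\<close> positive also if the exponent of the power is 0.\<close>

lemma word_top:
  assumes "set L \<subseteq> \<C>"
  shows "nth_blank (word L) 0 = Blank \<longleftrightarrow> L = []"
proof (cases L)
  case (Cons x L')
  then have "x \<noteq> []" using carrierD(2)[of x] assms N_pos by auto
  then show ?thesis using nth_blank_append[of 0 x "word L'"] Cons by simp
qed simp

lemma tops_state [simp]:
  "tops (state Q X L P F A) 4 = nth_blank (word Q) 0"
  "tops (state Q X L P F A) 6 = nth_blank (word L) 0"
  "tops (state Q X L P F A) 7 = nth_blank (word P) 0"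
  "tops (state Q X L P [f] A) 20 = f"
  "tops (state Q X L P F [a]) 21 = a"
  by (simp_all add: tops_def)

lemma column_simps:
  "r \<in> D \<Longrightarrow> column D \<sigma> j r = nth_blank (\<sigma> r) j"
  by (simp add: column_def)

lemma map_nth_blank:
  "length x = n \<Longrightarrow> map (nth_blank (map Letter x @ u)) [0..<n] = map Letter x"
  "length x = n \<Longrightarrow> map (nth_blank (map Letter x)) [0..<n] = map Letter x"
  by (auto intro!: nth_equalityI simp: nth_blank_append nth_blank_map)

lemma foldl_copy_flag: "foldl copy_flag f cs = f"
  by (induction cs) (simp_all add: copy_flag_def)

lemmas sweep_simps = sweep_stack_def column_simps foldl_copy_flag map_nth_blank length_\<beta> nth_blank_append nth_blank_map

lemma wp_pop:
  assumes "x \<in> \<C>" "set X \<subseteq> \<C>" "length X \<le> 1" "length F \<le> 1" "6 * l + 6 \<le> n"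
    and post: "Post (state Q [x] L P [Aux 0] A)"
  shows "wp pop_cmd n Post (state (x # Q) X L P F A)"
proof -
  have "drop N (word X) = []" using assms(2,3) carrierD(2) by (cases X) auto
  then show ?thesis
    unfolding pop_cmd_def
    by (intro wp_sweep_conf[where N = N and Post = Post, OF post])
      (use assms carrierD(2) N_le in \<open>auto simp: sweep_simps\<close>)
qed

lemma wp_scan:
  assumes "x \<in> \<C>" "y \<in> \<C>" "length F \<le> 1" "6 * l + 6 \<le> n"
    and post: "\<And>f. f = Aux 1 \<longleftrightarrow> G.matches y x \<Longrightarrow>
      Post (state Q [if G.matches y x then inv\<^bsub>\<G>\<^esub> y \<cdot> x else x] L (y # P) [f] A)"
  shows "wp scan_cmd n Post (state Q [x] (y # L) P F A)"
proof -
  let ?c = "column {1, 5, 6} (state Q [x] (y # L) P F A)"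
  define f where "f = foldl (first_nonzero compare) (Aux 0) (map ?c [0..<N])"
  have len: "length x = N" "length y = N" using carrierD(2) assms(1,2) by auto
  have cmp: "compare (?c j) = (if y ! j \<noteq> x ! j then Aux 2 else if unit_of (x ! j) = x ! j then Aux 0 else Aux 1)"
    if "j < N" for j
    using that len by (simp add: compare_def sweep_simps)
  have f: "f = Aux 1 \<longleftrightarrow> G.matches y x"
  proof -
    have "compare (?c j) = Aux 0 \<longleftrightarrow> y ! j = x ! j \<and> unit_of (x ! j) = x ! j"
      "compare (?c j) = Aux 1 \<longleftrightarrow> y ! j = x ! j \<and> unit_of (x ! j) \<noteq> x ! j" if "j < N" for j
      using cmp[OF that] by auto
    then have "(\<exists>i<N. (\<forall>j<i. compare (?c j) = Aux 0) \<and> compare (?c i) = Aux 1) \<longleftrightarrow>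
      (\<exists>i<N. (\<forall>j<i. y ! j = x ! j \<and> unit_of (x ! j) = x ! j) \<and> y ! i = x ! i \<and> unit_of (x ! i) \<noteq> x ! i)"
      by (meson less_trans)
    then show ?thesis
      unfolding matches_iff[OF assms(1)] f_def by (subst foldl_first_nonzero) simp_all
  qed
  have "map (\<lambda>j. Letter (mul (inverse_of (letter (?c j 6))) (letter (?c j 5)))) [0..<N] =
      map Letter (inv\<^bsub>\<G>\<^esub> y \<cdot> x)"
    using len by (intro nth_equalityI) (simp_all add: sweep_simps component_simps inv_eq[OF assms(2)])
  then show ?thesis
    unfolding scan_cmd_def using len
    by (cases "G.matches y x"; intro wp_sweep_conf[where N = N and Post = Post, OF post[OF f]])
      (use assms f[unfolded One_nat_def] f_def[symmetric] N_le in \<open>auto simp: sweep_simps\<close>)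
qed

lemma wp_restore_step:
  assumes "y \<in> \<C>" "length F \<le> 1" "6 * l + 6 \<le> n"
    and post: "Post (state Q X (y # L) P [Aux 0] A)"
  shows "wp restore_cmd n Post (state Q X L (y # P) F A)"
  unfolding restore_cmd_def
  by (rule wp_sweep_conf[where N = N and Post = Post, OF post])
    (use assms carrierD(2) N_le in \<open>auto simp: sweep_simps\<close>)

lemma wp_check_unit:
  assumes "x \<in> \<C>" "length F \<le> 1" "6 * l + 6 \<le> n"
    and post: "\<And>f. f = Aux 0 \<longleftrightarrow> x = \<^bold>1 \<Longrightarrow> Post (state Q [x] L P [f] A)"
  shows "wp check_unit_cmd n Post (state Q [x] L P F A)"
proof -
  let ?c = "column {1, 5} (state Q [x] L P F A)"
  define f where "f = foldl (first_nonzero check_unit) (Aux 0) (map ?c [0..<N])"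
  have len: "length x = N" using carrierD(2) assms(1) by auto
  have "f = Aux 0 \<longleftrightarrow> (\<forall>j<N. check_unit (?c j) = Aux 0)"
    unfolding f_def by (rule foldl_first_nonzero_0)
  also have "\<dots> \<longleftrightarrow> x = \<^bold>1"
    using len by (auto simp: one_iff[OF assms(1)] check_unit_def sweep_simps)
  finally have f: "f = Aux 0 \<longleftrightarrow> x = \<^bold>1" .
  show ?thesis
    unfolding check_unit_cmd_def
    by (rule wp_sweep_conf[where N = N and Post = Post, OF post[OF f]])
      (use assms len N_le in \<open>auto simp: sweep_simps f_def\<close>)
qed

lemma wp_insert:
  assumes "x \<in> \<C>" "length F \<le> 1" "6 * l + 6 \<le> n"
    and post: "Post (state Q [x] (x # L) P [Aux 0] A)"
  shows "wp insert_cmd n Post (state Q [x] L P F A)"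
  unfolding insert_cmd_def
  by (rule wp_sweep_conf[where N = N and Post = Post, OF post])
    (use assms carrierD(2) N_le in \<open>auto simp: sweep_simps\<close>)

lemma wp_recall:
  assumes "set X \<subseteq> \<C>" "length X \<le> 1" "length F \<le> 1" "6 * l + 6 \<le> n"
    and post: "Post (state Q [\<beta>] L P [Aux 0] A)"
  shows "wp recall_cmd n Post (state Q X L P F A)"
proof -
  have "drop N (word X) = []" using assms(1,2) carrierD(2) by (cases X) auto
  then show ?thesis
    unfolding recall_cmd_def
    by (intro wp_sweep_conf[where N = N and Post = Post, OF post]) (use assms N_le in \<open>auto simp: sweep_simps\<close>)
qed

lemma wp_left_product:
  assumes "x \<in> \<C>" "y \<in> \<C>" "length F \<le> 1" "6 * l + 6 \<le> n"
    and post: "Post (state (x \<cdot> y # Q) [x] L (y # P) [Aux 0] A)"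
  shows "wp left_product_cmd n Post (state Q [x] (y # L) P F A)"
proof -
  let ?c = "column {1, 5, 6} (state Q [x] (y # L) P F A)"
  have len: "length x = N" "length y = N" using carrierD(2) assms(1,2) by auto
  have "map (\<lambda>j. Letter (mul (letter (?c j 5)) (letter (?c j 6)))) [0..<N] =
      map Letter (x \<cdot> y)"
    using len by (intro nth_equalityI) (simp_all add: sweep_simps component_simps)
  then show ?thesis
    unfolding left_product_cmd_def
    by (intro wp_sweep_conf[where N = N and Post = Post, OF post]) (use assms len N_le in \<open>auto simp: sweep_simps\<close>)
qed

lemma wp_right_product:
  assumes "x \<in> \<C>" "y \<in> \<C>" "length F \<le> 1" "6 * l + 6 \<le> n"
    and post: "Post (state (y \<cdot> x # Q) [x] (y # L) P [Aux 0] A)"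
  shows "wp right_product_cmd n Post (state Q [x] L (y # P) F A)"
proof -
  let ?c = "column {1, 5, 7} (state Q [x] L (y # P) F A)"
  have len: "length x = N" "length y = N" using carrierD(2) assms(1,2) by auto
  have "map (\<lambda>j. Letter (mul (letter (?c j 7)) (letter (?c j 5)))) [0..<N] =
      map Letter (y \<cdot> x)"
    using len by (intro nth_equalityI) (simp_all add: sweep_simps component_simps)
  then show ?thesis
    unfolding right_product_cmd_def
    by (intro wp_sweep_conf[where N = N and Post = Post, OF post]) (use assms len N_le in \<open>auto simp: sweep_simps\<close>)
qed

text \<open>Once the tuple has changed, nothing is claimed about the entries already passed, as they
  were compared with an earlier tuple; the drop in height pays for the next pass.\<close>

lemma wp_scan_loop:
  assumes L: "set L \<subseteq> \<C>" and x: "x \<in> \<C>" and F: "length F \<le> 1"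
    and n: "Suc (length L * (6 * l + 11)) \<le> n"
    and post: "\<And>x' f a. length f \<le> 1 \<Longrightarrow> G.reduces (set L) x x' \<Longrightarrow>
      a = Aux 0 \<and> x' = x \<and> (\<forall>y\<in>set L. \<not> G.matches y x) \<or> a = Aux 1 \<and> G.height x' < G.height x \<Longrightarrow>
      Post (state Q [x'] [] (rev L) f [a])"
  shows "wp scan_loop n Post (state Q [x] L [] F [Aux 0])"
proof -
  define I where "I L1 L2 \<tau> \<longleftrightarrow> (\<exists>x' f a. \<tau> = state Q [x'] L2 (rev L1) f [a] \<and> length f \<le> 1 \<and>
      G.reduces (set L) x x' \<and> (a = Aux 0 \<and> x' = x \<and> (\<forall>y\<in>set L1. \<not> G.matches y x) \<or>
      a = Aux 1 \<and> G.height x' < G.height x))" for L1 L2 \<tau>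
  show ?thesis
    unfolding scan_loop_def
  proof (rule wp_for_each[where I = I and xs = L and m = "6 * l + 10"])
    show "I [] L (state Q [x] L [] F [Aux 0])"
      unfolding I_def using F
      by (intro exI[of _ x] exI[of _ F] exI[of _ "Aux 0"]) (auto intro: G.reduces.refl)
  next
    fix \<tau>
    assume "I L [] \<tau>"
    then show "\<not> tops \<tau> 6 \<noteq> Blank \<and> Post \<tau>" using post by (auto simp: I_def)
  next
    fix L1 y L2 \<tau>
    assume L12: "L = L1 @ y # L2" and "I L1 (y # L2) \<tau>"
    then obtain x' f a where *: "\<tau> = state Q [x'] (y # L2) (rev L1) f [a]"
          "length f \<le> 1" "G.reduces (set L) x x'"
          "a = Aux 0 \<and> x' = x \<and> (\<forall>y\<in>set L1. \<not> G.matches y x) \<or> a = Aux 1 \<and> G.height x' < G.height x"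
      unfolding I_def by blast
    have y: "y \<in> \<C>" "y \<in> set L" using L L12 by auto
    have x': "x' \<in> \<C>" using G.reduces_carrier[OF *(3) L x] .
    let ?z = "if G.matches y x' then inv\<^bsub>\<G>\<^esub> y \<cdot> x' else x'"
    have inv: "I (L1 @ [y]) L2 (state Q [?z] L2 (y # rev L1) [f] [b])"
      if "b = (if G.matches y x' then Aux 1 else a)" for b f
    proof -
      have "b = Aux 0 \<and> ?z = x \<and> (\<forall>y\<in>set (L1 @ [y]). \<not> G.matches y x) \<or> b = Aux 1 \<and> G.height ?z < G.height x"
        using *(4) that G.height_quotient[of y x'] x' y(1) by (cases "G.matches y x'") auto
      moreover have "G.reduces (set L) x ?z"
        using *(3) G.reduces.step[OF *(3) y(2)] by simp
      ultimately show ?thesis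
        unfolding I_def by (intro exI[of _ ?z] exI[of _ "[f]"] exI[of _ b]) simp
    qed
    have "wp scan_step (6 * l + 10) (I (L1 @ [y]) L2) \<tau>"
      unfolding *(1) scan_step_def
    proof (rule wp_Seq[where m = "6 * l + 6" and n = 3], rule wp_scan[OF x' y(1) *(2)])
      fix g :: "'b tape_symbol"
      assume g: "g = Aux 1 \<longleftrightarrow> G.matches y x'"
      show "wp (Cond (\<lambda>t. t 20 = Aux 1) (put 21 (Aux 1)) skip) 3 (I (L1 @ [y]) L2) (state Q [?z] L2 (y # rev L1) [g] [a])"
        by (rule wp_Cond[where n = 2]; (rule wp_put wp_skip)?)
          (use g inv[of "if G.matches y x' then Aux 1 else a" g] in \<open>auto simp: conf_put_21\<close>)
    qed simp_all
    then show "tops \<tau> 6 \<noteq> Blank \<and> wp scan_step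
        (6 * l + 10) (I (L1 @ [y]) L2) \<tau>"
      using word_top[of "y # L2"] L L12 by (simp add: *(1) del: word_simps)
  qed (use n in \<open>simp add: add.commute\<close>)
qed

lemma wp_restore_loop:
  assumes "set P \<subseteq> \<C>" "length F \<le> 1" "Suc (length P * (6 * l + 7)) \<le> n"
    and post: "\<And>F'. length F' \<le> 1 \<Longrightarrow> Post (state Q X (rev P @ L) [] F' A)"
  shows "wp restore_loop n Post (state Q X L P F A)"
  unfolding restore_loop_def
proof (rule wp_for_each[where xs = P and m = "6 * l + 6" and
      I = "\<lambda>us vs \<tau>. \<exists>f. length f \<le> 1 \<and> \<tau> = state Q X (rev us @ L) vs f A"])
  fix us y vs \<tau>
  assume "P = us @ y # vs" "\<exists>f. length f \<le> 1 \<and> \<tau> = state Q X (rev us @ L) (y # vs) f A"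
  moreover from this have "set (y # vs) \<subseteq> \<C>" using assms by auto
  ultimately show "tops \<tau> 7 \<noteq> Blank \<and> wp restore_cmd (6 * l + 6)
      (\<lambda>\<tau>. \<exists>f. length f \<le> 1 \<and> \<tau> = state Q X (rev (us @ [y]) @ L) vs f A) \<tau>"
    using word_top[of "y # vs"] assms(1)
    by (auto simp del: word_simps intro!: wp_restore_step exI[of _ "[Aux 0]"])
qed (use assms post in \<open>auto simp: add.commute\<close>)

lemma wp_reduce:
  assumes L: "set L \<subseteq> \<C>" "length L \<le> table_bound l" and x: "x \<in> \<C>"
    and F: "length F \<le> 1" "length A \<le> 1" and n: "reduce_time l \<le> n"
    and post: "\<And>x' f. length f \<le> 1 \<Longrightarrow> G.reduces (set L) x x' \<Longrightarrow> (\<And>y. y \<in> set L \<Longrightarrow> \<not> G.matches y x') \<Longrightarrow>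
      Post (state Q [x'] L [] f [Aux 0])"
  shows "wp reduce_cmd n Post (state Q [x] L [] F A)"
proof -
  \<comment> \<open>The variant is 0 only after a pass without change. While the flag is
    \<open>Aux 1\<close> it exceeds the height by one, for the pass that finds no match.\<close>
  define I where "I k \<tau> \<longleftrightarrow> (\<exists>x' f a. \<tau> = state Q [x'] L [] f [a] \<and> length f \<le> 1 \<and> G.reduces (set L) x x' \<and>
      (a = Aux 0 \<and> k = 0 \<and> (\<forall>y\<in>set L. \<not> G.matches y x') \<or> a = Aux 1 \<and> k = Suc (G.height x')))" for k \<tau>
  have "wp (Loop (\<lambda>t. t 21 = Aux 1)
     (Seq (put 21 (Aux 0)) (Seq scan_loop restore_loop)))
     (Suc ((l + 2) * Suc (pass_time l))) Post (state Q [x] L [] F [Aux 1])"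
  proof (rule wp_Loop[where I = I and v = "Suc (G.height x)" and m = "pass_time l"])
    show "I (Suc (G.height x)) (state Q [x] L [] F [Aux 1])"
      unfolding I_def using F by (intro exI[of _ x] exI[of _ F] exI[of _ "Aux 1"]) (simp add: G.reduces.refl)
  next
    fix k \<tau>
    assume "I k \<tau>" "\<not> tops \<tau> 21 = Aux 1"
    then show "Post \<tau>" using post by (auto simp: I_def)
  next
    fix k \<tau>
    assume "I k \<tau>" "tops \<tau> 21 = Aux 1"
    then obtain x1 f where *: "\<tau> = state Q [x1] L [] f [Aux 1]" "length f \<le> 1" "G.reduces (set L) x x1"
      "k = Suc (G.height x1)"
      by (auto simp: I_def)
    have x1: "x1 \<in> \<C>" using G.reduces_carrier[OF *(3) L(1) x] .
    have times: "Suc (length L * (6 * l + 11)) \<le> Suc (table_bound l * (6 * l + 11))"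
      using L(2) mult_le_mono1 by blast
    have "wp (Seq scan_loop restore_loop)
      (2 * table_bound l * (6 * l + 11) + 3) (\<lambda>\<tau>'. \<exists>k'<k. I k' \<tau>') (state Q [x1] L [] f [Aux 0])"
    proof (rule wp_Seq, rule wp_scan_loop[OF L(1) x1 *(2) times])
      fix x' and a :: "'b tape_symbol" and g :: "'b tape_symbol list"
      assume g: "length g \<le> (1::nat)" "G.reduces (set L) x1 x'"
        "a = Aux 0 \<and> x' = x1 \<and> (\<forall>y\<in>set L. \<not> G.matches y x1) \<or> a = Aux 1 \<and> G.height x' < G.height x1"
      have "length (rev L) * (6 * l + 7) \<le> table_bound l * (6 * l + 11)"
        using L(2) by (intro mult_le_mono) auto
      moreover have "\<exists>k'<k. I k' (state Q [x'] L [] h [a])" if "length h \<le> 1" for h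
      proof -
        have "I (if a = Aux 0 then 0 else Suc (G.height x')) (state Q [x'] L [] h [a])"
          unfolding I_def using g that G.reduces_trans[OF g(2) *(3)]
          by (intro exI[of _ x'] exI[of _ h] exI[of _ a]) auto
        moreover have "(if a = Aux 0 then 0 else Suc (G.height x')) < k" using g(3) *(4) by auto
        ultimately show ?thesis by blast
      qed
      ultimately show "wp restore_loop (Suc (table_bound l * (6 * l + 11)))
          (\<lambda>\<tau>'. \<exists>k'<k. I k' \<tau>') (state Q [x'] [] (rev L) g [a])"
        using L(1) g(1) by (intro wp_restore_loop) auto
    qed simp
    then show "wp (Seq (put 21 (Aux 0)) (Seq scan_loop restore_loop))
       (pass_time l) (\<lambda>\<tau>'. \<exists>k'<k. I k' \<tau>') \<tau>"
      unfolding *(1)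
      by - (rule wp_Seq[where m = 2 and n = "2 * table_bound l * (6 * l + 11) + 3"], rule wp_put,
          simp_all add: conf_put_21 pass_time_def)
  next
    have "Suc (G.height x) \<le> l + 2" using G.height_le[of x] N_le by simp
    then show "Suc (Suc (G.height x) * Suc (pass_time l)) \<le> Suc ((l + 2) * Suc (pass_time l))"
      by (meson Suc_le_mono mult_le_mono1)
  qed
  then show ?thesis
    unfolding reduce_cmd_def using n F
    by - (rule wp_Seq[where m = 2 and n = "Suc ((l + 2) * Suc (pass_time l))"], rule wp_put,
        simp_all add: conf_put_21 reduce_time_def del: mult_Suc mult_Suc_right)
qed

lemma wp_left_product_loop:
  assumes "x \<in> \<C>" "set L \<subseteq> \<C>" "length F \<le> 1" "Suc (length L * (6 * l + 7)) \<le> n"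
    and post: "\<And>F'. length F' \<le> 1 \<Longrightarrow> Post (state (rev (map ((\<cdot>) x) L) @ Q) [x] [] (rev L @ P) F' A)"
  shows "wp left_product_loop n Post (state Q [x] L P F A)"
  unfolding left_product_loop_def
proof (rule wp_for_each[where xs = L and m = "6 * l + 6" and
      I = "\<lambda>us vs \<tau>. \<exists>f. length f \<le> 1 \<and> \<tau> = state (rev (map ((\<cdot>) x) us) @ Q) [x] vs (rev us @ P) f A"])
  fix us y vs \<tau>
  assume "L = us @ y # vs" "\<exists>f. length f \<le> 1 \<and> \<tau> = state (rev (map ((\<cdot>) x) us) @ Q) [x] (y # vs) (rev us @ P) f A"
  moreover from this have "set (y # vs) \<subseteq> \<C>" using assms by auto
  ultimately show "tops \<tau> 6 \<noteq> Blank \<and> wp left_product_cmd (6 * l + 6)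
      (\<lambda>\<tau>. \<exists>f. length f \<le> 1 \<and> \<tau> = state (rev (map ((\<cdot>) x) (us @ [y])) @ Q) [x] vs (rev (us @ [y]) @ P) f A) \<tau>"
    using word_top[of "y # vs"] assms(1)
    by (auto simp del: word_simps intro!: wp_left_product exI[of _ "[Aux 0]"])
qed (use assms post in \<open>auto simp: add.commute\<close>)

lemma wp_right_product_loop:
  assumes "x \<in> \<C>" "set P \<subseteq> \<C>" "length F \<le> 1" "Suc (length P * (6 * l + 7)) \<le> n"
    and post: "\<And>F'. length F' \<le> 1 \<Longrightarrow>
      Post (state (rev (map (\<lambda>y. y \<cdot> x) P) @ Q) [x] (rev P @ L) [] F' A)"
  shows "wp right_product_loop n Post (state Q [x] L P F A)"
  unfolding right_product_loop_def
proof (rule wp_for_each[where xs = P and m = "6 * l + 6" and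
      I = "\<lambda>us vs \<tau>. \<exists>f. length f \<le> 1 \<and> \<tau> = state (rev (map (\<lambda>y. y \<cdot> x) us) @ Q) [x] (rev us @ L) vs f A"])
  fix us y vs \<tau>
  assume "P = us @ y # vs" "\<exists>f. length f \<le> 1 \<and> \<tau> = state (rev (map (\<lambda>y. y \<cdot> x) us) @ Q) [x] (rev us @ L) (y # vs) f A"
  moreover from this have "set (y # vs) \<subseteq> \<C>" using assms by auto
  ultimately show "tops \<tau> 7 \<noteq> Blank \<and> wp right_product_cmd (6 * l + 6)
      (\<lambda>\<tau>. \<exists>f. length f \<le> 1 \<and> \<tau> = state (rev (map (\<lambda>y. y \<cdot> x) (us @ [y])) @ Q) [x] (rev (us @ [y]) @ L) vs f A) \<tau>"
    using word_top[of "y # vs"] assms(1)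
    by (auto simp del: word_simps intro!: wp_right_product exI[of _ "[Aux 0]"])
qed (use assms post in \<open>auto simp: add.commute\<close>)

text \<open>The new element enters the table first, so its square is among the products. Walking
  along the table for \<open>x \<cdot> y\<close> moves it to stack 7, and walking back for
  \<open>y \<cdot> x\<close> restores it.\<close>

lemma wp_extend:
  assumes "x \<in> \<C>" "set L \<subseteq> \<C>" "length L \<le> table_bound l" "length F \<le> 1" "extend_time l \<le> n"
    and post: "\<And>F'. length F' \<le> 1 \<Longrightarrow>
      Post (state (map (\<lambda>y. y \<cdot> x) (x # L) @ rev (map ((\<cdot>) x) (x # L)) @ Q) [x] (x # L) [] F' A)"
  shows "wp extend_cmd n Post (state Q [x] L [] F A)"
proof -
  have L': "set (x # L) \<subseteq> \<C>" using assms(1,2) by simp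
  have t: "Suc (length (x # L) * (6 * l + 7)) \<le> Suc (Suc (table_bound l) * (6 * l + 7))"
    using assms(3) by (intro Suc_leI le_imp_less_Suc mult_le_mono1) simp
  have "wp right_product_loop (Suc (Suc (table_bound l) * (6 * l + 7))) Post
      (state (rev (map ((\<cdot>) x) (x # L)) @ Q) [x] [] (rev (x # L) @ []) F' A)" if "length F' \<le> 1" for F'
    using L' t post that assms(1)
    by (intro wp_right_product_loop) (simp_all add: rev_map[symmetric] del: map_eq_Cons_conv)
  then have "wp left_product_loop (Suc (Suc (table_bound l) * (6 * l + 7)))
     (wp right_product_loop (Suc (Suc (table_bound l) * (6 * l + 7))) Post)
     (state Q [x] (x # L) [] [Aux 0] A)"
    using wp_left_product_loop[OF assms(1) L' _ t] by simp
  then show ?thesis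
    unfolding extend_cmd_def using assms(1,4,5)
    by (intro wp_Seq[where m = "6 * l + 6"] wp_insert wp_Seq[where m = "Suc (Suc (table_bound l) * (6 * l + 7))"])
      (auto simp: extend_time_def)
qed

section \<open>Closing the table under products\<close>

definition table :: "'b list list \<Rightarrow> bool" where
  "table L \<longleftrightarrow> distinct L \<and> set L \<subseteq> \<C> \<and> \<^bold>1 \<notin> set L \<and>
     (\<forall>y\<in>set L. \<forall>z\<in>set L. G.matches y z \<longrightarrow> y = z)"

lemma table_sifting: "table L \<Longrightarrow> sifting_table \<G> N (!) (set L)"
  by unfold_locales (auto simp: table_def)

lemma table_length:
  assumes "table L"
  shows "length L \<le> table_bound l"
proof -
  interpret sifting_table \<G> N "(!)" "set L" using table_sifting[OF assms] .
  have "card (set L) \<le> N * card T"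
    using carrierD(3) assms by (intro card_table_le finite_T) (auto simp: table_def)
  also have "\<dots> \<le> table_bound l" using N_le by (simp add: table_bound_def)
  finally show ?thesis using assms by (simp add: table_def distinct_card)
qed

lemma table_Cons:
  assumes "table L" "x \<in> \<C>" "x \<noteq> \<^bold>1" "\<And>y. y \<in> set L \<Longrightarrow> \<not> G.matches y x"
  shows "table (x # L)"
  using assms G.matches_self[of x] G.matches_sym unfolding table_def by fastforce

abbreviation generated_by :: "'b list set \<Rightarrow> 'b list set" where
  "generated_by \<equiv> generated (map2 mul)"

lemma generated_carrier:
  assumes "A \<subseteq> \<C>"
  shows "generated_by A \<subseteq> \<C>"
proof
  fix x
  assume "x \<in> generated_by A"
  then show "x \<in> \<C>"
  proof induction
    case (mult x y)
    then show ?case using G.m_closed[of x y] by (simp only: component_simps)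
  qed (use assms in auto)
qed

lemma generated_inverse:
  assumes "A \<subseteq> \<C>" "x \<in> generated_by A"
  shows "inv\<^bsub>\<G>\<^esub> x \<in> generated_by A" "\<^bold>1 \<in> generated_by A"
proof -
  have A: "A \<subseteq> power_carrier T N" using assms(1) carrierD(1) by blast
  have x: "x \<in> \<C>" using assms generated_carrier by blast
  have "\<^bold>1 = map unit_of x"
    using x by (simp add: P.component_def)
  then show "inv\<^bsub>\<G>\<^esub> x \<in> generated_by A" "\<^bold>1 \<in> generated_by A"
    using P.generated_unit_inverse[OF finite_power_carrier[OF finite_T] A assms(2)] inv_eq[OF x]
    by simp_all
qed

lemma reduces_generated:
  assumes "G.reduces L x x'" "A \<subseteq> \<C>" "L \<subseteq> generated_by A" "x \<in> generated_by A"
  shows "x' \<in> generated_by A"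
  using assms
proof (induction rule: G.reduces.induct)
  case (step x x' y)
  then have "inv\<^bsub>\<G>\<^esub> y \<in> generated_by A" using generated_inverse(1) by blast
  then show ?case
    using generated.mult[of "inv\<^bsub>\<G>\<^esub> y" "map2 mul" A x'] step by (simp add: component_simps)
qed simp

text \<open>Generators and pairwise products sift up to pending tuples. Once the queue is empty,
  this is what \<open>generated_subset_U\<close> asks for.\<close>

definition close_inv :: "'b list set \<Rightarrow> 'b list list \<Rightarrow> 'b list list \<Rightarrow> bool" where
  "close_inv A L Q \<longleftrightarrow> table L \<and> set L \<subseteq> generated_by A \<and> set Q \<subseteq> generated_by A \<and>
     A \<subseteq> G.sifted (set L) (set Q) \<and>
     (\<forall>y\<in>set L. \<forall>z\<in>set L. y \<cdot> z \<in> G.sifted (set L) (set Q))"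

lemma close_inv_carrier: "close_inv A L Q \<Longrightarrow> A \<subseteq> \<C> \<Longrightarrow> set Q \<subseteq> \<C>"
  using generated_carrier[of A] unfolding close_inv_def by blast

text \<open>The condition \<open>A \<noteq> {}\<close> matters: the identity always sifts, but the
  empty set generates nothing.\<close>

lemma close_inv_final:
  assumes "close_inv A L []" "A \<subseteq> \<C>" "A \<noteq> {}"
  shows "G.sifted (set L) {} = generated_by A"
proof
  interpret sifting_table \<G> N "(!)" "set L"
    using table_sifting assms(1) by (simp add: close_inv_def)
  have "(\<cdot>) = map2 mul" by (simp add: P.component_def)
  moreover have "generated (\<cdot>) A \<subseteq> G.sifted (set L) {}"
    using assms(1) by (intro generated_subset_U) (auto simp: close_inv_def)
  ultimately show "generated_by A \<subseteq> G.sifted (set L) {}" by simp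
  show "G.sifted (set L) {} \<subseteq> generated_by A"
  proof
    fix x
    assume "x \<in> G.sifted (set L) {}"
    then show "x \<in> generated_by A"
    proof induction
      case one
      obtain a where "a \<in> A" using assms(3) by blast
      then show ?case using generated_inverse(2)[OF assms(2) generated.gen] by blast
    next
      case (step y x)
      have y: "y \<in> \<C>" "y \<in> generated_by A"
        using step(1) assms(1) L_carrier by (auto simp: close_inv_def)
      have "x = y \<cdot> (inv\<^bsub>\<G>\<^esub> y \<cdot> x)"
        using y(1) step(2) by (simp add: G.m_assoc[symmetric])
      then show ?case using generated.mult[OF y(2) step.IH] by (metis component_simps(1))
    qed simp
  qed
qed

text \<open>The discarded tuple sifts to the identity through the table alone, so whatever relied on
  it as pending still sifts.\<close>

lemma close_inv_discard:
  assumes "close_inv A L (q # Q)" "A \<subseteq> \<C>" "G.reduces (set L) q \<^bold>1"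
  shows "close_inv A L Q"
proof -
  have c: "q \<in> \<C>" "set L \<subseteq> \<C>"
    using assms generated_carrier by (auto simp: close_inv_def table_def)
  have "q \<in> G.sifted (set L) (set Q)"
    using G.reduces_sifted[OF assms(3) c(2,1) G.sifted.one] .
  then have "G.sifted (set L) (set (q # Q)) \<subseteq> G.sifted (set L) (set Q)"
    using G.sifted_mono[of _ "set L" "set (q # Q)" "set L" "set Q"] by (auto intro: G.sifted.pending)
  then show ?thesis using assms(1) unfolding close_inv_def by auto
qed

lemma close_inv_extend:
  assumes inv: "close_inv A L (q # Q)" and A: "A \<subseteq> \<C>"
    and red: "G.reduces (set L) q x" "\<And>y. y \<in> set L \<Longrightarrow> \<not> G.matches y x" and x: "x \<noteq> \<^bold>1"
    and Q': "set Q' = set Q \<union> {x \<cdot> y | y. y \<in> set (x # L)} \<union> {y \<cdot> x | y. y \<in> set (x # L)}"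
  shows "close_inv A (x # L) Q'"
proof -
  have c: "q \<in> \<C>" "set L \<subseteq> \<C>"
    using inv A generated_carrier by (auto simp: close_inv_def table_def)
  have x_gen: "x \<in> generated_by A"
    using reduces_generated[OF red(1) A] inv by (simp add: close_inv_def)
  then have xc: "x \<in> \<C>" using A generated_carrier by blast
  have prod: "y \<cdot> z \<in> generated_by A" if "y \<in> generated_by A" "z \<in> generated_by A" for y z
    using generated.mult[OF that] by (simp add: component_simps)
  have gen: "set (x # L) \<subseteq> generated_by A" using inv x_gen by (simp add: close_inv_def)
  have "set Q' \<subseteq> generated_by A"
  proof -
    have "set Q \<subseteq> generated_by A" using inv by (simp add: close_inv_def)
    moreover have "{x \<cdot> y | y. y \<in> set (x # L)} \<subseteq> generated_by A"
      using prod[OF x_gen subsetD[OF gen]] by (intro subsetI) (elim CollectE exE conjE, simp only:)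
    moreover have "{y \<cdot> x | y. y \<in> set (x # L)} \<subseteq> generated_by A"
      using prod[OF subsetD[OF gen] x_gen] by (intro subsetI) (elim CollectE exE conjE, simp only:)
    ultimately show ?thesis unfolding Q' by (intro Un_least)
  qed
  moreover have "table (x # L)"
    using inv table_Cons[OF _ xc x red(2)] by (simp add: close_inv_def)
  moreover have sub: "G.sifted (set L) (set (q # Q)) \<subseteq> G.sifted (set (x # L)) (set Q')"
  proof -
    \<comment> \<open>As a table entry, \<open>x\<close> matches itself and leaves the identity.
      Hence \<open>x\<close> sifts, \<open>q\<close> sifts by way of \<open>x\<close>, and
      \<open>q\<close> may leave the queue.\<close>
    have "x \<in> G.sifted (set (x # L)) (set Q')"
    proof (rule G.sifted.step[OF _ xc G.matches_self[OF xc x]])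
      show "inv\<^bsub>\<G>\<^esub> x \<cdot> x \<in> G.sifted (set (x # L)) (set Q')"
        unfolding G.l_inv[OF xc] by (rule G.sifted.one)
    qed simp
    moreover have "G.reduces (set (x # L)) q x" by (rule G.reduces_mono[OF red(1)]) auto
    ultimately have "q \<in> G.sifted (set (x # L)) (set Q')"
      using c xc by (intro G.reduces_sifted[of "set (x # L)" q x]) auto
    then show ?thesis
      using G.sifted_mono[of _ "set L" "set (q # Q)" "set (x # L)" "set Q'"] Q'
      by (auto intro: G.sifted.pending)
  qed
  moreover have "y \<cdot> z \<in> G.sifted (set (x # L)) (set Q')" if "y \<in> set (x # L)" "z \<in> set (x # L)" for y z
  proof (cases "y = x \<or> z = x")
    case True
    then have "y \<cdot> z \<in> set Q'" using that unfolding Q' by blast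
    then show ?thesis by (rule G.sifted.pending)
  next
    case False
    then show ?thesis using that inv sub by (auto simp: close_inv_def)
  qed
  ultimately show ?thesis using inv gen unfolding close_inv_def by blast
qed

lemma wp_close:
  assumes Q: "set Q \<subseteq> \<C>" "Q \<noteq> []" "length Q \<le> l" and F: "length F \<le> 1" "length A \<le> 1"
    and n: "close_time l \<le> n"
    and post: "\<And>X L f a. set X \<subseteq> \<C> \<Longrightarrow> length X \<le> 1 \<Longrightarrow> length f \<le> 1 \<Longrightarrow> length a \<le> 1 \<Longrightarrow>
      table L \<Longrightarrow> G.sifted (set L) {} = generated_by (set Q) \<Longrightarrow> Post (state [] X L [] f a)"
  shows "wp close_cmd n Post (state Q [] [] [] F A)"
proof -
  \<comment> \<open>Each free slot counts \<open>2 * table_bound l + 1\<close>, more than the number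
    of products queued when it is filled, so an insertion lowers the value although the queue
    grows.\<close>
  define V where "V L Q' = (table_bound l - length L) * (2 * table_bound l + 1) + length Q'"
    for L Q' :: "'b list list"
  define I where "I k \<tau> \<longleftrightarrow> (\<exists>Q' X L f a. \<tau> = state Q' X L [] f a \<and> set X \<subseteq> \<C> \<and> length X \<le> 1 \<and>
    length f \<le> 1 \<and> length a \<le> 1 \<and> close_inv (set Q) L Q' \<and> k = V L Q')" for k \<tau>
  show ?thesis
    unfolding close_cmd_def
  proof (rule wp_Loop[where I = I and v = "V [] Q" and m = "close_body_time l"])
    have "close_inv (set Q) [] Q"
      by (auto simp: close_inv_def table_def intro: generated.gen G.sifted.pending)
    then show "I (V [] Q) (state Q [] [] [] F A)"
      unfolding I_def using F by (intro exI[of _ Q] exI[of _ "[]"] exI[of _ F] exI[of _ A]) simp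
  next
    have "V [] Q \<le> table_bound l * (2 * table_bound l + 1) + l"
      using Q(3) by (simp add: V_def)
    then have "Suc (V [] Q * Suc (close_body_time l)) \<le> close_time l"
      unfolding close_time_def by (meson Suc_le_mono mult_le_mono1)
    then show "Suc (V [] Q * Suc (close_body_time l)) \<le> n" using n by simp
  next
    fix k \<tau>
    assume "I k \<tau>" and stop: "\<not> tops \<tau> 4 \<noteq> Blank"
    then obtain Q' X L f a where *: "\<tau> = state Q' X L [] f a" "set X \<subseteq> \<C>" "length X \<le> 1"
      "length f \<le> 1" "length a \<le> 1" "close_inv (set Q) L Q'"
      unfolding I_def by blast
    have "set Q' \<subseteq> \<C>" using close_inv_carrier[OF *(6) Q(1)] .
    then have "Q' = []" using stop word_top[of Q'] by (simp add: *(1))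
    then have inv: "close_inv (set Q) L []" using *(6) by simp
    have "G.sifted (set L) {} = generated_by (set Q)"
      using Q(2) by (intro close_inv_final[OF inv Q(1)]) simp
    moreover have "table L" using inv unfolding close_inv_def by blast
    ultimately show "Post \<tau>"
      unfolding *(1) \<open>Q' = []\<close> using post[OF *(2-5)] by blast
  next
    fix k \<tau>
    assume "I k \<tau>" and cont: "tops \<tau> 4 \<noteq> Blank"
    then obtain Q' X L f a where *: "\<tau> = state Q' X L [] f a" "set X \<subseteq> \<C>" "length X \<le> 1"
      "length f \<le> 1" "length a \<le> 1" "close_inv (set Q) L Q'" "k = V L Q'"
      unfolding I_def by blast
    have "Q' \<noteq> []" using cont by (auto simp: *(1))
    then obtain q R where Q': "Q' = q # R" by (cases Q') auto
    have L: "table L" "set L \<subseteq> \<C>" "length L \<le> table_bound l"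
      using *(6) table_length by (auto simp: close_inv_def table_def)
    have q: "q \<in> \<C>" using close_inv_carrier[OF *(6) Q(1)] by (simp add: Q')
    let ?Post = "\<lambda>\<tau>'. \<exists>k'<k. I k' \<tau>'"
    have I_state: "?Post (state R' [x] L' [] g [Aux 0])"
      if "x \<in> \<C>" "length g \<le> 1" "close_inv (set Q) L' R'" "V L' R' < k" for R' x L' g
      using that unfolding I_def
      by (intro exI[of _ "V L' R'"] conjI exI[of _ R'] exI[of _ "[x]"] exI[of _ L'] exI[of _ g]
          exI[of _ "[Aux 0]"]) auto
    have finish: "wp extend_unless_unit (extend_time l + 3) ?Post
        (state R [x] L [] [h] [Aux 0])"
      if red: "G.reduces (set L) q x" "\<And>y. y \<in> set L \<Longrightarrow> \<not> G.matches y x" and h: "h = Aux 0 \<longleftrightarrow> x = \<^bold>1"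
      for x h
    proof -
      have x: "x \<in> \<C>" using G.reduces_carrier[OF red(1) L(2) q] .
      show ?thesis
        unfolding extend_unless_unit_def
      proof (rule wp_Cond[where n = "extend_time l + 2"])
        assume "tops (state R [x] L [] [h] [Aux 0]) 20 = Aux 0"
        then have "x = \<^bold>1" using h by simp
        then have "close_inv (set Q) L R" using close_inv_discard *(6) Q(1) red(1) Q' by blast
        then show "wp skip (extend_time l + 2) ?Post (state R [x] L [] [h] [Aux 0])"
          using x *(7) Q' by (intro wp_skip I_state) (auto simp: V_def)
      next
        assume "tops (state R [x] L [] [h] [Aux 0]) 20 \<noteq> Aux 0"
        then have ne: "x \<noteq> \<^bold>1" using h by simp
        let ?R = "map (\<lambda>y. y \<cdot> x) (x # L) @ rev (map ((\<cdot>) x) (x # L)) @ R"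
        have inv: "close_inv (set Q) (x # L) ?R"
          using *(6) unfolding Q'
          by (rule close_inv_extend[OF _ Q(1) red ne]) auto
        then have "Suc (length L) \<le> table_bound l"
          using table_length[of "x # L"] by (simp add: close_inv_def)
        then obtain d where d: "table_bound l = Suc (length L) + d" using le_iff_add by blast
        have "V (x # L) ?R < k"
          unfolding *(7) Q' V_def d by simp
        then show "wp extend_cmd (extend_time l + 2) ?Post (state R [x] L [] [h] [Aux 0])"
          using inv by (intro wp_extend x L I_state) auto
      qed simp
    qed
    show "wp (Seq pop_cmd (Seq reduce_cmd (Seq check_unit_cmd
        extend_unless_unit))) (close_body_time l) ?Post \<tau>"
      unfolding *(1) Q'
    proof (rule wp_Seq[where m = "6 * l + 6"], rule wp_pop[OF q *(2-4)], simp)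
      show "wp (Seq reduce_cmd (Seq check_unit_cmd extend_unless_unit))
          (6 * l + 13 + reduce_time l + extend_time l) ?Post (state R [q] L [] [Aux 0] a)"
      proof (rule wp_Seq[where m = "reduce_time l"], rule wp_reduce[OF L(2,3) q])
        fix x and g :: "'b tape_symbol list"
        assume g: "length g \<le> (1::nat)" "G.reduces (set L) q x" "\<And>y. y \<in> set L \<Longrightarrow> \<not> G.matches y x"
        have "x \<in> \<C>" using G.reduces_carrier[OF g(2) L(2) q] .
        then show "wp (Seq check_unit_cmd extend_unless_unit)
            (6 * l + 10 + extend_time l) ?Post (state R [x] L [] g [Aux 0])"
          using g finish
          by (intro wp_Seq[where m = "6 * l + 6" and n = "extend_time l + 3"] wp_check_unit) simp_all
      qed (use *(5) in simp_all)
    qed (simp add: close_body_time_def)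
  qed
qed

text \<open>An irreducible remainder is in the sifted set only if it is the identity, and reduction
  respects membership in both directions, so the one remainder found is conclusive.\<close>

lemma wp_test:
  assumes "set X \<subseteq> \<C>" "length X \<le> 1" "length F \<le> 1" "length A \<le> 1" "table L" "test_time l \<le> n"
  shows "wp test_cmd n (\<lambda>\<tau>. tops \<tau> 20 = Aux 0 \<longleftrightarrow> \<beta> \<in> G.sifted (set L) {}) (state [] X L [] F A)"
    (is "wp _ _ ?Post _")
proof -
  interpret sifting_table \<G> N "(!)" "set L" using table_sifting[OF assms(5)] .
  have b: "\<beta> \<in> \<C>" using \<beta> by (simp add: P.component_def)
  show ?thesis
    unfolding test_cmd_def
  proof (rule wp_Seq[where m = "6 * l + 6"], rule wp_recall[OF assms(1-3)])
    show "wp (Seq reduce_cmd check_unit_cmd) (6 * l + 7 + reduce_time l) ?Post (state [] [\<beta>] L [] [Aux 0] A)"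
    proof (rule wp_Seq[where m = "reduce_time l"], rule wp_reduce[OF L_carrier table_length[OF assms(5)] b])
      fix x and g :: "'b tape_symbol list"
      assume g: "length g \<le> (1::nat)" "G.reduces (set L) \<beta> x" "\<And>y. y \<in> set L \<Longrightarrow> \<not> G.matches y x"
      have "x \<in> \<C>" using G.reduces_carrier[OF g(2) L_carrier b] .
      moreover have "x = \<^bold>1 \<longleftrightarrow> \<beta> \<in> U"
        using reduces_U_iff[OF g(2) b] irreducible_U_iff[of x] g(3) by blast
      ultimately show "wp check_unit_cmd (6 * l + 6) ?Post (state [] [x] L [] g [Aux 0])"
        using g(1) by (intro wp_check_unit) auto
    qed (use assms(4) in simp_all)
  qed (use assms(6) in \<open>simp_all add: test_time_def\<close>)
qed

lemma wp_close_test: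
  assumes "set Q \<subseteq> \<C>" "Q \<noteq> []" "length Q \<le> l" "length F \<le> 1" "length A \<le> 1"
    and "close_time l + test_time l + 1 \<le> n"
  shows "wp (Seq close_cmd test_cmd) n (\<lambda>\<tau>. tops \<tau> 20 = Aux 0 \<longleftrightarrow> \<beta> \<in> generated_by (set Q))
    (state Q [] [] [] F A)"
proof (rule wp_Seq[where m = "close_time l" and n = "test_time l"], rule wp_close[OF assms(1-5)])
  fix X L and f a :: "'b tape_symbol list"
  assume "set X \<subseteq> \<C>" "length X \<le> (1::nat)" "length f \<le> (1::nat)" "length a \<le> (1::nat)"
    "table L" and L: "G.sifted (set L) {} = generated_by (set Q)"
  then show "wp test_cmd (test_time l) (\<lambda>\<tau>. tops \<tau> 20 = Aux 0 \<longleftrightarrow> \<beta> \<in> generated_by (set Q))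
      (state [] X L [] f a)"
    using wp_test[of X f a L "test_time l"] by simp
qed (use assms in simp_all)

end

section \<open>Reading the input\<close>

text \<open>Unlike with \<open>first_nonzero\<close>, \<open>Aux 2\<close> prevails wherever it
  occurs: a malformed block must be noticed even if an earlier column has already shown that it is
  not above the target.\<close>

definition worst :: "((nat \<Rightarrow> 'b tape_symbol) \<Rightarrow> 'b tape_symbol) \<Rightarrow> 'b tape_symbol \<Rightarrow> (nat \<Rightarrow> 'b tape_symbol) \<Rightarrow> 'b tape_symbol" where
  "worst d f c = (if f = Aux 2 \<or> d c = Aux 2 then Aux 2 else if f = Aux 0 then d c else f)"

lemma worst_eq: "worst d f c = Aux 2 \<longleftrightarrow> f = Aux 2 \<or> d c = Aux 2"
  "worst d f c = Aux 0 \<longleftrightarrow> f = Aux 0 \<and> d c = Aux 0"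
  by (auto simp: worst_def)

lemma foldl_worst_2:
  "foldl (worst d) (Aux 0) (map g [0..<n]) = Aux 2 \<longleftrightarrow> (\<exists>j<n. d (g j) = Aux 2)"
  by (induction n) (auto simp: worst_eq less_Suc_eq)

lemma foldl_worst_0:
  "foldl (worst d) (Aux 0) (map g [0..<n]) = Aux 0 \<longleftrightarrow> (\<forall>j<n. d (g j) = Aux 0)"
  by (induction n) (auto simp: worst_eq less_Suc_eq)

lemma generated_empty: "x \<notin> generated f {}"
proof
  assume "x \<in> generated f {}"
  then show False by induction auto
qed

context solver
begin

text \<open>\<open>Aux 2\<close> marks a malformed block, one that breaks off or whose delimiters
  are not placed as in the target; \<open>Aux 0\<close> and \<open>Aux 1\<close> tell whether the
  coordinate is above that of the target.\<close>

definition grade :: "(nat \<Rightarrow> 'b tape_symbol) \<Rightarrow> 'b tape_symbol" where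
  "grade c = (if c 2 = Blank \<or> (letter (c 2) = delim) \<noteq> (letter (c 1) = delim) then Aux 2
     else if mul (unit_of (letter (c 2))) (unit_of (letter (c 1))) = unit_of (letter (c 1)) then Aux 0
     else Aux 1)"

definition check_meet :: "(nat \<Rightarrow> 'b tape_symbol) \<Rightarrow> 'b tape_symbol" where
  "check_meet c =
     (if c 3 \<noteq> Aux 0 \<and> unit_of (letter (c 3)) = unit_of (letter (c 1)) then Aux 0 else Aux 1)"

text \<open>
  Stack 3 accumulates the product of the generators above the target; the symbol \<open>Aux 0\<close> serves
  as an adjoined identity, standing for the empty product.
\<close>

definition collect_step :: "'b cmd" where
  "collect_step = sweep {1, 2, 3} (worst grade) (\<lambda>f. [1 \<mapsto> \<lambda>c. c 1,
     3 \<mapsto> \<lambda>c. if f = Aux 0 then Letter (if c 3 = Aux 0 then letter (c 2) else mul (letter (c 3)) (letter (c 2)))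
              else c 3]
     (4 := if f = Aux 0 then Some (\<lambda>c. Letter (mul (letter (c 2)) (unit_of (letter (c 1))))) else None))"

definition check_meet_cmd :: "'b cmd" where
  "check_meet_cmd = sweep {1, 3} (first_nonzero check_meet) (\<lambda>_. [1 \<mapsto> \<lambda>c. c 1])"

definition meet_and_close :: "'b cmd" where
  "meet_and_close = Seq check_meet_cmd (Cond (\<lambda>t. t 20 = Aux 0) (Seq close_cmd test_cmd) skip)"

definition solve_cmd :: "'b cmd" where
  "solve_cmd = Seq (Loop (\<lambda>t. t 2 \<noteq> Blank \<and> t 20 \<noteq> Aux 2) collect_step)
     (Cond (\<lambda>t. t 20 = Aux 2) skip meet_and_close)"

definition reverse_input :: "'b cmd" where
  "reverse_input = Loop (\<lambda>t. t 0 \<noteq> Blank)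
     (Do (\<lambda>t. (\<lambda>_. Keep)(0 := Pop, 2 := Push (t 0))))"

definition pull :: "'b instr" where
  "pull t = (\<lambda>_. Keep)(2 := Pop, 11 := Push (t 2))"

text \<open>The target passes through stack 11, which preserves its order and leaves 11 empty for
  its later use as the shadow of 1. On the way stack 3 receives one identity symbol per
  coordinate.\<close>

definition load_target :: "'b cmd" where
  "load_target = Seq (Do pull) (Seq (Loop (\<lambda>t. t 2 \<noteq> Blank \<and> t 2 \<noteq> Letter delim) (Do pull))
     (Loop (\<lambda>t. t 11 \<noteq> Blank) (Do (\<lambda>t. (\<lambda>_. Keep)(11 := Pop, 1 := Push (t 11), 3 := Push (Aux 0))))))"

text \<open>A word that does not end with a delimiter is no instance; register 20 then stays blank,
  which counts as rejection.\<close>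

definition program :: "'b cmd" where
  "program = Seq reverse_input
     (Cond (\<lambda>t. t 2 = Letter delim) (Seq load_target solve_cmd) skip)"

definition meet_step :: "nat \<Rightarrow> 'b tape_symbol list \<Rightarrow> 'b list \<Rightarrow> 'b tape_symbol list" where
  "meet_step n M v = map (\<lambda>j. Letter (if M ! j = Aux 0 then v ! j else mul (letter (M ! j)) (v ! j))) [0..<n]"

definition solve_time :: "nat \<Rightarrow> nat" where
  "solve_time l = l * (6 * l + 7) + 6 * l + 20 + close_time l + test_time l"

end

context solver_instance
begin

text \<open>In the application the target is a delimiter followed by other letters, so this says
  that a block starts with a delimiter and contains no further one.\<close>

definition well_shaped :: "'b list \<Rightarrow> bool" where
  "well_shaped v \<longleftrightarrow> v \<in> power_carrier T N \<and> (\<forall>j<N. (v ! j = delim) = (\<beta> ! j = delim))"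

lemma above_iff:
  assumes "v \<in> power_carrier T N"
  shows "P.above v \<beta> \<longleftrightarrow> (\<forall>j<N. mul (unit_of (v ! j)) (unit_of (\<beta> ! j)) = unit_of (\<beta> ! j))"
  using power_carrier_length[OF assms] length_\<beta>
  by (auto simp: P.above_def list_eq_iff_nth_eq)

lemma wp_collect_step:
  assumes R: "set R \<subseteq> T" and M: "length M = N" "length F \<le> 1" and n: "6 * l + 6 \<le> n"
    and post: "\<And>f. f = Aux 2 \<longleftrightarrow> \<not> (N \<le> length R \<and> well_shaped (take N R)) \<Longrightarrow>
      (f \<noteq> Aux 2 \<Longrightarrow> f = Aux 0 \<longleftrightarrow> P.above (take N R) \<beta>) \<Longrightarrow>
      Post (conf \<beta> (map Letter (drop N R))
        (if f = Aux 0 then meet_step N M R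
         else M)
        (if f = Aux 0 then P.lower \<beta> (take N R) # Q else Q) [] [] [] [f] A)"
  shows "wp collect_step n Post (conf \<beta> (map Letter R) M Q [] [] [] F A)"
proof -
  let ?c = "column {1, 2, 3} (conf \<beta> (map Letter R) M Q [] [] [] F A)"
  define f where "f = foldl (worst grade) (Aux 0) (map ?c [0..<N])"
  have c1: "?c j 1 = Letter (\<beta> ! j)" "?c j (Suc 0) = Letter (\<beta> ! j)" if "j < N" for j
    using that length_\<beta> by (simp_all add: column_simps nth_blank_map)
  have c2: "?c j 2 = (if j < length R then Letter (R ! j) else Blank)" for j
    by (simp add: column_simps nth_blank_def)
  have c3: "?c j 3 = M ! j" if "j < N" for j
    using that M(1) by (simp add: column_simps nth_blank_def)
  have shaped: "f = Aux 2 \<longleftrightarrow> \<not> (N \<le> length R \<and> well_shaped (take N R))"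
  proof -
    have g: "grade (?c j) = Aux 2 \<longleftrightarrow> \<not> (j < length R \<and> (R ! j = delim) = (\<beta> ! j = delim))" if "j < N" for j
      unfolding grade_def using c1[OF that] c2[of j] by simp
    have "f = Aux 2 \<longleftrightarrow> (\<exists>j<N. grade (?c j) = Aux 2)"
      unfolding f_def by (rule foldl_worst_2)
    also have "\<dots> \<longleftrightarrow> \<not> (N \<le> length R \<and> (\<forall>j<N. (R ! j = delim) = (\<beta> ! j = delim)))"
    proof -
      have "(\<forall>j<N. j < length R) \<longleftrightarrow> N \<le> length R"
        by (meson leI less_le_trans less_irrefl)
      then show ?thesis using g by blast
    qed
    also have "\<dots> \<longleftrightarrow> \<not> (N \<le> length R \<and> well_shaped (take N R))"
      using R by (auto simp: well_shaped_def power_carrier_def dest: in_set_takeD)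
    finally show ?thesis .
  qed
  have above: "f = Aux 0 \<longleftrightarrow> P.above (take N R) \<beta>" and long: "N \<le> length R" if "f \<noteq> Aux 2"
  proof -
    have ws: "N \<le> length R" "well_shaped (take N R)" using that shaped by auto
    then show "N \<le> length R" by simp
    have "f = Aux 0 \<longleftrightarrow> (\<forall>j<N. grade (?c j) = Aux 0)"
      unfolding f_def by (rule foldl_worst_0)
    also have "\<dots> \<longleftrightarrow> (\<forall>j<N. mul (unit_of (R ! j)) (unit_of (\<beta> ! j)) = unit_of (\<beta> ! j))"
      using ws c1 c2 unfolding grade_def well_shaped_def by auto
    finally show "f = Aux 0 \<longleftrightarrow> P.above (take N R) \<beta>"
      using ws by (simp add: above_iff well_shaped_def)
  qed
  have keep: "map (\<lambda>j. ?c j 3) [0..<N] = M"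
    using c3 M(1) by (intro nth_equalityI) simp_all
  have [simp]: "f = Aux 0 \<Longrightarrow> j < length M \<Longrightarrow> j < length R" for j
    using long M(1) by auto
  have lower: "map (\<lambda>j. Letter (mul (letter (?c j 2)) (unit_of (letter (?c j 1))))) [0..<N] =
      map Letter (P.lower \<beta> (take N R))" if "f = Aux 0"
    using c1 c2 long that length_\<beta>
    by (intro nth_equalityI) (simp_all add: P.lower_def)
  have target: "map (\<lambda>j. ?c j 1) [0..<N] = map Letter \<beta>"
    using c1 length_\<beta> by (intro nth_equalityI) simp_all
  show ?thesis
    unfolding collect_step_def
    by (rule wp_sweep_conf[where N = N and Post = Post, OF post[OF shaped above]])
      (use keep lower target M n N_le length_\<beta> f_def[symmetric] in
        \<open>auto simp: sweep_stack_def drop_map column_simps nth_blank_def meet_step_def\<close>)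
qed

lemma wp_check_meet:
  assumes M: "length M = N" "length F \<le> 1" and n: "6 * l + 6 \<le> n"
    and post: "\<And>f. f = Aux 0 \<longleftrightarrow> (\<forall>j<N. M ! j \<noteq> Aux 0 \<and> unit_of (letter (M ! j)) = unit_of (\<beta> ! j)) \<Longrightarrow>
      Post (state Q [] [] [] [f] A)"
  shows "wp check_meet_cmd n Post (conf \<beta> [] M Q [] [] [] F A)"
proof -
  let ?c = "column {1, 3} (conf \<beta> [] M Q [] [] [] F A)"
  define f where "f = foldl (first_nonzero check_meet) (Aux 0) (map ?c [0..<N])"
  have c1: "?c j 1 = Letter (\<beta> ! j)" "?c j (Suc 0) = Letter (\<beta> ! j)" if "j < N" for j
    using that length_\<beta> by (simp_all add: column_simps nth_blank_map)
  have c3: "?c j 3 = M ! j" if "j < N" for j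
    using that M(1) by (simp add: column_simps nth_blank_def)
  have "f = Aux 0 \<longleftrightarrow> (\<forall>j<N. check_meet (?c j) = Aux 0)"
    unfolding f_def by (rule foldl_first_nonzero_0)
  also have "\<dots> \<longleftrightarrow> (\<forall>j<N. M ! j \<noteq> Aux 0 \<and> unit_of (letter (M ! j)) = unit_of (\<beta> ! j))"
    using c1 c3 by (auto simp: check_meet_def)
  finally have f: "f = Aux 0 \<longleftrightarrow> (\<forall>j<N. M ! j \<noteq> Aux 0 \<and> unit_of (letter (M ! j)) = unit_of (\<beta> ! j))" .
  have target: "map (\<lambda>j. ?c j 1) [0..<N] = map Letter \<beta>"
    using c1 length_\<beta> by (intro nth_equalityI) simp_all
  show ?thesis
    unfolding check_meet_cmd_def
    by (rule wp_sweep_conf[where N = N and Post = Post, OF post[OF f]])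
      (use target M n N_le length_\<beta> f_def[symmetric] in \<open>auto simp: sweep_stack_def\<close>)
qed

section \<open>Parsing and the meet of the relevant generators\<close>

definition parses :: "'b list \<Rightarrow> 'b list list \<Rightarrow> bool" where
  "parses R vs \<longleftrightarrow> (\<forall>v\<in>set vs. well_shaped v) \<and> R = concat vs"

lemma well_shaped_length: "well_shaped v \<Longrightarrow> length v = N"
  by (auto simp: well_shaped_def power_carrier_length)

text \<open>All blocks have the same positive length, so each next block is forced and any parse
  extends the one found so far.\<close>

lemma parses_append:
  assumes "parses (concat vs @ R) ws" "\<forall>v\<in>set vs. well_shaped v"
  shows "\<exists>ws'. ws = vs @ ws' \<and> parses R ws'"
  using assms
proof (induction vs arbitrary: ws)
  case (Cons v vs)
  have v: "length v = N" using Cons.prems(2) well_shaped_length by simp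
  have "ws \<noteq> []" using Cons.prems(1) v N_pos by (auto simp: parses_def)
  then obtain w ws1 where ws: "ws = w # ws1" by (cases ws) auto
  have "length w = N" using Cons.prems(1) well_shaped_length by (simp add: ws parses_def)
  then have "v = w" "parses (concat vs @ R) ws1"
    using Cons.prems(1) v by (auto simp: ws parses_def)
  then show ?case using Cons.IH[of ws1] Cons.prems(2) ws by auto
qed simp

lemma parses_unique: "parses R vs \<Longrightarrow> parses R ws \<Longrightarrow> vs = ws"
proof -
  assume vs: "parses R vs" and ws: "parses R ws"
  then have "parses (concat vs @ []) ws" by (simp add: parses_def)
  then obtain ws' where ws': "ws = vs @ ws'" "parses [] ws'"
    using parses_append[of vs "[]" ws] vs unfolding parses_def by blast
  have "ws' = []"
  proof (cases ws')
    case (Cons v ws1)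
    then have "v = []" "length v = N" using ws'(2) well_shaped_length by (auto simp: parses_def)
    then show ?thesis using N_pos by simp
  qed
  then show ?thesis using ws'(1) by simp
qed

definition kept :: "'b list list \<Rightarrow> 'b list set" where
  "kept vs = {v \<in> set vs. P.above v \<beta>}"

text \<open>The element \<open>m\<close> need not be idempotent: only its unit matters, which is the
  meet of the units of the kept generators.\<close>

definition meet_of :: "'b list list \<Rightarrow> 'b tape_symbol list \<Rightarrow> bool" where
  "meet_of vs M \<longleftrightarrow> kept vs = {} \<and> M = replicate N (Aux 0) \<or>
     (\<exists>m. M = map Letter m \<and> m \<in> generated_by (kept vs) \<and> (\<forall>a\<in>kept vs. P.above a m))"

definition collected :: "'b list \<Rightarrow> 'b list list \<Rightarrow> 'b tape_symbol list \<Rightarrow> 'b list list \<Rightarrow> bool" where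
  "collected R vs M Q \<longleftrightarrow> (\<forall>v\<in>set vs. well_shaped v) \<and> meet_of vs M \<and>
     set Q = P.lower \<beta> ` kept vs \<and> length Q \<le> length vs"

lemma kept_carrier: "\<forall>v\<in>set vs. well_shaped v \<Longrightarrow> kept vs \<subseteq> power_carrier T N"
  by (auto simp: kept_def well_shaped_def)

lemma meet_of_length:
  assumes "\<forall>v\<in>set vs. well_shaped v" "meet_of vs M"
  shows "length M = N"
  using assms P.generated_closed[OF kept_carrier[OF assms(1)]] power_carrier_length[of _ T N]
  by (auto simp: meet_of_def)

lemma meet_of_step:
  assumes vs: "\<forall>v\<in>set vs. well_shaped v" and v: "well_shaped v" and M: "meet_of vs M" and ab: "P.above v \<beta>"
  shows "meet_of (vs @ [v]) (meet_step N M v)"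
proof -
  have vc: "v \<in> power_carrier T N" using v by (simp add: well_shaped_def)
  have k: "kept (vs @ [v]) = insert v (kept vs)" using ab by (auto simp: kept_def)
  show ?thesis
  proof (cases "kept vs = {} \<and> M = replicate N (Aux 0)")
    case True
    then have "meet_step N M v = map Letter v"
      using well_shaped_length[OF v] by (intro nth_equalityI) (auto simp: meet_step_def)
    then show ?thesis
      using True P.above_refl[OF vc] by (auto simp: meet_of_def k intro: generated.gen)
  next
    case False
    then obtain m where m: "M = map Letter m" "m \<in> generated_by (kept vs)" "\<forall>a\<in>kept vs. P.above a m"
      using M by (auto simp: meet_of_def)
    have mc: "m \<in> power_carrier T N" using P.generated_closed[OF kept_carrier[OF vs] m(2)] .
    have "meet_step N M v = map Letter (map2 mul m v)"
      using power_carrier_length[OF mc] power_carrier_length[OF vc] m(1)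
      by (intro nth_equalityI) (auto simp: meet_step_def)
    moreover have sub: "x \<in> generated_by (insert v (kept vs))" if "x \<in> generated_by (kept vs)" for x
      using that by induction (auto intro: generated.intros)
    have "map2 mul m v \<in> generated_by (insert v (kept vs))"
      by (rule generated.mult[OF sub[OF m(2)] generated.gen]) simp
    moreover have "P.above a (map2 mul m v)" if "a \<in> insert v (kept vs)" for a
    proof (cases "a = v")
      case False
      then have "P.above a m" "a \<in> power_carrier T N" using that m(3) kept_carrier[OF vs] by auto
      then show ?thesis using P.above_trans P.above_mult_left(1)[OF mc vc] mc vc P.closed by blast
    qed (use P.above_mult_left(2)[OF mc vc] in simp)
    ultimately show ?thesis unfolding meet_of_def k by blast
  qed
qed

definition solution :: "'b list \<Rightarrow> bool" where
  "solution R \<longleftrightarrow> (\<exists>vs. parses R vs \<and> \<beta> \<in> generated_by (set vs))"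

text \<open>If some generator is kept, this is \<open>generated_iff_lower\<close>. If none is, a
  product above the target would have a factor above it, so the target, which is above itself, is
  not generated; the identity symbols on stack 3 make the test fail as well.\<close>

lemma solution_iff:
  assumes "parses R vs" "meet_of vs M" "set Q = P.lower \<beta> ` kept vs"
  shows "solution R \<longleftrightarrow> (\<forall>j<N. M ! j \<noteq> Aux 0 \<and> unit_of (letter (M ! j)) = unit_of (\<beta> ! j)) \<and>
    \<beta> \<in> generated_by (set Q)"
proof -
  have vs: "\<forall>v\<in>set vs. well_shaped v" using assms(1) by (simp add: parses_def)
  have vc: "set vs \<subseteq> power_carrier T N" using vs by (auto simp: well_shaped_def)
  have sol: "solution R \<longleftrightarrow> \<beta> \<in> generated_by (set vs)"
    using assms(1) parses_unique unfolding solution_def by blast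
  show ?thesis
  proof (cases "kept vs = {} \<and> M = replicate N (Aux 0)")
    case True
    have "\<not> P.above x \<beta>" if "x \<in> generated_by (set vs)" for x
      using that
    proof induction
      case (gen a)
      then show ?case using True by (auto simp: kept_def)
    next
      case (mult x y)
      then have "x \<in> power_carrier T N" "y \<in> power_carrier T N" using P.generated_closed[OF vc] by auto
      then show ?case using mult P.above_multD(1) \<beta> by blast
    qed
    then show ?thesis using True N_pos P.above_refl[OF \<beta>] sol by auto
  next
    case False
    then obtain m where m: "M = map Letter m" "m \<in> generated_by (kept vs)" "\<forall>a\<in>kept vs. P.above a m"
      using assms(2) by (auto simp: meet_of_def)
    have "m \<in> power_carrier T N" using P.generated_closed[OF kept_carrier[OF vs] m(2)] .
    then have len: "length m = N" by (rule power_carrier_length)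
    have "\<beta> \<in> generated_by (set vs) \<longleftrightarrow> map unit_of m = map unit_of \<beta> \<and>
        \<beta> \<in> generated_by (P.lower \<beta> ` {a \<in> set vs. P.above a \<beta>})"
      using m(2,3) by (intro P.generated_iff_lower finite_power_carrier finite_T vc \<beta>) (auto simp: kept_def)
    moreover have "map unit_of m = map unit_of \<beta> \<longleftrightarrow> (\<forall>j<N. M ! j \<noteq> Aux 0 \<and> unit_of (letter (M ! j)) = unit_of (\<beta> ! j))"
      using len length_\<beta> by (auto simp: m(1) list_eq_iff_nth_eq)
    ultimately show ?thesis using sol assms(3) by (simp add: kept_def)
  qed
qed

lemma lower_kept_carrier:
  "\<forall>v\<in>set vs. well_shaped v \<Longrightarrow> P.lower \<beta> ` kept vs \<subseteq> \<C>"
  using P.lower_component \<beta> by (auto simp: kept_def well_shaped_def)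

lemma wp_solve:
  assumes R: "set R \<subseteq> T" "length R \<le> l" and n: "solve_time l \<le> n"
  shows "wp solve_cmd n (\<lambda>\<tau>. tops \<tau> 20 = Aux 0 \<longleftrightarrow> solution R)
    (conf \<beta> (map Letter R) (replicate N (Aux 0)) [] [] [] [] [] [])"
    (is "wp _ _ ?Post _")
proof -
  \<comment> \<open>After a malformed block only the negative answer is remembered. The bound on
    \<open>length vs + length R'\<close> limits the queue: every block takes at least one letter, so
    at most \<open>l\<close> tuples are collected.\<close>
  define I where "I k \<tau> \<longleftrightarrow> (\<exists>vs R' M Q F. \<tau> = conf \<beta> (map Letter R') M Q [] [] [] F [] \<and> length F \<le> 1 \<and>
    k = length R' \<and> set R' \<subseteq> T \<and>
    (F = [Aux 2] \<and> \<not> solution R \<or>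
     F \<noteq> [Aux 2] \<and> R = concat vs @ R' \<and> collected R vs M Q \<and> length vs + length R' \<le> l))" for k \<tau>
  have "wp (Loop (\<lambda>t. t 2 \<noteq> Blank \<and> t 20 \<noteq> Aux 2) collect_step) (Suc (l * (6 * l + 7)))
    (wp (Cond (\<lambda>t. t 20 = Aux 2) skip
       meet_and_close)
       (6 * l + 15 + close_time l + test_time l) ?Post)
    (conf \<beta> (map Letter R) (replicate N (Aux 0)) [] [] [] [] [] [])"
  proof (rule wp_Loop[where I = I and v = "length R" and m = "6 * l + 6"])
    show "I (length R) (conf \<beta> (map Letter R) (replicate N (Aux 0)) [] [] [] [] [] [])"
      unfolding I_def using R
      by (intro exI[of _ "[]"] exI[of _ R] exI[of _ "replicate N (Aux 0)"])
        (simp add: collected_def meet_of_def kept_def)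
  next
    show "Suc (length R * Suc (6 * l + 6)) \<le> Suc (l * (6 * l + 7))"
      using mult_le_mono1[OF R(2), of "6 * l + 7"] by (simp add: add.commute)
  next
    fix k \<tau>
    assume "I k \<tau>" and cont: "tops \<tau> 2 \<noteq> Blank \<and> tops \<tau> 20 \<noteq> Aux 2"
    then obtain vs R' M Q F where *: "\<tau> = conf \<beta> (map Letter R') M Q [] [] [] F []" "length F \<le> 1"
      "k = length R'" "set R' \<subseteq> T" "F \<noteq> [Aux 2]" "R = concat vs @ R'" "collected R vs M Q"
      "length vs + length R' \<le> l"
      unfolding I_def by (auto simp: tops_def)
    have "R' \<noteq> []" using cont *(1) by (auto simp: tops_def)
    then have dec: "length (drop N R') < k" using *(3) N_pos by (cases R') auto
    have vs: "\<forall>v\<in>set vs. well_shaped v" "meet_of vs M" using *(7) by (auto simp: collected_def)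
    show "wp collect_step (6 * l + 6) (\<lambda>\<tau>'. \<exists>k'<k. I k' \<tau>') \<tau>"
      unfolding *(1)
    proof (rule wp_collect_step[OF *(4) meet_of_length[OF vs] *(2)])
      fix f :: "'b tape_symbol"
      assume f: "f = Aux 2 \<longleftrightarrow> \<not> (N \<le> length R' \<and> well_shaped (take N R'))"
        and ab: "f \<noteq> Aux 2 \<Longrightarrow> f = Aux 0 \<longleftrightarrow> P.above (take N R') \<beta>"
      let ?M = "if f = Aux 0 then meet_step N M R'
         else M"
      let ?Q = "if f = Aux 0 then P.lower \<beta> (take N R') # Q else Q"
      have T: "set (drop N R') \<subseteq> T" using *(4) by (meson order_trans set_drop_subset)
      have "I (length (drop N R')) (conf \<beta> (map Letter (drop N R')) ?M ?Q [] [] [] [f] [])"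
      proof (cases "f = Aux 2")
        case True
        have "\<not> solution R"
        proof
          assume "solution R"
          then obtain ws where "parses (concat vs @ R') ws" unfolding solution_def *(6) by blast
          then obtain ws' where ws': "parses R' ws'" using parses_append vs(1) by blast
          then obtain v ws'' where "ws' = v # ws''" using \<open>R' \<noteq> []\<close> by (cases ws') (auto simp: parses_def)
          then have "well_shaped v" "R' = v @ concat ws''" using ws' by (auto simp: parses_def)
          then show False using f True well_shaped_length by simp
        qed
        then show ?thesis
          unfolding I_def using True T by (intro exI[of _ vs] exI[of _ "drop N R'"] exI[of _ ?M] exI[of _ ?Q] exI[of _ "[f]"]) simp
      next
        case False
        then have long: "N \<le> length R'" and v: "well_shaped (take N R')" using f by auto
        have nth: "R' ! j = take N R' ! j" if "j < N" for j using that by simp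
        have "meet_of (vs @ [take N R']) ?M"
        proof (cases "f = Aux 0")
          case True
          have "P.above (take N R') \<beta>" using ab[OF False] True by simp
          moreover have "meet_step N M R' = meet_step N M (take N R')"
            unfolding meet_step_def by (intro map_cong) auto
          ultimately show ?thesis
            using meet_of_step[OF vs(1) v vs(2)] by (simp only: True simp_thms if_True)
        next
          case f0: False
          then have "kept (vs @ [take N R']) = kept vs" using ab[OF False] by (auto simp: kept_def)
          then show ?thesis using vs(2) f0 by (simp add: meet_of_def)
        qed
        moreover have "set ?Q = P.lower \<beta> ` kept (vs @ [take N R'])"
          using ab[OF False] *(7) by (auto simp: kept_def collected_def)
        ultimately have "collected R (vs @ [take N R']) ?M ?Q"
          using *(7) v by (auto simp: collected_def)
        moreover have "R = concat (vs @ [take N R']) @ drop N R'" using *(6) by simp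
        moreover have "length (vs @ [take N R']) + length (drop N R') \<le> l"
          using *(8) long N_pos by simp
        ultimately show ?thesis
          unfolding I_def using False T
          by (intro exI[of _ "vs @ [take N R']"] exI[of _ "drop N R'"] exI[of _ ?M] exI[of _ ?Q] exI[of _ "[f]"]) simp
      qed
      then show "\<exists>k'<k. I k' (conf \<beta> (map Letter (drop N R')) ?M ?Q [] [] [] [f] [])"
        using dec by blast
    qed simp
  next
    fix k \<tau>
    assume "I k \<tau>" and stop: "\<not> (tops \<tau> 2 \<noteq> Blank \<and> tops \<tau> 20 \<noteq> Aux 2)"
    then obtain vs R' M Q F where *: "\<tau> = conf \<beta> (map Letter R') M Q [] [] [] F []" "length F \<le> 1"
      "k = length R'" "set R' \<subseteq> T"
      "F = [Aux 2] \<and> \<not> solution R \<or>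
       F \<noteq> [Aux 2] \<and> R = concat vs @ R' \<and> collected R vs M Q \<and> length vs + length R' \<le> l"
      unfolding I_def by blast
    have top: "tops \<tau> 20 = Aux 2 \<longleftrightarrow> F = [Aux 2]"
      using *(1,2) by (cases F) (auto simp: tops_def)
    show "wp (Cond (\<lambda>t. t 20 = Aux 2) skip
       meet_and_close)
       (6 * l + 15 + close_time l + test_time l) ?Post \<tau>"
    proof (rule wp_Cond[where n = "6 * l + 14 + close_time l + test_time l"])
      assume "tops \<tau> 20 = Aux 2"
      then show "wp skip (6 * l + 14 + close_time l + test_time l) ?Post \<tau>"
        using top *(5) by (intro wp_skip) auto
    next
      assume ne: "tops \<tau> 20 \<noteq> Aux 2"
      then have "tops \<tau> 2 = Blank" using stop by blast
      then have "R' = []" using *(1) by (cases R') (auto simp: tops_def)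
      then have **: "R = concat vs" "collected R vs M Q" "length vs \<le> l" using *(5) ne top by auto
      then have vs: "\<forall>v\<in>set vs. well_shaped v" "meet_of vs M" "set Q = P.lower \<beta> ` kept vs" "length Q \<le> l"
        by (auto simp: collected_def)
      have sol: "solution R \<longleftrightarrow> (\<forall>j<N. M ! j \<noteq> Aux 0 \<and> unit_of (letter (M ! j)) = unit_of (\<beta> ! j)) \<and>
          \<beta> \<in> generated_by (set Q)"
        using solution_iff[OF _ vs(2,3)] vs(1) **(1) by (simp add: parses_def)
      have Qc: "set Q \<subseteq> \<C>" using lower_kept_carrier[OF vs(1)] vs(3) by simp
      show "wp meet_and_close
          (6 * l + 14 + close_time l + test_time l) ?Post \<tau>"
        unfolding *(1) \<open>R' = []\<close> list.map(1) meet_and_close_def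
      proof (rule wp_Seq[where m = "6 * l + 6"], rule wp_check_meet[OF meet_of_length[OF vs(1,2)] *(2)], simp)
        fix f :: "'b tape_symbol"
        assume f: "f = Aux 0 \<longleftrightarrow> (\<forall>j<N. M ! j \<noteq> Aux 0 \<and> unit_of (letter (M ! j)) = unit_of (\<beta> ! j))"
        show "wp (Cond (\<lambda>t. t 20 = Aux 0) (Seq close_cmd test_cmd) skip)
            (6 + close_time l + test_time l) ?Post (state Q [] [] [] [f] [])"
        proof (rule wp_Cond[where n = "4 + close_time l + test_time l"])
          assume "tops (state Q [] [] [] [f] []) 20 = Aux 0"
          then have 1: "\<forall>j<N. M ! j \<noteq> Aux 0 \<and> unit_of (letter (M ! j)) = unit_of (\<beta> ! j)"
            using f by simp
          \<comment> \<open>Passing the test shows that some generator was kept, so the queue is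
            nonempty, as the correctness of the closure requires.\<close>
          then have "M \<noteq> replicate N (Aux 0)" using N_pos by auto
          then have "kept vs \<noteq> {}" using vs(2) generated_empty unfolding meet_of_def by metis
          then have "Q \<noteq> []" using vs(3) by auto
          then have "wp (Seq close_cmd test_cmd) (4 + close_time l + test_time l)
              (\<lambda>\<tau>. tops \<tau> 20 = Aux 0 \<longleftrightarrow> \<beta> \<in> generated_by (set Q)) (state Q [] [] [] [f] [])"
            using Qc vs(4) by (intro wp_close_test) auto
          then show "wp (Seq close_cmd test_cmd) (4 + close_time l + test_time l) ?Post (state Q [] [] [] [f] [])"
            using 1 sol by simp
        next
          assume "tops (state Q [] [] [] [f] []) 20 \<noteq> Aux 0"
          then show "wp skip (4 + close_time l + test_time l) ?Post (state Q [] [] [] [f] [])"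
            using f sol by (intro wp_skip) auto
        qed simp
      qed simp
    qed simp
  qed
  then show ?thesis
    unfolding solve_cmd_def by (rule wp_Seq) (use n in \<open>simp add: solve_time_def\<close>)
qed

end

context solver
begin

section \<open>The whole program\<close>

definition program_time :: "nat \<Rightarrow> nat" where
  "program_time l = 9 * l + 20 + solve_time l"

text \<open>The condition decided by the program, phrased on the reversed word with delimiter
  patterns only; \<open>SMP_iff_accepted\<close> links it to encoded instances.\<close>

definition accepted :: "'b list \<Rightarrow> bool" where
  "accepted w \<longleftrightarrow> (\<exists>u vs. rev w = delim # u @ concat vs \<and> delim \<notin> set u \<and>
     (\<forall>v\<in>set vs. v \<in> power_carrier T (Suc (length u)) \<and>
        (\<forall>j<Suc (length u). (v ! j = delim) = ((delim # u) ! j = delim))) \<and>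
     delim # u \<in> generated (map2 mul) (set vs))"

lemma wp_reverse_input:
  "wp reverse_input (3 * length w + 1) (\<lambda>\<tau>. \<tau> = (\<lambda>_. [])(2 := map Letter (rev w))) (input_store w)"
  unfolding reverse_input_def
proof (rule wp_for_each[where xs = w and m = 2 and
      I = "\<lambda>u v \<tau>. \<tau> = (\<lambda>_. [])(0 := map Letter v, 2 := map Letter (rev u))"])
  fix u x v and \<tau> :: "'b store"
  assume \<tau>: "\<tau> = (\<lambda>_. [])(0 := map Letter (x # v), 2 := map Letter (rev u))"
  have "update (\<lambda>t. (\<lambda>_. Keep)(0 := Pop, 2 := Push (t 0))) \<tau> =
      (\<lambda>_. [])(0 := map Letter v, 2 := map Letter (rev (u @ [x])))"
    by (auto simp: \<tau> update_def tops_def fun_eq_iff)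
  then show "tops \<tau> 0 \<noteq> Blank \<and> wp (Do (\<lambda>t. (\<lambda>_. Keep)(0 := Pop, 2 := Push (t 0)))) 2
      (\<lambda>\<tau>. \<tau> = (\<lambda>_. [])(0 := map Letter v, 2 := map Letter (rev (u @ [x])))) \<tau>"
    by (intro conjI wp_Do) (simp_all add: \<tau> tops_def)
qed (auto simp: tops_def input_store_def fun_eq_iff)

lemma update_pull:
  "update pull ((\<lambda>_. [])(2 := map Letter (x # v), 11 := s)) = (\<lambda>_. [])(2 := map Letter v, 11 := Letter x # s)"
  by (auto simp: update_def pull_def tops_def fun_eq_iff)

lemma wp_load_target:
  assumes u: "delim \<notin> set u" and rest: "rest = [] \<or> hd rest = delim"
    and n: "6 * length u + 10 \<le> n"
  shows "wp load_target n
    (\<lambda>\<tau>. \<tau> = conf (delim # u) (map Letter rest) (replicate (Suc (length u)) (Aux 0)) [] [] [] [] [] [])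
    ((\<lambda>_. [])(2 := map Letter (delim # u @ rest)))"
    (is "wp _ _ ?Post _")
proof -
  let ?step = "(\<lambda>t. (\<lambda>_. Keep)(11 := Pop, 1 := Push (t 11), 3 := Push (Aux 0))) :: 'b instr"
  define \<beta> where "\<beta> = delim # u"
  define s where "s v w = ((\<lambda>_. [])(2 := map Letter v, 11 := w) :: 'b store)" for v w
  \<comment> \<open>The store with the first \<open>k\<close> letters of the target still on stack
    11; \<open>k\<close> counts down to 0.\<close>
  define stage where "stage k = ((\<lambda>_. [])(2 := map Letter rest, 11 := map Letter (rev (take k \<beta>)),
    1 := map Letter (drop k \<beta>), 3 := replicate (length \<beta> - k) (Aux 0)) :: 'b store)" for k
  have stage_step: "update ?step (stage (Suc k)) = stage k" if "k < length \<beta>" for k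
    using that Cons_nth_drop_Suc[OF that, symmetric]
    by (auto simp: update_def tops_def stage_def fun_eq_iff take_Suc_conv_app_nth Suc_diff_Suc
        replicate_Suc[symmetric] simp del: replicate_Suc)
  have restore: "wp (Loop (\<lambda>t. t 11 \<noteq> Blank) (Do ?step)) (3 * length \<beta> + 1) ?Post (stage (length \<beta>))"
  proof (rule wp_Loop[where I = "\<lambda>k \<tau>. \<tau> = stage k \<and> k \<le> length \<beta>" and v = "length \<beta>" and m = 2])
    fix k and \<tau> :: "'b store"
    assume k: "\<tau> = stage k \<and> k \<le> length \<beta>" "tops \<tau> 11 \<noteq> Blank"
    then obtain k' where "k = Suc k'" by (cases k) (auto simp: tops_def stage_def)
    then show "wp (Do ?step) 2 (\<lambda>\<tau>'. \<exists>k'<k. \<tau>' = stage k' \<and> k' \<le> length \<beta>) \<tau>"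
      using k stage_step[of k'] by (intro wp_Do) auto
  next
    fix k and \<tau> :: "'b store"
    assume k: "\<tau> = stage k \<and> k \<le> length \<beta>" "\<not> tops \<tau> 11 \<noteq> Blank"
    then have "k = 0"
      by (cases k) (auto simp: tops_def stage_def take_Suc_conv_app_nth)
    then show "?Post \<tau>" using k by (auto simp: stage_def conf_def fun_eq_iff \<beta>_def)
  qed auto
  have "wp (Loop (\<lambda>t. t 2 \<noteq> Blank \<and> t 2 \<noteq> Letter delim) (Do pull)) (3 * length u + 1)
      (wp (Loop (\<lambda>t. t 11 \<noteq> Blank) (Do ?step)) (3 * length \<beta> + 1) ?Post) (s (u @ rest) [Letter delim])"
  proof (rule wp_for_each[where m = 2 and xs = u and
        I = "\<lambda>u1 u2 \<tau>. \<tau> = s (u2 @ rest) (map Letter (rev (delim # u1)))"])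
    fix u1 x u2 \<tau>
    assume *: "u = u1 @ x # u2" "\<tau> = s ((x # u2) @ rest) (map Letter (rev (delim # u1)))"
    have "update pull \<tau> = s (u2 @ rest) (map Letter (rev (delim # u1 @ [x])))"
      using update_pull[of x "u2 @ rest"] by (simp add: *(2) s_def)
    then show "(tops \<tau> 2 \<noteq> Blank \<and> tops \<tau> 2 \<noteq> Letter delim) \<and>
        wp (Do pull) 2 (\<lambda>\<tau>. \<tau> = s (u2 @ rest) (map Letter (rev (delim # u1 @ [x])))) \<tau>"
      using u * by (intro conjI wp_Do) (auto simp: tops_def s_def)
  next
    fix \<tau>
    assume \<tau>: "\<tau> = s ([] @ rest) (map Letter (rev (delim # u)))"
    then have "\<tau> = stage (length \<beta>)" by (auto simp: s_def stage_def \<beta>_def fun_eq_iff)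
    then have "wp (Loop (\<lambda>t. t 11 \<noteq> Blank) (Do ?step)) (3 * length \<beta> + 1) ?Post \<tau>"
      using restore by simp
    moreover have "tops \<tau> 2 = Blank \<or> tops \<tau> 2 = Letter delim"
      using rest by (cases rest) (auto simp: \<tau> tops_def s_def)
    ultimately show "\<not> (tops \<tau> 2 \<noteq> Blank \<and> tops \<tau> 2 \<noteq> Letter delim) \<and>
        wp (Loop (\<lambda>t. t 11 \<noteq> Blank) (Do ?step)) (3 * length \<beta> + 1) ?Post \<tau>"
      by blast
  qed simp_all
  then have loops: "wp (Seq (Loop (\<lambda>t. t 2 \<noteq> Blank \<and> t 2 \<noteq> Letter delim) (Do pull))
      (Loop (\<lambda>t. t 11 \<noteq> Blank) (Do ?step))) (6 * length u + 6) ?Post (s (u @ rest) [Letter delim])"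
    by (rule wp_Seq) (simp add: \<beta>_def)
  have "update pull ((\<lambda>_. [])(2 := map Letter (delim # u @ rest))) = s (u @ rest) [Letter delim]"
    by (auto simp: update_def pull_def tops_def s_def fun_eq_iff)
  then have "wp (Do pull) 2 (wp (Seq (Loop (\<lambda>t. t 2 \<noteq> Blank \<and> t 2 \<noteq> Letter delim) (Do pull))
      (Loop (\<lambda>t. t 11 \<noteq> Blank) (Do ?step))) (6 * length u + 6) ?Post)
      ((\<lambda>_. [])(2 := map Letter (delim # u @ rest)))"
    using loops by (intro wp_Do) simp_all
  then show ?thesis
    unfolding load_target_def by (rule wp_Seq) (use n in simp)
qed

lemma wp_program:
  assumes w: "set w \<subseteq> T"
  shows "wp program (program_time (length w)) (\<lambda>\<tau>. tops \<tau> 20 = Aux 0 \<longleftrightarrow> accepted w) (input_store w)"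
    (is "wp _ _ ?Post _")
proof -
  let ?l = "length w"
  have "wp (Cond (\<lambda>t. t 2 = Letter delim) (Seq load_target solve_cmd) skip) (6 * ?l + 15 + solve_time ?l)
    ?Post ((\<lambda>_. [])(2 := map Letter (rev w)))"
  proof (rule wp_Cond)
    assume "tops ((\<lambda>_. [])(2 := map Letter (rev w))) 2 = Letter delim"
    then obtain R where R: "rev w = delim # R"
      by (cases "rev w") (auto simp: tops_def)
    define u where "u = takeWhile (\<lambda>x. x \<noteq> delim) R"
    define rest where "rest = dropWhile (\<lambda>x. x \<noteq> delim) R"
    have u: "delim \<notin> set u" using set_takeWhileD unfolding u_def by fast
    have rest: "rest = [] \<or> hd rest = delim" using hd_dropWhile[of "\<lambda>x. x \<noteq> delim" R] by (auto simp: rest_def)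
    have w_eq: "rev w = delim # u @ rest" by (simp add: R u_def rest_def)
    have "set (rev w) \<subseteq> T" using w by simp
    then have sub: "set u \<subseteq> T" "set rest \<subseteq> T" unfolding w_eq by auto
    have "length (rev w) = Suc (length u + length rest)" unfolding w_eq by simp
    then have len: "Suc (length u) \<le> ?l" "length rest \<le> ?l" by auto
    interpret solver_instance T mul unit_of inverse_of delim "delim # u" "Suc (length u)" ?l
      using sub delim len by unfold_locales (auto simp: power_carrier_def)
    have "accepted w \<longleftrightarrow> solution rest"
    proof
      assume "accepted w"
      then obtain u' vs where *: "rev w = delim # u' @ concat vs" "delim \<notin> set u'"
        "\<forall>v\<in>set vs. v \<in> power_carrier T (Suc (length u')) \<and>
          (\<forall>j<Suc (length u'). (v ! j = delim) = ((delim # u') ! j = delim))"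
        "delim # u' \<in> generated (map2 mul) (set vs)"
        unfolding accepted_def by blast
      \<comment> \<open>What follows the target starts with a delimiter, so \<open>u'\<close> is the
        longest delimiter-free prefix, which is where the program stops reading the target.\<close>
      have "concat vs = [] \<or> hd (concat vs) = delim"
      proof (cases vs)
        case (Cons v vs')
        then have "length v = Suc (length u')" "v ! 0 = delim"
          using *(3) by (auto simp: power_carrier_def)
        then show ?thesis using Cons by (cases v) auto
      qed simp
      then have "takeWhile (\<lambda>x. x \<noteq> delim) (u' @ concat vs) = u'"
      proof -
        assume hd: "concat vs = [] \<or> hd (concat vs) = delim"
        have "takeWhile (\<lambda>x. x \<noteq> delim) (u' @ concat vs) = u' @ takeWhile (\<lambda>x. x \<noteq> delim) (concat vs)"
          using *(2) by (intro takeWhile_append2) auto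
        moreover have "takeWhile (\<lambda>x. x \<noteq> delim) ys = []" if "ys = [] \<or> hd ys = delim" for ys
          using that by (cases ys) auto
        ultimately show ?thesis using hd by simp
      qed
      moreover have "u' @ concat vs = R" using *(1) R by simp
      ultimately have "u' = u" "concat vs = rest"
        using w_eq R by (auto simp: u_def)
      then show "solution rest"
        using * unfolding solution_def parses_def well_shaped_def by blast
    next
      assume "solution rest"
      then show "accepted w"
        using w_eq u unfolding solution_def parses_def well_shaped_def accepted_def by blast
    qed
    then have "wp solve_cmd (solve_time ?l) ?Post
        (conf (delim # u) (map Letter rest) (replicate (Suc (length u)) (Aux 0)) [] [] [] [] [] [])"
      using wp_solve[OF sub(2) len(2) order_refl] by simp
    then show "wp (Seq load_target solve_cmd) (6 * ?l + 14 + solve_time ?l) ?Post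
        ((\<lambda>_. [])(2 := map Letter (rev w)))"
      unfolding w_eq using len(1)
      by - (rule wp_Seq[where m = "6 * ?l + 10" and n = "solve_time ?l"],
          rule wp_mono[OF wp_load_target[OF u rest order_refl]], auto)
  next
    assume "tops ((\<lambda>_. [])(2 := map Letter (rev w))) 2 \<noteq> Letter delim"
    then have "\<not> accepted w"
      unfolding accepted_def tops_def by fastforce
    then show "wp skip (6 * ?l + 14 + solve_time ?l) ?Post ((\<lambda>_. [])(2 := map Letter (rev w)))"
      by (intro wp_skip) (auto simp: tops_def)
  qed simp
  then show ?thesis
    unfolding program_def
    by - (rule wp_Seq[where m = "3 * ?l + 1" and n = "6 * ?l + 15 + solve_time ?l"],
        rule wp_mono[OF wp_reverse_input], auto simp: program_time_def)
qed

section \<open>Alphabet and well-formedness\<close>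

definition alphabet :: "'b tape_symbol set" where
  "alphabet = {Blank, Aux 0, Aux 1, Aux 2} \<union> Letter ` T"

lemma letter_in: "s \<in> alphabet \<Longrightarrow> letter s \<in> T"
  using delim by (auto simp: alphabet_def letter_def)

lemma Letter_in: "x \<in> T \<Longrightarrow> Letter x \<in> alphabet"
  by (simp add: alphabet_def)

lemma alphabet_simps [simp]:
  "Blank \<in> alphabet" "Aux 0 \<in> alphabet" "Aux 1 \<in> alphabet"
  "Aux (Suc 0) \<in> alphabet" "Aux 2 \<in> alphabet"
  by (auto simp: alphabet_def)

lemma well_formed_put: "s < 22 \<Longrightarrow> x \<in> alphabet \<Longrightarrow> well_formed alphabet 22 (put s x)"
  by (auto simp: put_def)

text \<open>Stacks up to 7 have shadows up to 17, and the registers are 20 and 21, so all indices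
  touched stay below 22.\<close>

lemma well_formed_sweep:
  assumes D: "D \<subseteq> {1..7}"
    and h: "\<And>f c. f \<in> alphabet \<Longrightarrow> (\<And>r. c r \<in> alphabet) \<Longrightarrow> h f c \<in> alphabet"
    and out: "\<And>f c r v. (\<And>r. c r \<in> alphabet) \<Longrightarrow> out f r = Some v \<Longrightarrow> v c \<in> alphabet"
  shows "well_formed alphabet 22 (sweep D h out)"
proof -
  have D': "r \<in> D \<Longrightarrow> r \<le> 7" for r using D by auto
  have "op_symbols (forward D h t r) \<subseteq> alphabet \<and> (22 \<le> r \<longrightarrow> forward D h t r = Keep)"
    "op_symbols (backward D out t r) \<subseteq> alphabet \<and> (22 \<le> r \<longrightarrow> backward D out t r = Keep)"
    if "range t \<subseteq> alphabet" for t r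
  proof -
    have t: "t s \<in> alphabet" for s using that by auto
    show "op_symbols (forward D h t r) \<subseteq> alphabet \<and> (22 \<le> r \<longrightarrow> forward D h t r = Keep)"
      using t h[of "t 20" "\<lambda>s. if s \<in> D then t s else Blank"] D'[of r] D'[of "r - 10"]
      by (auto simp: forward_def)
    show "op_symbols (backward D out t r) \<subseteq> alphabet \<and> (22 \<le> r \<longrightarrow> backward D out t r = Keep)"
      using t out[of "\<lambda>s. if s \<in> D then t (s + 10) else Blank" "t 20" r] D'[of "r - 10"]
      by (auto simp: backward_def split: option.split)
  qed
  then show ?thesis by (auto simp: sweep_def well_formed_put)
qed

lemmas closed_in = letter_in Letter_in closed unit_closed inverse_closed

lemma well_formed_program: "well_formed alphabet 22 program"
proof -
  have flag: "first_nonzero d f c \<in> alphabet" "worst d f c \<in> alphabet"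
    if "d c \<in> alphabet" "f \<in> alphabet" for d f and c :: "nat \<Rightarrow> 'b tape_symbol"
    using that by (auto simp: first_nonzero_def worst_def)
  have checks: "compare c \<in> alphabet" "check_unit c \<in> alphabet" "grade c \<in> alphabet"
    "check_meet c \<in> alphabet" for c
    by (auto simp: compare_def check_unit_def grade_def check_meet_def)
  have "\<forall>c \<in> {pop_cmd, scan_cmd, restore_cmd, check_unit_cmd, insert_cmd, left_product_cmd,
      right_product_cmd, recall_cmd, collect_step, check_meet_cmd}. well_formed alphabet 22 c"
    unfolding pop_cmd_def scan_cmd_def restore_cmd_def check_unit_cmd_def insert_cmd_def
      left_product_cmd_def right_product_cmd_def recall_cmd_def collect_step_def check_meet_cmd_def
      ball_simps
    by (intro conjI TrueI; rule well_formed_sweep;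
        auto simp: copy_flag_def split: if_splits intro: flag checks intro!: closed_in)
  moreover have "well_formed alphabet 22 skip" by (simp add: skip_def)
  ultimately show ?thesis
    using well_formed_put
    by (auto simp: program_def reverse_input_def load_target_def pull_def solve_cmd_def close_cmd_def
        test_cmd_def extend_cmd_def reduce_cmd_def scan_loop_def scan_step_def restore_loop_def
        left_product_loop_def right_product_loop_def extend_unless_unit_def meet_and_close_def)
qed

end

section \<open>Polynomial bounds\<close>

definition polynomial_fun :: "(nat \<Rightarrow> nat) \<Rightarrow> bool" where
  "polynomial_fun g \<longleftrightarrow> (\<exists>p. g = poly p)"

lemma polynomial_fun_intros:
  "polynomial_fun (\<lambda>n. n)" "polynomial_fun (\<lambda>n. c)"
  "polynomial_fun g \<Longrightarrow> polynomial_fun h \<Longrightarrow> polynomial_fun (\<lambda>n. g n + h n)"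
  "polynomial_fun g \<Longrightarrow> polynomial_fun h \<Longrightarrow> polynomial_fun (\<lambda>n. g n * h n)"
  "polynomial_fun g \<Longrightarrow> polynomial_fun (\<lambda>n. Suc (g n))"
proof -
  show "polynomial_fun (\<lambda>n. n)" unfolding polynomial_fun_def by (intro exI[of _ "[:0, 1:]"]) auto
  show "polynomial_fun (\<lambda>n. c)" unfolding polynomial_fun_def by (intro exI[of _ "[:c:]"]) auto
  show "polynomial_fun (\<lambda>n. g n + h n)" "polynomial_fun (\<lambda>n. g n * h n)"
    if gh: "polynomial_fun g" "polynomial_fun h"
  proof -
    obtain p q where "g = poly p" "h = poly q" using gh unfolding polynomial_fun_def by blast
    then have "(\<lambda>n. g n + h n) = poly (p + q)" "(\<lambda>n. g n * h n) = poly (p * q)"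
      by (simp_all add: fun_eq_iff)
    then show "polynomial_fun (\<lambda>n. g n + h n)" "polynomial_fun (\<lambda>n. g n * h n)"
      unfolding polynomial_fun_def by blast+
  qed
  show "polynomial_fun (\<lambda>n. Suc (g n))" if g: "polynomial_fun g"
  proof -
    obtain p where "g = poly p" using g unfolding polynomial_fun_def by blast
    then have "(\<lambda>n. Suc (g n)) = poly (p + 1)" by (simp add: fun_eq_iff)
    then show ?thesis unfolding polynomial_fun_def by blast
  qed
qed

text \<open>The cardinality of \<open>T\<close> enters as a constant, since the semigroup is not
  part of the input.\<close>

lemma (in solver) polynomial_program_time: "polynomial_fun program_time"
  unfolding program_time_def[abs_def] solve_time_def close_time_def close_body_time_def test_time_def
    extend_time_def reduce_time_def pass_time_def table_bound_def
  by (intro polynomial_fun_intros)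

section \<open>Encoded instances and accepted words\<close>

lemma rev_encode_instance: "rev (encode_instance as b) = block b @ concat (map block (rev as))"
  by (simp add: encode_instance_def rev_concat rev_map block_def[abs_def] o_def)

lemma block_cases:
  assumes "v ! 0 = None" "length v = Suc n" "\<And>j. 0 < j \<Longrightarrow> j < Suc n \<Longrightarrow> v ! j \<noteq> None"
  shows "\<exists>a. v = block a"
proof -
  obtain t where v: "v = None # t" using assms(1,2) by (cases v) auto
  have "t ! j \<noteq> None" if "j < n" for j using assms(3)[of "Suc j"] that v by simp
  then have "t = map Some (map the t)" using assms(2) v by (intro nth_equalityI) auto
  then have "v = block (rev (map the t))" using v by (simp add: block_eq rev_map)
  then show ?thesis ..
qed

lemma block_nth: "j < Suc (length a) \<Longrightarrow> block a ! j = None \<longleftrightarrow> j = 0"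
  by (cases j) (auto simp: block_eq rev_nth)

text \<open>Reversal turns an encoding into the target block followed by the generator blocks in
  opposite order. This does no harm, as coordinates are reversed in all tuples alike and only the
  set of generators matters.\<close>

lemma SMP_iff_accepted:
  assumes cl: "clifford S f e i" and fin: "finite S" and w: "w \<in> lists (smp_alphabet S)"
  shows "w \<in> SMP S f \<longleftrightarrow> solver.accepted (smp_alphabet S) (option_mult S f) None w"
proof -
  interpret solver "smp_alphabet S" "option_mult S f" "option_map_on S e" "option_map_on S i" None
    by (intro solver.intro clifford_option[OF cl] solver_axioms.intro)
      (auto simp: smp_alphabet_def fin)
  show ?thesis
  proof
    assume "w \<in> SMP S f"
    then obtain n as b where *: "w = encode_instance as b" "set as \<subseteq> power_carrier S n"
      "b \<in> power_carrier S n" "b \<in> generated (map2 f) (set as)"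
      unfolding SMP_def by blast
    let ?u = "rev (map Some b)" and ?vs = "map block (rev as)"
    have b: "None # ?u = block b" by (simp add: block_eq)
    have len: "length ?u = n" using *(3) by (simp add: power_carrier_length)
    have "rev w = None # ?u @ concat ?vs"
      unfolding *(1) rev_encode_instance by (simp add: block_eq)
    moreover have "None \<notin> set ?u" by auto
    moreover have "\<forall>v\<in>set ?vs. v \<in> power_carrier (smp_alphabet S) (Suc (length ?u)) \<and>
        (\<forall>j<Suc (length ?u). (v ! j = None) = ((None # ?u) ! j = None))"
    proof
      fix v
      assume "v \<in> set ?vs"
      then obtain a where a: "v = block a" "a \<in> power_carrier S n" using *(2) by auto
      then show "v \<in> power_carrier (smp_alphabet S) (Suc (length ?u)) \<and>
        (\<forall>j<Suc (length ?u). (v ! j = None) = ((None # ?u) ! j = None))"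
        unfolding b len using block_nth[of _ a] block_nth[of _ b] *(3)
        by (auto simp: block_power_carrier power_carrier_length)
    qed
    moreover have "None # ?u \<in> generated (map2 (option_mult S f)) (set ?vs)"
      unfolding b using block_generated[OF cl *(2), of b] *(4) by simp
    ultimately show "accepted w" unfolding accepted_def by blast
  next
    assume "accepted w"
    then obtain u vs where *: "rev w = None # u @ concat vs" "None \<notin> set u"
      "\<forall>v\<in>set vs. v \<in> power_carrier (smp_alphabet S) (Suc (length u)) \<and>
         (\<forall>j<Suc (length u). (v ! j = None) = ((None # u) ! j = None))"
      "None # u \<in> generated (map2 (option_mult S f)) (set vs)"
      unfolding accepted_def by blast
    define n where "n = length u"
    have u: "(None # u) ! j = None \<longleftrightarrow> j = 0" if "j < Suc n" for j
      using *(2) that by (cases j) (auto simp: n_def in_set_conv_nth)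
    have "\<exists>b. None # u = block b"
      by (rule block_cases[where n = n]) (simp_all only: u, simp_all add: n_def)
    then obtain b where b: "None # u = block b" ..
    have "set (rev w) \<subseteq> smp_alphabet S" using w by auto
    then have "None # u \<in> power_carrier (smp_alphabet S) (Suc n)"
      unfolding *(1) by (auto simp: power_carrier_def n_def)
    then have b_n: "b \<in> power_carrier S n" unfolding b by (simp add: block_power_carrier)
    have "\<forall>v\<in>set vs. \<exists>a. v = block a"
    proof
      fix v
      assume "v \<in> set vs"
      then have "length v = Suc n" "\<And>j. j < Suc n \<Longrightarrow> v ! j = None \<longleftrightarrow> j = 0"
        using *(3) u by (auto simp: n_def power_carrier_length)
      then show "\<exists>a. v = block a" using block_cases[of v n] by auto
    qed
    then have "\<exists>as. vs = map block as" by (simp add: ex_map_conv)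
    then obtain as where as: "vs = map block as" ..
    have as_n: "set as \<subseteq> power_carrier S n"
    proof
      fix a
      assume "a \<in> set as"
      then have "block a \<in> power_carrier (smp_alphabet S) (Suc n)" using *(3) by (simp add: as n_def)
      then show "a \<in> power_carrier S n" by (simp only: block_power_carrier)
    qed
    have "rev w = rev (encode_instance (rev as) b)"
      unfolding rev_encode_instance using *(1) b as by simp
    then have "w = encode_instance (rev as) b" by simp
    moreover have "b \<in> generated (map2 f) (set (rev as))"
      using block_generated[OF cl as_n, of b] *(4) by (simp add: as b)
    ultimately show "w \<in> SMP S f"
      unfolding SMP_def using as_n b_n
      by (intro CollectI exI[of _ n] exI[of _ "rev as"] exI[of _ b]) simp
  qed
qed

theorem corollary4p9:
  fixes S :: "'a set" and f :: "'a \<Rightarrow> 'a \<Rightarrow> 'a"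
  assumes "finite S" and "clifford_semigroup_on S f"
  shows "SMP S f \<in> class_P (smp_alphabet S)"
proof -
  obtain e i where cl: "clifford S f e i"
    using clifford_semigroup_on_clifford[OF assms(2)] .
  interpret solver "smp_alphabet S" "option_mult S f" "option_map_on S e" "option_map_on S i" None
    by (intro solver.intro clifford_option[OF cl] solver_axioms.intro)
      (auto simp: smp_alphabet_def assms(1))
  obtain p where p: "program_time = poly p"
    using polynomial_program_time unfolding polynomial_fun_def by blast
  show ?thesis
  \<comment> \<open>The data stacks are 0 to 7, their shadows 11 to 17, the registers 20 and 21,
    hence 22 tapes. Acceptance is read from register 20, the outcome of the last sweep.\<close>
  proof (rule program_in_class_P[where \<Gamma> = alphabet and K = 22 and c = program and T = p and
        accepting = "\<lambda>t. t 20 = Aux 0"])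
    show "finite alphabet" using finite_T by (simp add: alphabet_def)
    show "Letter ` smp_alphabet S \<subseteq> alphabet" by (auto intro: Letter_in)
    show "SMP S f \<subseteq> lists (smp_alphabet S)"
    proof
      fix w
      assume "w \<in> SMP S f"
      then obtain n as b where "w = encode_instance as b" "set as \<subseteq> power_carrier S n"
        "b \<in> power_carrier S n"
        unfolding SMP_def by blast
      then have "w = concat (map encode_tuple (as @ [b]))" "\<forall>x\<in>set (as @ [b]). set x \<subseteq> S"
        by (auto simp: encode_instance_def power_carrier_def)
      then have "set w = (\<Union>x\<in>set (as @ [b]). insert None (Some ` set x))"
        "\<forall>x\<in>set (as @ [b]). insert None (Some ` set x) \<subseteq> smp_alphabet S"
        by (auto simp: smp_alphabet_def encode_tuple_def)
      then have "set w \<subseteq> smp_alphabet S" by blast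
      then show "w \<in> lists (smp_alphabet S)" by auto
    qed
  next
    fix w
    assume w: "w \<in> lists (smp_alphabet S)"
    then have "set w \<subseteq> smp_alphabet S" by auto
    from wp_program[OF this]
    show "wp program (poly p (length w)) (\<lambda>\<sigma>. tops \<sigma> 20 = Aux 0 \<longleftrightarrow> w \<in> SMP S f) (input_store w)"
      unfolding SMP_iff_accepted[OF cl assms(1) w] p .
  qed (use well_formed_program in simp_all)
qed

end
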